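(* Let $\beta>0$, let $\mathsf T$ be a directed tree with $\ell$ leaves, and assume that $0<\gamma<1/(2\ell)$. Let $\mathcal T_{n,\mathsf T}$ be the number of copies of $\mathsf T$ in the age-dependent random connection model on the torus of length $n$ with parameters $\gamma,\beta$. Then there exist constants $0<c_-<c_+<\infty$ such that $$c_-n\le\mathrm{Var}(\mathcal T_{n,\mathsf T})\le c_+n$$ for all $n\ge 1$, and, as $n\to\infty$, $$\frac{\mathcal T_{n,\mathsf T}-\mathbb E[\mathcal T_{n,\mathsf T}]}{\sqrt{\mathrm{Var}(\mathcal T_{n,\mathsf T})}}$$ converges in distribution to the standard normal distribution $\mathcal N(0,1)$.
   Context: Age-dependent random connection model (ADRCM) on the torus. For $n\ge1$ let $\mathbb T_n=[-n/2,n/2]/\!\sim$ be the one-dimensional torus of length $n$ with toroidal distance $|x-y|_n=\min_{z\in\mathbb Z}|x-y+nz|$, and let $\overline{\mathbb T}_n=\mathbb T_n\times[0,1]$. Let $\mathcal P_n$ be a unit-intensity Poisson point process on $\overline{\mathbb T}_n$. For $p=(x,u)$ and $q=(y,v)$ with $u<v$, there is a directed edge $q\to p$ (from the point with higher mark to the point with lower mark) if and only if $|x-y|_n\le\beta u^{-\gamma}v^{\gamma-1}$. A directed tree $\mathsf T$ is a finite tree on a vertex set $\{1,\dots,m\}$ with a root $\mathsf r$, all edges being directed towards the root (each child points to its parent); a leaf is a vertex with no children, i.e. with no incoming edge. $\mathcal T_{n,\mathsf T}$ is the number of injective homomorphisms from $\mathsf T$ into the directed graph on $\mathcal P_n$,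 i.e. the number of tuples $(P_1,\dots,P_m)$ of pairwise distinct points of $\mathcal P_n$ such that $P_i\to P_j$ for every directed edge $i\to j$ of $\mathsf T$ (the copies need not be induced). *)

theory Defs
  imports "HOL-Probability.Probability"
begin

section \<open>Poisson point processes\<close>

text \<open>
  A Poisson point process with finite intensity measure \<open>\<nu>\<close>, realised as a random finite set of
  points; this is adequate for diffuse \<open>\<nu>\<close>, where the process is almost surely simple.
  The law is written out because \<^const>\<open>poisson_pmf\<close> is only specified for positive rates;
  for a null set \<open>A\<close> the formula gives the point mass at 0.
\<close>

locale poisson_point_process =
  prob_space M + intensity: finite_measure \<nu>
  for M :: "'w measure" and \<nu> :: "'a measure" and N :: "'w \<Rightarrow> 'a set" +
  assumes points_finite: "\<And>\<omega>. \<omega> \<in> space M \<Longrightarrow> finite (N \<omega>)"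
    and points_in_space: "\<And>\<omega>. \<omega> \<in> space M \<Longrightarrow> N \<omega> \<subseteq> space \<nu>"
    and count_measurable:
      "\<And>A. A \<in> sets \<nu> \<Longrightarrow> random_variable (count_space UNIV) (\<lambda>\<omega>. card (N \<omega> \<inter> A))"
    and count_poisson:
      "\<And>A k. A \<in> sets \<nu> \<Longrightarrow>
        prob {\<omega> \<in> space M. card (N \<omega> \<inter> A) = k}
          = measure \<nu> A ^ k / fact k * exp (- measure \<nu> A)"
    and count_indep:
      "\<And>(I :: nat set) A. finite I \<Longrightarrow> (\<And>i. i \<in> I \<Longrightarrow> A i \<in> sets \<nu>) \<Longrightarrow> disjoint_family_on A I \<Longrightarrow>
        indep_vars (\<lambda>_. count_space UNIV) (\<lambda>i \<omega>. card (N \<omega> \<inter> A i)) I"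

section \<open>The age-dependent random connection model on the torus\<close>

text \<open>
  The torus of length \<open>n\<close> is represented by the fundamental domain \<open>[-n/2, n/2)\<close>.
\<close>

definition torus_dist :: "real \<Rightarrow> real \<Rightarrow> real \<Rightarrow> real" where
  "torus_dist n x y = (INF z::int. \<bar>x - y + n * of_int z\<bar>)"

definition marked_torus :: "real \<Rightarrow> (real \<times> real) set" where
  "marked_torus n = {- n / 2 ..< n / 2} \<times> {0..1}"

definition unit_intensity :: "real \<Rightarrow> (real \<times> real) measure" where
  "unit_intensity n = restrict_space lborel (marked_torus n)"

text \<open>
  \<open>adrcm_edge n \<beta> \<gamma> q p\<close> is the edge \<open>q \<rightarrow> p\<close>. Since \<^term>\<open>0 powr a = (0::real)\<close>, the formula
  departs from the convention \<open>0 ^ (-\<gamma>) = \<infinity>\<close> only for points \<open>p\<close> of mark 0, which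
  almost surely do not occur.
\<close>

definition adrcm_edge :: "real \<Rightarrow> real \<Rightarrow> real \<Rightarrow> real \<times> real \<Rightarrow> real \<times> real \<Rightarrow> bool" where
  "adrcm_edge n \<beta> \<gamma> q p \<longleftrightarrow>
    snd p < snd q \<and>
    torus_dist n (fst p) (fst q) \<le> \<beta> * snd p powr (- \<gamma>) * snd q powr (\<gamma> - 1)"

section \<open>Directed trees\<close>

text \<open>
  Acyclicity is required of the underlying undirected graph. The notion \<open>tree\<close> of the AFP entry
  Graph-Theory is not suitable: on an orientation it excludes only directed cycles, and on a
  symmetric digraph it counts traversing an edge back and forth as a cycle.
\<close>

definition undirected_tree :: "'a set \<Rightarrow> ('a \<times> 'a) set \<Rightarrow> bool" where
  "undirected_tree V S \<longleftrightarrow>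
    finite V \<and> V \<noteq> {} \<and> S \<subseteq> V \<times> V \<and> sym S \<and> irrefl S \<and>
    (\<forall>x\<in>V. \<forall>y\<in>V. (x, y) \<in> S\<^sup>*) \<and>
    \<not> (\<exists>c. 3 \<le> length c \<and> distinct c \<and>
        (\<forall>i < length c. (c ! i, c ! ((i + 1) mod length c)) \<in> S))"

text \<open>
  A pair \<open>(i, j)\<close> in \<open>E\<close> is the edge from the child \<open>i\<close> to its parent \<open>j\<close>.
  The condition \<^term>\<open>E \<inter> E\<inverse> = {}\<close> says that every undirected edge carries one direction, and
  the last conjunct that these directions point towards the root \<open>r\<close>.
\<close>

definition directed_tree :: "nat \<Rightarrow> nat \<Rightarrow> (nat \<times> nat) set \<Rightarrow> bool" where
  "directed_tree m r E \<longleftrightarrow>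
    undirected_tree {1..m} (E \<union> E\<inverse>) \<and> E \<inter> E\<inverse> = {} \<and>
    r \<in> {1..m} \<and> (\<forall>v\<in>{1..m}. (v, r) \<in> E\<^sup>*)"

definition num_leaves :: "nat \<Rightarrow> (nat \<times> nat) set \<Rightarrow> nat" where
  "num_leaves m E = card {v \<in> {1..m}. \<not> (\<exists>w. (w, v) \<in> E)}"

definition tree_count ::
  "real \<Rightarrow> real \<Rightarrow> real \<Rightarrow> nat \<Rightarrow> (nat \<times> nat) set \<Rightarrow> (real \<times> real) set \<Rightarrow> nat" where
  "tree_count n \<beta> \<gamma> m E X =
    card {P \<in> {1..m} \<rightarrow>\<^sub>E X. inj_on P {1..m} \<and>
      (\<forall>(i, j) \<in> E. adrcm_edge n \<beta> \<gamma> (P i) (P j))}"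

end

theory Submission
  imports Defs
begin

text \<open>
  By the multivariate Mecke formula, the variance of \<open>T = T\<^sub>n\<close> is the sum, over all ways in which
  two copies of the tree can share at least one vertex, of the intensity measure of such glued
  pairs. The pairs of equal copies contribute the mean, of order \<open>n\<close>. For the upper bound, a glued
  pair is explored along a spanning tree; integrating out the positions leaves a product of
  powers of the marks, in which each copy with root mark \<open>u\<close> contributes at most
  \<open>u powr (- \<gamma> * \<ell>)\<close>, by telescoping along the \<open>\<ell>\<close> branches of the tree. If the roots differ, the
  shared vertex \<open>s\<close> costs a further factor \<open>1 / u\<^sub>s\<close>, which is split evenly between the two roots.
  The remaining integrals converge because \<open>\<gamma> * \<ell> + 1 / 2 < 1\<close>.

  The same estimate shows that copies which are not contained in one of the consecutive blocks of
  length \<open>L\<close> contribute at most \<open>\<eta> n\<close> to the variance, where \<open>\<eta> \<rightarrow> 0\<close> as \<open>L \<rightarrow> \<infinity>\<close>. The counts in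
  the blocks are independent and identically distributed, so the central limit theorem for such
  sums and the Levy continuity theorem apply.
\<close>

section \<open>Directed trees\<close>

text \<open>All points of a glued pair have to be integrated along one tree that hangs from the root
  of the first copy, because the position and the mark of this root are what the block approximation
  restricts. The second copy is therefore entered at a shared vertex. On the way up to its own root
  the point that is integrated out is the parent, whereas the radius still carries the inverse mark
  of the child; this mismatch is the source of the extra factor at the shared vertex, and sharing
  that factor between two roots is what makes 1/2 the threshold for \<gamma> times the number of
  leaves. The strict inequality leaves a slack, cut into shares \<delta>. One share per vertex makes
  the marks integrable; a spare one at the first root yields a factor
  \<open>\<kappa> powr \<delta>\<close> when its mark is at most \<kappa>. This controls long edges,
  which force a small root mark. The process is known only through its counts. Hence the moment
  formula is built from counts in disjoint cells, and blocks belonging to different torus lengths,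
  on unrelated probability spaces, are compared through the uniqueness of the law of a Poisson
  process.\<close>

lemma rtrancl_simple_path:
  assumes "(x, y) \<in> S\<^sup>*"
  obtains c where "distinct c" "c \<noteq> []" "hd c = x" "last c = y"
    "\<And>i. Suc i < length c \<Longrightarrow> (c ! i, c ! Suc i) \<in> S"
proof -
  define n where "n = (LEAST n. (x, y) \<in> S ^^ n)"
  have n: "(x, y) \<in> S ^^ n"
    unfolding n_def using rtrancl_imp_relpow[OF assms] by (metis LeastI)
  have least: "\<not> (x, y) \<in> S ^^ k" if "k < n" for k
    using that unfolding n_def by (rule not_less_Least)
  from n obtain f where f: "f 0 = x" "f n = y" "\<And>i. i < n \<Longrightarrow> (f i, f (Suc i)) \<in> S"
    by (auto simp: relpow_fun_conv)
  \<comment> \<open>In a walk with the least number of steps, the part between two visits to the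
    same vertex could be cut out.\<close>
  have inj: "f i \<noteq> f j" if "i < j" "j \<le> n" for i j
  proof
    assume eq: "f i = f j"
    have "(x, f i) \<in> S ^^ i"
      using f that by (auto simp: relpow_fun_conv intro!: exI[of _ f])
    moreover have "(f j, y) \<in> S ^^ (n - j)"
      using f that by (auto simp: relpow_fun_conv intro!: exI[of _ "\<lambda>k. f (j + k)"])
    ultimately have "(x, y) \<in> S ^^ (i + (n - j))"
      using eq by (auto simp: relpow_add)
    moreover have "i + (n - j) < n" using that by linarith
    ultimately show False using least by blast
  qed
  have "inj_on f {0..<Suc n}"
  proof (rule inj_onI)
    fix i j assume "i \<in> {0..<Suc n}" "j \<in> {0..<Suc n}" "f i = f j"
    then show "i = j" using inj[of i j] inj[of j i] by (cases i j rule: linorder_cases) auto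
  qed
  then have 1: "distinct (map f [0..<Suc n])" by (simp add: distinct_map del: upt_Suc)
  show ?thesis
  proof (rule that[OF 1])
    show "hd (map f [0..<Suc n]) = x" using f by (simp add: hd_map del: upt_Suc)
    show "last (map f [0..<Suc n]) = y" using f by simp
    show "(map f [0..<Suc n] ! i, map f [0..<Suc n] ! Suc i) \<in> S"
      if "Suc i < length (map f [0..<Suc n])" for i
      using that f(3)[of i] by (simp del: upt_Suc)
  qed simp
qed

text \<open>A simple path from \<open>x\<close> to \<open>y\<close> that avoids this edge would be
  closed by it to a forbidden cycle.\<close>

lemma undirected_tree_bridge:
  assumes T: "undirected_tree V S" and xy: "(x, y) \<in> S"
  shows "(x, y) \<notin> (S - {(x, y), (y, x)})\<^sup>*"
proof
  assume "(x, y) \<in> (S - {(x, y), (y, x)})\<^sup>*"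
  then obtain c where c: "distinct c" "c \<noteq> []" "hd c = x" "last c = y"
    "\<And>i. Suc i < length c \<Longrightarrow> (c ! i, c ! Suc i) \<in> S - {(x, y), (y, x)}"
    by (rule rtrancl_simple_path) blast
  have "x \<noteq> y" using T xy by (auto simp: undirected_tree_def irrefl_def)
  have c0: "c ! 0 = x" using c by (simp add: hd_conv_nth)
  have cl: "c ! (length c - 1) = y" using c by (simp add: last_conv_nth)
  have "length c \<noteq> 0" using c by simp
  moreover have "length c \<noteq> 1" using c0 cl \<open>x \<noteq> y\<close> by auto
  \<comment> \<open>A path on two vertices would consist of the removed edge itself.\<close>
  moreover have "length c \<noteq> 2" using c(5)[of 0] c0 cl by auto
  ultimately have l: "3 \<le> length c" by linarith
  have "(c ! i, c ! ((i + 1) mod length c)) \<in> S" if "i < length c" for i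
  proof (cases "Suc i < length c")
    case True
    then show ?thesis using c(5)[of i] by auto
  next
    case False
    then have "i = length c - 1" "Suc i = length c" using that by auto
    then show ?thesis using cl c0 xy T by (auto simp: undirected_tree_def sym_def)
  qed
  then show False using T l c(1) unfolding undirected_tree_def by blast
qed

text \<open>A directed path from \<open>b\<close> to \<open>a\<close> can be stopped at its first
  visit to \<open>a\<close>, so it avoids the edge from \<open>a\<close> to \<open>b\<close>. It
  contains no step from \<open>b\<close> to \<open>a\<close> either, as every edge has one
  direction. This contradicts the bridge property.\<close>

lemma directed_tree_acyclic:
  assumes "directed_tree m r E" and ab: "(a, b) \<in> E"
  shows "(b, a) \<notin> E\<^sup>*"
proof
  assume ba: "(b, a) \<in> E\<^sup>*"
  have "(x, a) \<in> (E - {(a, b)})\<^sup>*" if "(x, a) \<in> E\<^sup>*" for x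
    using that
  proof (induction rule: converse_rtrancl_induct)
    case (step y z)
    show ?case
    proof (cases "(y, z) = (a, b)")
      case False
      then have "(y, z) \<in> E - {(a, b)}" using step by auto
      then show ?thesis using step by (meson converse_rtrancl_into_rtrancl)
    qed auto
  qed simp
  note this[OF ba]
  moreover have T: "undirected_tree {1..m} (E \<union> E\<inverse>)" "E \<inter> E\<inverse> = {}"
    using assms by (auto simp: directed_tree_def)
  have "E - {(a, b)} \<subseteq> (E \<union> E\<inverse>) - {(b, a), (a, b)}"
    using T ab by auto
  ultimately have "(b, a) \<in> ((E \<union> E\<inverse>) - {(b, a), (a, b)})\<^sup>*"
    using rtrancl_mono by blast
  then show False using undirected_tree_bridge[OF T(1), of b a] ab by auto
qed

text \<open>With two parents \<open>p\<close> and \<open>q\<close>, both reach the root without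
  passing through \<open>v\<close> again, and the detour from \<open>v\<close> over \<open>q\<close>
  and the root to \<open>p\<close> bypasses the edge between \<open>v\<close> and
  \<open>p\<close>.\<close>

lemma directed_tree_unique_parent:
  assumes D: "directed_tree m r E" and p: "(v, p) \<in> E" "(v, q) \<in> E"
  shows "p = q"
proof (rule ccontr)
  assume "p \<noteq> q"
  have T: "undirected_tree {1..m} (E \<union> E\<inverse>)" "E \<inter> E\<inverse> = {}"
    and reach: "\<And>v. v \<in> {1..m} \<Longrightarrow> (v, r) \<in> E\<^sup>*"
    using D by (auto simp: directed_tree_def)
  have V: "p \<in> {1..m}" "q \<in> {1..m}"
    using T p by (auto simp: undirected_tree_def)
  define E' where "E' = E - {(v, p)}"
  \<comment> \<open>Only a path that visits \<open>v\<close> can use the edge from \<open>v\<close>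
    to \<open>p\<close>.\<close>
  have *: "(x, r) \<in> E'\<^sup>* \<or> (x, v) \<in> E\<^sup>*" if "(x, r) \<in> E\<^sup>*" for x
    using that
  proof (induction rule: converse_rtrancl_induct)
    case (step x y)
    show ?case
    proof (cases "x = v")
      case False
      then have "(x, y) \<in> E'" using step by (auto simp: E'_def)
      then show ?thesis using step by (meson converse_rtrancl_into_rtrancl)
    qed auto
  qed simp
  have "(p, r) \<in> E'\<^sup>*" "(q, r) \<in> E'\<^sup>*"
    using *[OF reach] V directed_tree_acyclic[OF D] p by blast+
  moreover have sub: "E' \<union> E'\<inverse> \<subseteq> (E \<union> E\<inverse>) - {(v, p), (p, v)}"
    using T p by (auto simp: E'_def)
  ultimately have "(q, r) \<in> (E' \<union> E'\<inverse>)\<^sup>*" "(r, p) \<in> (E' \<union> E'\<inverse>)\<^sup>*"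
    by (meson in_rtrancl_UnI, metis converse_iff rtrancl_converse in_rtrancl_UnI)
  moreover have "(v, q) \<in> E' \<union> E'\<inverse>" using p \<open>p \<noteq> q\<close> by (auto simp: E'_def)
  ultimately have "(v, p) \<in> (E' \<union> E'\<inverse>)\<^sup>*"
    by (meson converse_rtrancl_into_rtrancl rtrancl_trans)
  then have "(v, p) \<in> ((E \<union> E\<inverse>) - {(v, p), (p, v)})\<^sup>*"
    using rtrancl_mono[OF sub] by blast
  then show False using undirected_tree_bridge[OF T(1), of v p] p by auto
qed

text \<open>The form in which trees are used from here on: a parent map and a depth, so that
  statements about ancestors become inductions on \<open>dep\<close>. The bound by \<open>m\<close>
  separates the ranges of \<open>rank\<close> below and limits how far a copy extends from its
  root.\<close>

locale rooted_tree =
  fixes m r :: nat and pa dep :: "nat \<Rightarrow> nat"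
  assumes root_in: "r \<in> {1..m}"
    and pa_in: "v \<in> {1..m} \<Longrightarrow> v \<noteq> r \<Longrightarrow> pa v \<in> {1..m}"
    and dep_pa: "v \<in> {1..m} \<Longrightarrow> v \<noteq> r \<Longrightarrow> dep v = Suc (dep (pa v))"
    and dep_less: "v \<in> {1..m} \<Longrightarrow> dep v < m"
    and dep_root: "dep r = 0"

lemma directed_tree_rooted_tree:
  assumes D: "directed_tree m r E"
  obtains pa dep where "rooted_tree m r pa dep" "E = (\<lambda>v. (v, pa v)) ` ({1..m} - {r})"
proof -
  have T: "undirected_tree {1..m} (E \<union> E\<inverse>)" and r: "r \<in> {1..m}"
    and reach: "\<And>v. v \<in> {1..m} \<Longrightarrow> (v, r) \<in> E\<^sup>*"
    using D by (auto simp: directed_tree_def)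
  define pa where "pa v = (SOME w. (v, w) \<in> E)" for v
  define dep where "dep v = (LEAST n. (v, r) \<in> E ^^ n)" for v
  have E_sub: "E \<subseteq> {1..m} \<times> {1..m}" using T by (auto simp: undirected_tree_def)
  have out: "(v, pa v) \<in> E" if "v \<in> {1..m}" "v \<noteq> r" for v
  proof -
    have "\<exists>w. (v, w) \<in> E" using reach[OF that(1)] that(2) by (meson converse_rtranclE)
    then show ?thesis unfolding pa_def by (rule someI_ex)
  qed
  have noroot: "(r, w) \<notin> E" for w
    using directed_tree_acyclic[OF D, of r w] reach[of w] E_sub by auto
  have E_eq: "E = (\<lambda>v. (v, pa v)) ` ({1..m} - {r})"
  proof safe
    fix v w assume vw: "(v, w) \<in> E"
    then have "v \<in> {1..m}" "v \<noteq> r" using E_sub noroot by auto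
    then have "w = pa v" using directed_tree_unique_parent[OF D vw out] by simp
    then show "(v, w) \<in> (\<lambda>v. (v, pa v)) ` ({1..m} - {r})"
      using \<open>v \<in> {1..m}\<close> \<open>v \<noteq> r\<close> by auto
  qed (use out in auto)
  have pa: "pa v \<in> {1..m}" if "v \<in> {1..m}" "v \<noteq> r" for v
    using out[OF that] E_sub by auto
  have pow: "(v, r) \<in> E ^^ Suc n \<longleftrightarrow> (pa v, r) \<in> E ^^ n" if "v \<in> {1..m}" "v \<noteq> r" for v n
    using out[OF that] directed_tree_unique_parent[OF D _ out[OF that]]
    by (metis relpow_Suc_D2 relpow_Suc_I2)
  have d0: "dep r = 0" unfolding dep_def by (rule Least_eq_0) simp
  have ds: "dep v = Suc (dep (pa v))" if "v \<in> {1..m}" "v \<noteq> r" for v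
  proof -
    have "\<exists>n. (v, r) \<in> E ^^ n" using reach[OF that(1)] by (meson rtrancl_imp_relpow)
    then obtain n where n: "(v, r) \<in> E ^^ n" by blast
    have "dep v = Suc (LEAST n. (v, r) \<in> E ^^ Suc n)"
      unfolding dep_def by (rule Least_Suc[where P="\<lambda>n. (v, r) \<in> E ^^ n", OF n]) (use that in auto)
    then show ?thesis using pow[OF that] by (simp add: dep_def)
  qed
  \<comment> \<open>The ancestors of \<open>v\<close> attain every smaller depth, so
    \<open>dep v + 1\<close> distinct values occur among \<open>m\<close> vertices.\<close>
  have below: "\<exists>w\<in>{1..m}. dep w = k" if "v \<in> {1..m}" "k \<le> dep v" for v k
    using that
  proof (induction "dep v" arbitrary: v)
    case 0
    then show ?case by auto
  next
    case (Suc n)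
    then have "v \<noteq> r" using d0 by auto
    show ?case
    proof (cases "k = dep v")
      case False
      then show ?thesis
        using Suc(1)[of "pa v"] Suc ds[of v] pa[of v] \<open>v \<noteq> r\<close> by auto
    qed (use Suc in auto)
  qed
  have "dep v < m" if "v \<in> {1..m}" for v
  proof -
    have "{0..dep v} \<subseteq> dep ` {1..m}" using below[OF that] by fastforce
    then have "card {0..dep v} \<le> card (dep ` {1..m})" by (intro card_mono) auto
    also have "\<dots> \<le> card {1..m}" by (rule card_image_le) simp
    finally show ?thesis by simp
  qed
  then have "rooted_tree m r pa dep"
    using r pa ds d0 by unfold_locales auto
  then show thesis using that E_eq by blast
qed

section \<open>Leaf counts and telescoping along the branches\<close>

context rooted_tree
begin

definition leaves :: nat where
  "leaves = card {v \<in> {1..m}. \<not> (\<exists>w\<in>{1..m} - {r}. pa w = v)}"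

lemma leaves_eq:
  assumes "E = (\<lambda>v. (v, pa v)) ` ({1..m} - {r})"
  shows "num_leaves m E = leaves"
  unfolding num_leaves_def leaves_def assms by (rule arg_cong[where f=card]) auto

lemma root_le:
  assumes mono: "\<And>v. v \<in> {1..m} - {r} \<Longrightarrow> a (pa v) \<le> (a v :: real)" and "v \<in> {1..m}"
  shows "a r \<le> a v"
  using \<open>v \<in> {1..m}\<close>
proof (induction "dep v" arbitrary: v)
  case 0
  then show ?case using dep_pa by (cases "v = r") auto
next
  case (Suc n)
  then have "v \<noteq> r" using dep_root by auto
  then have "a r \<le> a (pa v)" using Suc dep_pa[of v] pa_in[of v] by auto
  also have "\<dots> \<le> a v" using mono Suc \<open>v \<noteq> r\<close> by auto
  finally show ?case .
qed

text \<open>Branching into \<open>c\<close> children creates \<open>c - 1\<close> further branches.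
  The subtraction is truncated at 0 for leaves; adding their number back turns each summand into
  \<open>c\<close>, and the numbers of children add up to \<open>m - 1\<close>.\<close>

lemma leaves_eq_sum:
  "leaves = 1 + (\<Sum>w\<in>{1..m}. card {v \<in> {1..m} - {r}. pa v = w} - 1)"
proof -
  let ?c = "\<lambda>w. card {v \<in> {1..m} - {r}. pa v = w}"
  let ?L = "{v \<in> {1..m}. \<not> (\<exists>w\<in>{1..m} - {r}. pa w = v)}"
  have m: "1 \<le> m" using root_in by simp
  have c0: "?c w = 0 \<longleftrightarrow> w \<in> ?L" if "w \<in> {1..m}" for w
    using that by (auto simp: card_eq_0_iff)
  have "(\<Sum>w\<in>{1..m}. ?c w) = card ({1..m} - {r})"
  proof -
    have "(\<Sum>w\<in>{1..m}. \<Sum>v\<in>{v \<in> {1..m} - {r}. pa v = w}. 1) = (\<Sum>v\<in>{1..m} - {r}. 1 :: nat)"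
      by (rule sum.group) (use pa_in in blast)+
    then show ?thesis by simp
  qed
  also have "\<dots> = m - 1" using root_in by simp
  finally have s: "(\<Sum>w\<in>{1..m}. ?c w) = m - 1" .
  have "(\<Sum>w\<in>{1..m}. ?c w) + card ?L = (\<Sum>w\<in>{1..m}. (?c w - 1) + 1)"
  proof -
    have "card ?L = (\<Sum>w\<in>{1..m}. if w \<in> ?L then 1 else 0)"
      by (subst sum.inter_filter[symmetric]) (auto simp: card_eq_sum simp del: sum_constant intro!: sum.cong)
    then have "(\<Sum>w\<in>{1..m}. ?c w) + card ?L = (\<Sum>w\<in>{1..m}. ?c w + (if w \<in> ?L then 1 else 0))"
      by (simp only: sum.distrib)
    also have "\<dots> = (\<Sum>w\<in>{1..m}. (?c w - 1) + 1)"
    proof (rule sum.cong[OF refl])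
      fix w assume "w \<in> {1..m}"
      from c0[OF this] show "?c w + (if w \<in> ?L then 1 else 0) = (?c w - 1) + 1"
        by (cases "?c w") (auto simp del: card_0_eq card_eq_0_iff)
    qed
    finally show ?thesis .
  qed
  also have "\<dots> = (\<Sum>w\<in>{1..m}. ?c w - 1) + m" by (simp only: sum.distrib) simp
  finally have "(m - 1) + leaves = (\<Sum>w\<in>{1..m}. ?c w - 1) + m"
    using s by (simp add: leaves_def)
  then show ?thesis using m by simp
qed

text \<open>After collecting terms, \<open>x w\<close> has the number of children of
  \<open>w\<close> minus 1 as its coefficient. The negative terms at the leaves are dropped, and
  elsewhere \<open>x w\<close> is at most \<open>x r\<close>. With x the negative logarithm of the
  marks, this gives the exponent \<gamma> times \<open>leaves\<close> at the root.\<close>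

lemma sum_parent_diff_le:
  fixes x :: "nat \<Rightarrow> real"
  assumes x: "\<And>v. v \<in> {1..m} \<Longrightarrow> 0 \<le> x v"
    and mono: "\<And>v. v \<in> {1..m} - {r} \<Longrightarrow> x v \<le> x (pa v)"
  shows "(\<Sum>v\<in>{1..m} - {r}. x (pa v) - x v) \<le> leaves * x r"
proof -
  let ?c = "\<lambda>w. card {v \<in> {1..m} - {r}. pa v = w}"
  have le: "x w \<le> x r" if "w \<in> {1..m}" for w
    using root_le[of "\<lambda>v. - x v" w] mono that by auto
  have "(\<Sum>v\<in>{1..m} - {r}. x (pa v)) = (\<Sum>w\<in>{1..m}. \<Sum>v\<in>{v \<in> {1..m} - {r}. pa v = w}. x (pa v))"
    by (rule sum.group[symmetric]) (use pa_in in blast)+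
  also have "\<dots> = (\<Sum>w\<in>{1..m}. ?c w * x w)" by (rule sum.cong) auto
  finally have 1: "(\<Sum>v\<in>{1..m} - {r}. x (pa v)) = (\<Sum>w\<in>{1..m}. ?c w * x w)" .
  have 2: "(\<Sum>v\<in>{1..m}. x v) = x r + (\<Sum>v\<in>{1..m} - {r}. x v)"
    by (rule sum.remove) (use root_in in auto)
  have "(\<Sum>v\<in>{1..m} - {r}. x (pa v) - x v) = (\<Sum>w\<in>{1..m}. ?c w * x w - x w) + x r"
    using 1 2 by (simp add: sum_subtractf)
  also have "(\<Sum>w\<in>{1..m}. ?c w * x w - x w) \<le> (\<Sum>w\<in>{1..m}. real (?c w - 1) * x r)"
  proof (rule sum_mono)
    fix w assume w: "w \<in> {1..m}"
    show "?c w * x w - x w \<le> real (?c w - 1) * x r"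
    proof (cases "?c w")
      case 0
      show ?thesis unfolding 0 using x[OF w] by simp
    next
      case (Suc k)
      have "real k * x w \<le> real k * x r" using le[OF w] by (intro mult_left_mono) auto
      then show ?thesis unfolding Suc by (simp add: algebra_simps)
    qed
  qed
  also have "\<dots> + x r = leaves * x r"
    unfolding leaves_eq_sum sum_distrib_right[symmetric] by (simp add: algebra_simps)
  finally show ?thesis by simp
qed

end

section \<open>Factorial moments of a Poisson process\<close>

definition tuples :: "'i set \<Rightarrow> 'a set \<Rightarrow> ('i \<Rightarrow> 'a) set" where
  "tuples V X = {R \<in> V \<rightarrow>\<^sub>E X. inj_on R V}"

lemma finite_tuples: "finite V \<Longrightarrow> finite X \<Longrightarrow> finite (tuples V X)"
  unfolding tuples_def by (rule finite_subset[OF _ finite_PiE]) auto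

lemma poisson_mean_sums:
  fixes l :: real
  shows "(\<lambda>k. real k * (l ^ k / fact k * exp (- l))) sums l"
proof -
  have "(\<lambda>k. l * exp (- l) * (l ^ k / fact k)) sums (l * exp (- l) * exp l)"
    using exp_converges[of l] by (intro sums_mult) (simp add: field_simps scaleR_conv_of_real)
  moreover have "l * exp (- l) * (l ^ k / fact k) = real (Suc k) * (l ^ Suc k / fact (Suc k) * exp (- l))" for k
    by (simp add: field_simps del: of_nat_Suc)
  moreover have "l * exp (- l) * exp l = l" by (simp add: exp_minus)
  ultimately have "(\<lambda>k. real (Suc k) * (l ^ Suc k / fact (Suc k) * exp (- l))) sums l"
    by (simp only:)
  from sums_Suc[where f="\<lambda>k. real k * (l ^ k / fact k * exp (- l))", OF this]
  show ?thesis by simp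
qed

context poisson_point_process
begin

abbreviation count :: "'a set \<Rightarrow> 'w \<Rightarrow> nat" where
  "count A \<omega> \<equiv> card (N \<omega> \<inter> A)"

lemma count_measurable_borel[measurable]:
  "A \<in> sets \<nu> \<Longrightarrow> (\<lambda>\<omega>. of_nat (count A \<omega>) :: ennreal) \<in> borel_measurable M"
  using measurable_compose[OF count_measurable, of A of_nat borel] by simp

lemma nn_integral_count:
  assumes A: "A \<in> sets \<nu>"
  shows "(\<integral>\<^sup>+\<omega>. of_nat (count A \<omega>) \<partial>M) = emeasure \<nu> A"
proof -
  let ?l = "measure \<nu> A"
  let ?E = "\<lambda>k. {\<omega> \<in> space M. count A \<omega> = k}"
  have E[measurable]: "?E k \<in> sets M" for k
    using measurable_sets[OF count_measurable[OF A], of "{k}"] by (simp add: vimage_def Int_def conj_commute)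
  have "(\<integral>\<^sup>+\<omega>. of_nat (count A \<omega>) \<partial>M) = (\<integral>\<^sup>+\<omega>. (\<Sum>k. of_nat k * indicator (?E k) \<omega>) \<partial>M)"
  proof (rule nn_integral_cong)
    fix \<omega> assume w: "\<omega> \<in> space M"
    have "(\<Sum>k. of_nat k * indicator (?E k) \<omega> :: ennreal) = of_nat (count A \<omega>)"
      by (rule suminf_cmult_indicator) (use w in \<open>auto simp: disjoint_family_on_def\<close>)
    then show "of_nat (count A \<omega>) = (\<Sum>k. of_nat k * indicator (?E k) \<omega> :: ennreal)" by simp
  qed
  also have "\<dots> = (\<Sum>k. of_nat k * emeasure M (?E k))"
    by (subst nn_integral_suminf) (auto simp: nn_integral_cmult_indicator)
  also have "\<dots> = (\<Sum>k. ennreal (real k * (?l ^ k / fact k * exp (- ?l))))"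
    using count_poisson[OF A]
    by (intro arg_cong[where f=suminf] ext)
      (simp only: emeasure_eq_measure ennreal_mult'[OF of_nat_0_le_iff] ennreal_of_nat_eq_real_of_nat)
  also have "\<dots> = ennreal ?l"
    by (rule suminf_ennreal_eq) (use poisson_mean_sums in auto)
  finally show ?thesis by (simp add: intensity.emeasure_eq_measure)
qed

lemma nn_integral_prod_count:
  assumes V: "finite V" and A: "\<And>v. v \<in> V \<Longrightarrow> A v \<in> sets \<nu>" and "disjoint_family_on A V"
  shows "(\<integral>\<^sup>+\<omega>. (\<Prod>v\<in>V. of_nat (count (A (v :: nat)) \<omega>)) \<partial>M) = (\<Prod>v\<in>V. emeasure \<nu> (A v))"
proof -
  have "indep_vars (\<lambda>_. borel) (\<lambda>v \<omega>. of_nat (count (A v) \<omega>) :: ennreal) V"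
    using count_indep[OF assms] by (rule indep_vars_compose2) auto
  then have "(\<integral>\<^sup>+\<omega>. (\<Prod>v\<in>V. of_nat (count (A v) \<omega>)) \<partial>M)
      = (\<Prod>v\<in>V. \<integral>\<^sup>+\<omega>. of_nat (count (A v) \<omega>) \<partial>M)"
    by (intro indep_vars_nn_integral V) auto
  then show ?thesis using A by (simp add: nn_integral_count)
qed

text \<open>Expressed as a counting measure with values in \<open>ennreal\<close>, so that
  additivity and monotone limits in \<open>B\<close> are those of a measure.\<close>

definition tuple_count :: "nat set \<Rightarrow> (nat \<Rightarrow> 'a) set \<Rightarrow> 'w \<Rightarrow> ennreal" where
  "tuple_count V B \<omega> = emeasure (count_space UNIV) (tuples V (N \<omega>) \<inter> B)"

lemma tuple_count_mono: "B \<subseteq> B' \<Longrightarrow> tuple_count V B \<omega> \<le> tuple_count V B' \<omega>"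
  unfolding tuple_count_def by (intro emeasure_mono) auto

lemma tuple_count_eq_card:
  "finite V \<Longrightarrow> \<omega> \<in> space M \<Longrightarrow> tuple_count V B \<omega> = of_nat (card (tuples V (N \<omega>) \<inter> B))"
  unfolding tuple_count_def
  by (subst emeasure_count_space_finite) (auto simp: finite_tuples points_finite)

end

text \<open>A refining sequence of finite measurable partitions that separates points is all the
  structure of the underlying space that the moment formulas use.\<close>

locale separated_ppp = poisson_point_process M \<nu> N
  for M :: "'w measure" and \<nu> :: "'a measure" and N +
  fixes cell :: "nat \<Rightarrow> 'a \<Rightarrow> 'c"
  assumes cell_measurable: "\<And>k c. cell k -` {c} \<inter> space \<nu> \<in> sets \<nu>"
    and cell_finite: "\<And>k. finite (cell k ` space \<nu>)"
    and cell_refine: "\<And>k x y. cell (Suc k) x = cell (Suc k) y \<Longrightarrow> cell k x = cell k y"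
    and cell_separate: "\<And>x y. x \<noteq> y \<Longrightarrow> \<exists>k. cell k x \<noteq> cell k y"
    and diffuse: "\<And>x. emeasure \<nu> {x} = 0"
begin

sublocale product: product_sigma_finite "\<lambda>_ :: nat. \<nu>"
  by (rule product_sigma_finite.intro) (rule intensity.sigma_finite_measure_axioms)

lemma finite_measure_PiM: "finite (V :: nat set) \<Longrightarrow> emeasure (PiM V (\<lambda>_. \<nu>)) B < \<infinity>"
proof -
  assume V: "finite V"
  have "emeasure (PiM V (\<lambda>_. \<nu>)) B \<le> emeasure (PiM V (\<lambda>_. \<nu>)) (space (PiM V (\<lambda>_. \<nu>)))"
    by (rule emeasure_space)
  also have "\<dots> = (\<Prod>v\<in>V. emeasure \<nu> (space \<nu>))"
    unfolding space_PiM by (rule product.emeasure_PiM[OF V]) auto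
  also have "\<dots> < \<infinity>"
    using less_top[THEN iffD1, OF intensity.emeasure_finite[unfolded infinity_ennreal_def]]
    by (simp add: power_less_top_ennreal)
  finally show ?thesis .
qed

lemma cell_mono:
  assumes "k \<le> l" "cell l x = cell l y" shows "cell k x = cell k y"
  using assms by (induction l rule: dec_induct) (auto dest: cell_refine)

lemma diagonal_measurable:
  assumes v: "v \<in> V" "w \<in> V"
  shows "{R \<in> space (PiM V (\<lambda>_. \<nu>)). cell k (R v) = cell k (R w)} \<in> sets (PiM V (\<lambda>_. \<nu>))"
proof -
  have "{R \<in> space (PiM V (\<lambda>_. \<nu>)). cell k (R v) = cell k (R w)} =
    (\<Union>c\<in>cell k ` space \<nu>.
       ((\<lambda>R. R v) -` (cell k -` {c} \<inter> space \<nu>) \<inter> space (PiM V (\<lambda>_. \<nu>))) \<inter>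
       ((\<lambda>R. R w) -` (cell k -` {c} \<inter> space \<nu>) \<inter> space (PiM V (\<lambda>_. \<nu>))))"
    using v by (auto simp: space_PiM PiE_mem)
  moreover have "(\<lambda>R. R u) -` (cell k -` {c} \<inter> space \<nu>) \<inter> space (PiM V (\<lambda>_. \<nu>)) \<in> sets (PiM V (\<lambda>_. \<nu>))"
    if "u \<in> V" for u c
    using measurable_sets[OF measurable_component_singleton[OF that] cell_measurable] .
  ultimately show ?thesis
    using v cell_finite[of k] by (simp only:) (rule sets.finite_UN, assumption, rule sets.Int, simp_all only:)
qed

lemma diagonal_eq_INT:
  "{R \<in> space (PiM V (\<lambda>_. \<nu>)). R v = R w} =
   (\<Inter>k. {R \<in> space (PiM V (\<lambda>_. \<nu>)). cell k (R v) = cell k (R w)})"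
  using cell_separate by auto

text \<open>Integrating the coordinate \<open>v\<close> first leaves, for fixed other coordinates,
  the measure of the single point \<open>x w\<close>.\<close>

lemma diagonal_null:
  assumes V: "finite V" "v \<in> V" "w \<in> V" "(v :: nat) \<noteq> w"
  shows "{R \<in> space (PiM V (\<lambda>_. \<nu>)). R v = R w} \<in> null_sets (PiM V (\<lambda>_. \<nu>))"
proof -
  let ?D = "{R \<in> space (PiM V (\<lambda>_. \<nu>)). R v = R w}"
  define W where "W = V - {v}"
  have W: "V = insert v W" "finite W" "v \<notin> W" "w \<in> W" using V by (auto simp: W_def)
  have D: "?D \<in> sets (PiM V (\<lambda>_. \<nu>))"
    unfolding diagonal_eq_INT by (intro sets.countable_INT image_subsetI diagonal_measurable V) auto
  have "emeasure (PiM V (\<lambda>_. \<nu>)) ?D = (\<integral>\<^sup>+R. indicator ?D R \<partial>PiM V (\<lambda>_. \<nu>))"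
    using D by simp
  also have "\<dots> = (\<integral>\<^sup>+x. \<integral>\<^sup>+y. indicator ?D (x(v := y)) \<partial>\<nu> \<partial>PiM W (\<lambda>_. \<nu>))"
    using product.product_nn_integral_insert[of W v "indicator ?D", folded W(1)] D W by simp
  also have "\<dots> = (\<integral>\<^sup>+x. 0 \<partial>PiM W (\<lambda>_. \<nu>))"
  proof (rule nn_integral_cong)
    fix x assume x: "x \<in> space (PiM W (\<lambda>_. \<nu>))"
    have "(\<integral>\<^sup>+y. indicator ?D (x(v := y)) \<partial>\<nu>) = (\<integral>\<^sup>+y. indicator {x w} y \<partial>\<nu>)"
      using W x by (intro nn_integral_cong) (auto simp: indicator_def space_PiM PiE_iff extensional_def)
    also have "\<dots> = 0"
    proof (cases "{x w} \<in> sets \<nu>")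
      \<comment> \<open>A point is the intersection of its cells, so its singleton is measurable and
        this case is contradictory.\<close>
      case False
      have "x w \<in> space \<nu>" using x W by (auto simp: space_PiM)
      then have "{x w} = (\<Inter>k. cell k -` {cell k (x w)} \<inter> space \<nu>)"
        using cell_separate by (auto; blast)
      moreover have "(\<Inter>k. cell k -` {cell k (x w)} \<inter> space \<nu>) \<in> sets \<nu>"
        using cell_measurable by (intro sets.countable_INT) auto
      ultimately show ?thesis using False by simp
    qed (simp add: diffuse)
    finally show "(\<integral>\<^sup>+y. indicator ?D (x(v := y)) \<partial>\<nu>) = 0" .
  qed
  finally show ?thesis using D by (simp add: null_sets_def)
qed

definition off_diagonal :: "nat set \<Rightarrow> nat \<Rightarrow> (nat \<Rightarrow> 'a) set" where
  "off_diagonal V k = {R \<in> space (PiM V (\<lambda>_. \<nu>)). inj_on (\<lambda>v. cell k (R v)) V}"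

lemma off_diagonal_mono: "k \<le> l \<Longrightarrow> off_diagonal V k \<subseteq> off_diagonal V l"
  unfolding off_diagonal_def inj_on_def using cell_mono by blast

lemma off_diagonal_inj: "R \<in> off_diagonal V k \<Longrightarrow> inj_on R V"
  by (rule inj_on_imageI2[of "cell k"]) (simp add: off_diagonal_def comp_def)

lemma off_diagonal_measurable:
  assumes V: "finite V" shows "off_diagonal V k \<in> sets (PiM V (\<lambda>_. \<nu>))"
proof -
  have "off_diagonal V k = space (PiM V (\<lambda>_. \<nu>)) - (\<Union>v\<in>V. \<Union>w\<in>V - {v}.
      {R \<in> space (PiM V (\<lambda>_. \<nu>)). cell k (R v) = cell k (R w)})"
    by (auto simp: off_diagonal_def inj_on_def)
  also have "\<dots> \<in> sets (PiM V (\<lambda>_. \<nu>))"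
    using V by (intro sets.Diff sets.finite_UN diagonal_measurable) auto
  finally show ?thesis .
qed

text \<open>Each of the finitely many pairs is separated at some level; by refinement the largest of
  these levels separates all of them.\<close>

lemma UN_off_diagonal:
  assumes V: "finite V"
  shows "(\<Union>k. off_diagonal V k) = {R \<in> space (PiM V (\<lambda>_. \<nu>)). inj_on R V}"
proof safe
  fix R k assume "R \<in> off_diagonal V k"
  then show "R \<in> space (PiM V (\<lambda>_. \<nu>))" "inj_on R V" by (auto simp: off_diagonal_def inj_on_def)
next
  fix R assume R: "R \<in> space (PiM V (\<lambda>_. \<nu>))" "inj_on R V"
  define K where "K = (\<lambda>(v, w). SOME k. cell k (R v) \<noteq> cell k (R w))"
  have K: "cell (K (v, w)) (R v) \<noteq> cell (K (v, w)) (R w)" if "v \<in> V" "w \<in> V" "v \<noteq> w" for v w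
  proof -
    have "R v \<noteq> R w" using that R by (auto dest: inj_onD)
    from cell_separate[OF this] show ?thesis unfolding K_def prod.case by (rule someI_ex)
  qed
  define k where "k = Max (K ` (V \<times> V))"
  have "cell k (R v) \<noteq> cell k (R w)" if "v \<in> V" "w \<in> V" "v \<noteq> w" for v w
  proof -
    have "K (v, w) \<le> k" unfolding k_def using V that by (intro Max_ge) auto
    then show ?thesis using K[OF that] cell_mono by blast
  qed
  then have "R \<in> off_diagonal V k" using R by (auto simp: off_diagonal_def inj_on_def)
  then show "R \<in> (\<Union>k. off_diagonal V k)" by blast
qed

lemma AE_inj_on:
  assumes V: "finite (V :: nat set)" shows "AE R in PiM V (\<lambda>_. \<nu>). inj_on R V"
proof (rule AE_I')
  show "(\<Union>v\<in>V. \<Union>w\<in>V - {v}. {R \<in> space (PiM V (\<lambda>_. \<nu>)). R v = R w}) \<in> null_sets (PiM V (\<lambda>_. \<nu>))"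
    using V by (intro null_sets_UN' countable_finite diagonal_null[OF V]) auto
  show "{R \<in> space (PiM V (\<lambda>_. \<nu>)). \<not> inj_on R V} \<subseteq>
      (\<Union>v\<in>V. \<Union>w\<in>V - {v}. {R \<in> space (PiM V (\<lambda>_. \<nu>)). R v = R w})"
    by (auto simp: inj_on_def)
qed

text \<open>
  Tuples of distinct points are exhausted by the tuples with entries in distinct cells; the counts
  of the latter are products of independent counts.
\<close>

lemma factorial_moment_box:
  assumes V: "finite V" and A: "\<And>v. v \<in> V \<Longrightarrow> A v \<in> sets \<nu>"
  shows "tuple_count V (Pi\<^sub>E V A) \<in> borel_measurable M \<and>
    (\<integral>\<^sup>+\<omega>. tuple_count V (Pi\<^sub>E V A) \<omega> \<partial>M) = emeasure (PiM V (\<lambda>_. \<nu>)) (Pi\<^sub>E V A)"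
proof -
  let ?P = "PiM V (\<lambda>_. \<nu>)"
  \<comment> \<open>\<open>I k\<close> lists the assignments of distinct cells to the indices, and
    \<open>D k c v\<close> is the part of \<open>A v\<close> in its assigned cell. The sets
    \<open>A v\<close> may overlap, but these parts are disjoint, so independence of counts
    applies.\<close>
  define I where "I k = {c \<in> V \<rightarrow>\<^sub>E cell k ` space \<nu>. inj_on c V}" for k
  have finI: "finite (I k)" for k
    unfolding I_def using V cell_finite by (intro finite_subset[OF _ finite_PiE[of V "\<lambda>_. cell k ` space \<nu>"]]) auto
  define D where "D k c v = A v \<inter> (cell k -` {c v} \<inter> space \<nu>)" for k c and v :: nat
  have D[measurable]: "D k c v \<in> sets \<nu>" if "v \<in> V" for k c v
    unfolding D_def using A[OF that] cell_measurable by auto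
  have Dd: "disjoint_family_on (D k c) V" if "c \<in> I k" for k c
    using that by (auto simp: disjoint_family_on_def D_def I_def dest: inj_onD)
  have Dd2: "disjoint_family_on (\<lambda>c. X \<inter> Pi\<^sub>E V (D k c)) (I k)" for k X
  proof (unfold disjoint_family_on_def, intro ballI impI)
    fix c d assume c: "c \<in> I k" "d \<in> I k" "c \<noteq> d"
    then obtain v where v: "v \<in> V" "c v \<noteq> d v"
      unfolding I_def by (metis (no_types, lifting) PiE_ext mem_Collect_eq)
    have "c v = d v" if "R \<in> Pi\<^sub>E V (D k c)" "R \<in> Pi\<^sub>E V (D k d)" for R
    proof -
      have "R v \<in> D k c v" "R v \<in> D k d v" using that v by auto
      then show ?thesis by (auto simp: D_def)
    qed
    then show "(X \<inter> Pi\<^sub>E V (D k c)) \<inter> (X \<inter> Pi\<^sub>E V (D k d)) = {}"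
      using v(2) by blast
  qed
  have split: "off_diagonal V k \<inter> Pi\<^sub>E V A = (\<Union>c\<in>I k. Pi\<^sub>E V (D k c))" for k
  proof (intro equalityI subsetI)
    fix R assume "R \<in> off_diagonal V k \<inter> Pi\<^sub>E V A"
    then have R: "R \<in> off_diagonal V k" "R \<in> Pi\<^sub>E V A" by auto
    let ?c = "restrict (\<lambda>v. cell k (R v)) V"
    have "?c \<in> I k" using R by (auto simp: I_def off_diagonal_def space_PiM inj_on_def)
    moreover have "R \<in> Pi\<^sub>E V (D k ?c)"
      using R by (auto simp: D_def off_diagonal_def space_PiM PiE_iff)
    ultimately show "R \<in> (\<Union>c\<in>I k. Pi\<^sub>E V (D k c))" by blast
  next
    fix R assume "R \<in> (\<Union>c\<in>I k. Pi\<^sub>E V (D k c))"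
    then obtain c where R: "c \<in> I k" "R \<in> Pi\<^sub>E V (D k c)" by blast
    then show "R \<in> off_diagonal V k \<inter> Pi\<^sub>E V A"
      by (auto simp: D_def off_diagonal_def space_PiM PiE_iff I_def inj_on_def)
  qed
  have "PiE V A \<in> sets ?P" using V A by (intro sets_PiM_I_finite) auto
  then have boxes: "off_diagonal V k \<inter> Pi\<^sub>E V A \<in> sets ?P" for k
    using off_diagonal_measurable[OF V] by blast
  have tuples_eq: "tuples V (N \<omega>) \<inter> (off_diagonal V k \<inter> Pi\<^sub>E V A) =
      (\<Union>c\<in>I k. (V \<rightarrow>\<^sub>E N \<omega>) \<inter> Pi\<^sub>E V (D k c))" for k \<omega>
  proof -
    have "tuples V (N \<omega>) \<inter> (off_diagonal V k \<inter> Pi\<^sub>E V A) = (V \<rightarrow>\<^sub>E N \<omega>) \<inter> (off_diagonal V k \<inter> Pi\<^sub>E V A)"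
      using off_diagonal_inj by (auto simp: tuples_def)
    then show ?thesis unfolding split by blast
  qed
  have count_k: "tuple_count V (off_diagonal V k \<inter> Pi\<^sub>E V A) \<omega> =
      (\<Sum>c\<in>I k. \<Prod>v\<in>V. of_nat (count (D k c v) \<omega>))" if w: "\<omega> \<in> space M" for k \<omega>
  proof -
    have fin: "finite (N \<omega> \<inter> X)" for X using points_finite[OF w] by blast
    have "tuple_count V (off_diagonal V k \<inter> Pi\<^sub>E V A) \<omega> =
      (\<Sum>c\<in>I k. emeasure (count_space UNIV) ((V \<rightarrow>\<^sub>E N \<omega>) \<inter> Pi\<^sub>E V (D k c)))"
      unfolding tuple_count_def tuples_eq
      by (rule sum_emeasure[symmetric]) (use Dd2 finI in auto)
    also have "\<dots> = (\<Sum>c\<in>I k. \<Prod>v\<in>V. of_nat (count (D k c v) \<omega>))"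
    proof (rule sum.cong[OF refl])
      fix c
      have "(V \<rightarrow>\<^sub>E N \<omega>) \<inter> Pi\<^sub>E V (D k c) = Pi\<^sub>E V (\<lambda>v. N \<omega> \<inter> D k c v)" by auto
      then have "emeasure (count_space UNIV) ((V \<rightarrow>\<^sub>E N \<omega>) \<inter> Pi\<^sub>E V (D k c))
          = of_nat (card (Pi\<^sub>E V (\<lambda>v. N \<omega> \<inter> D k c v)))"
        by (simp add: emeasure_count_space_finite finite_PiE V fin)
      then show "emeasure (count_space UNIV) ((V \<rightarrow>\<^sub>E N \<omega>) \<inter> Pi\<^sub>E V (D k c)) = (\<Prod>v\<in>V. of_nat (count (D k c v) \<omega>))"
        by (simp add: card_PiE V)
    qed
    finally show ?thesis .
  qed
  have meas_k: "tuple_count V (off_diagonal V k \<inter> Pi\<^sub>E V A) \<in> borel_measurable M" for k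
    by (subst measurable_cong[OF count_k]) (auto intro!: borel_measurable_sum borel_measurable_prod)
  have int_k: "(\<integral>\<^sup>+\<omega>. tuple_count V (off_diagonal V k \<inter> Pi\<^sub>E V A) \<omega> \<partial>M)
      = emeasure ?P (off_diagonal V k \<inter> Pi\<^sub>E V A)" for k
  proof -
    have "(\<integral>\<^sup>+\<omega>. tuple_count V (off_diagonal V k \<inter> Pi\<^sub>E V A) \<omega> \<partial>M)
        = (\<Sum>c\<in>I k. \<integral>\<^sup>+\<omega>. (\<Prod>v\<in>V. of_nat (count (D k c v) \<omega>)) \<partial>M)"
      by (subst nn_integral_cong[OF count_k]) (auto intro!: nn_integral_sum borel_measurable_prod)
    also have "\<dots> = (\<Sum>c\<in>I k. emeasure ?P (Pi\<^sub>E V (D k c)))"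
      by (intro sum.cong refl) (simp add: nn_integral_prod_count V Dd product.emeasure_PiM)
    also have "\<dots> = emeasure ?P (\<Union>c\<in>I k. Pi\<^sub>E V (D k c))"
      using Dd2[of UNIV] V finI by (intro sum_emeasure) (auto intro!: sets_PiM_I_finite)
    finally show ?thesis unfolding split .
  qed
  have inc: "incseq (\<lambda>k. off_diagonal V k \<inter> Pi\<^sub>E V A)"
    using off_diagonal_mono by (force simp: incseq_def)
  have PA: "Pi\<^sub>E V A \<subseteq> space ?P" using A sets.sets_into_space by (fastforce simp: space_PiM)
  \<comment> \<open>Both sides of the claim pass to the limit: the counts by monotone convergence,
    the measures because the tuples with repeated entries form a null set.\<close>
  have sup: "tuple_count V (Pi\<^sub>E V A) \<omega> = (SUP k. tuple_count V (off_diagonal V k \<inter> Pi\<^sub>E V A) \<omega>)" for \<omega>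
  proof -
    have "(SUP k. tuple_count V (off_diagonal V k \<inter> Pi\<^sub>E V A) \<omega>) =
      emeasure (count_space UNIV) (\<Union>k. tuples V (N \<omega>) \<inter> (off_diagonal V k \<inter> Pi\<^sub>E V A))"
      unfolding tuple_count_def using inc by (intro SUP_emeasure_incseq) (auto simp: incseq_def)
    also have "(\<Union>k. tuples V (N \<omega>) \<inter> (off_diagonal V k \<inter> Pi\<^sub>E V A)) =
        tuples V (N \<omega>) \<inter> ((\<Union>k. off_diagonal V k) \<inter> Pi\<^sub>E V A)" by blast
    also have "\<dots> = tuples V (N \<omega>) \<inter> Pi\<^sub>E V A"
      unfolding UN_off_diagonal[OF V] using PA by (auto simp: tuples_def)
    finally show ?thesis by (simp add: tuple_count_def)
  qed
  have "(\<integral>\<^sup>+\<omega>. tuple_count V (Pi\<^sub>E V A) \<omega> \<partial>M) = (SUP k. \<integral>\<^sup>+\<omega>. tuple_count V (off_diagonal V k \<inter> Pi\<^sub>E V A) \<omega> \<partial>M)"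
    unfolding sup
    by (rule nn_integral_monotone_convergence_SUP)
      (use inc meas_k in \<open>auto simp: incseq_def le_fun_def intro!: tuple_count_mono\<close>)
  also have "\<dots> = emeasure ?P (\<Union>k. off_diagonal V k \<inter> Pi\<^sub>E V A)"
    unfolding int_k using inc boxes by (intro SUP_emeasure_incseq) auto
  also have "\<dots> = emeasure ?P (Pi\<^sub>E V A)"
  proof (rule emeasure_eq_AE)
    show "AE R in ?P. (R \<in> (\<Union>k. off_diagonal V k \<inter> Pi\<^sub>E V A)) = (R \<in> Pi\<^sub>E V A)"
      using AE_inj_on[OF V] AE_space
    proof eventually_elim
      case (elim R)
      then have "R \<in> (\<Union>k. off_diagonal V k)" using UN_off_diagonal[OF V] by blast
      then show ?case by blast
    qed
  qed (use boxes off_diagonal_measurable[OF V] \<open>Pi\<^sub>E V A \<in> sets ?P\<close> in auto)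
  finally show ?thesis
    unfolding sup using meas_k by auto
qed

text \<open>The Mecke formula for indicators of tuples alone. Boxes are an intersection-stable
  generator; the complement step subtracts, which is legitimate because each configuration is finite
  and the product measure has finite mass.\<close>

theorem factorial_moment:
  assumes V: "finite V" and B: "B \<in> sets (PiM V (\<lambda>_. \<nu>))"
  shows "tuple_count V B \<in> borel_measurable M \<and>
    (\<integral>\<^sup>+\<omega>. tuple_count V B \<omega> \<partial>M) = emeasure (PiM V (\<lambda>_. \<nu>)) B"
  using Int_stable_prod_algebra prod_algebra_sets_into_space B[unfolded sets_PiM]
proof (induction B rule: sigma_sets_induct_disjoint)
  case (basic B)
  then show ?case
    using factorial_moment_box[OF V] by (auto simp: prod_algebra_eq_finite[OF V])
next
  case empty
  then show ?case by (simp add: tuple_count_def[abs_def])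
next
  case (compl B)
  let ?P = "PiM V (\<lambda>_. \<nu>)"
  have [measurable]: "B \<in> sets ?P" using compl(1) by (simp add: sets_PiM)
  have top: "space ?P = Pi\<^sub>E V (\<lambda>_. space \<nu>)" by (simp add: space_PiM)
  have t: "tuple_count V (space ?P) \<in> borel_measurable M"
    "(\<integral>\<^sup>+\<omega>. tuple_count V (space ?P) \<omega> \<partial>M) = emeasure ?P (space ?P)"
    using factorial_moment_box[OF V, of "\<lambda>_. space \<nu>"] unfolding top by auto
  have fin: "tuple_count V B \<omega> \<noteq> \<infinity>" if "\<omega> \<in> space M" for B \<omega>
    using tuple_count_eq_card[OF V that] by simp
  have diff: "tuple_count V (space ?P - B) \<omega> = tuple_count V (space ?P) \<omega> - tuple_count V B \<omega>"
    if w: "\<omega> \<in> space M" for \<omega>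
  proof -
    have "tuples V (N \<omega>) \<inter> (space ?P - B) = tuples V (N \<omega>) \<inter> space ?P - tuples V (N \<omega>) \<inter> B" by auto
    moreover have "tuples V (N \<omega>) \<inter> B \<subseteq> tuples V (N \<omega>) \<inter> space ?P"
      using sets.sets_into_space[of B ?P] by auto
    ultimately show ?thesis
      using fin[OF w, of B] unfolding tuple_count_def by (simp add: emeasure_Diff)
  qed
  have le: "tuple_count V B \<omega> \<le> tuple_count V (space ?P) \<omega>" for \<omega>
    using sets.sets_into_space[of B ?P] by (intro tuple_count_mono) auto
  have "(\<integral>\<^sup>+\<omega>. tuple_count V (space ?P - B) \<omega> \<partial>M) =
      (\<integral>\<^sup>+\<omega>. tuple_count V (space ?P) \<omega> \<partial>M) - (\<integral>\<^sup>+\<omega>. tuple_count V B \<omega> \<partial>M)"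
    using compl(2) t finite_measure_PiM[OF V, of B] le
    by (subst nn_integral_cong[OF diff], simp, subst nn_integral_diff) auto
  also have "\<dots> = emeasure ?P (space ?P - B)"
    using compl(2) t finite_measure_PiM[OF V, of B] sets.sets_into_space[of B ?P]
    by (simp add: emeasure_Diff)
  finally have "(\<integral>\<^sup>+\<omega>. tuple_count V (space ?P - B) \<omega> \<partial>M) = emeasure ?P (space ?P - B)" .
  moreover have "tuple_count V (space ?P - B) \<in> borel_measurable M"
    using compl(2) t by (subst measurable_cong[OF diff]) auto
  ultimately show ?case by (simp add: space_PiM)
next
  case (union B)
  let ?P = "PiM V (\<lambda>_. \<nu>)"
  have [measurable]: "range B \<subseteq> sets ?P" using union(2) by (simp add: sets_PiM)
  have sum: "tuple_count V (\<Union>i. B i) \<omega> = (\<Sum>i. tuple_count V (B i) \<omega>)" for \<omega>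
    unfolding tuple_count_def using union(1)
    by (subst suminf_emeasure) (auto simp: disjoint_family_on_def intro!: arg_cong[where f="emeasure _"])
  have "(\<integral>\<^sup>+\<omega>. tuple_count V (\<Union>i. B i) \<omega> \<partial>M) = (\<Sum>i. emeasure ?P (B i))"
    unfolding sum using union(3) by (simp add: nn_integral_suminf)
  also have "\<dots> = emeasure ?P (\<Union>i. B i)"
    using union(1) by (intro suminf_emeasure) auto
  finally show ?case
    using union(3) unfolding sum by (auto intro!: borel_measurable_suminf_order)
qed

end

section \<open>Second moments of tuple counts\<close>

text \<open>
  A pair of injective \<open>m\<close>-tuples \<open>P\<close>, \<open>Q\<close> is encoded by the pattern \<open>\<tau>\<close> of their coincidences
  and by a single injective tuple \<open>R\<close> with \<open>P = R\<close> on \<open>{1..m}\<close> and \<open>Q = R \<circ> \<tau>\<close>: a point \<open>Q j\<close>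
  that occurs in \<open>P\<close> gets the index it has there, a new point gets the index \<open>m + j\<close>.
\<close>

definition patterns :: "nat \<Rightarrow> (nat \<Rightarrow> nat) set" where
  "patterns m = {\<tau> \<in> {1..m} \<rightarrow>\<^sub>E {1..2 * m}. inj_on \<tau> {1..m} \<and>
     (\<forall>j\<in>{1..m}. \<tau> j \<in> {1..m} \<or> \<tau> j = m + j)}"

definition no_overlap :: "nat \<Rightarrow> nat \<Rightarrow> nat" where
  "no_overlap m = (\<lambda>j\<in>{1..m}. m + j)"

definition pattern_index :: "nat \<Rightarrow> (nat \<Rightarrow> nat) \<Rightarrow> nat set" where
  "pattern_index m \<tau> = {1..m} \<union> \<tau> ` {1..m}"

definition glued :: "'a measure \<Rightarrow> nat \<Rightarrow> (nat \<Rightarrow> nat) \<Rightarrow> (nat \<Rightarrow> 'a) set \<Rightarrow> (nat \<Rightarrow> 'a) set \<Rightarrow> (nat \<Rightarrow> 'a) set" where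
  "glued \<nu> m \<tau> A B = {R \<in> space (PiM (pattern_index m \<tau>) (\<lambda>_. \<nu>)).
     restrict R {1..m} \<in> A \<and> (\<lambda>j\<in>{1..m}. R (\<tau> j)) \<in> B}"

lemma finite_patterns: "finite (patterns m)"
  unfolding patterns_def by (rule finite_subset[OF _ finite_PiE[of "{1..m}" "\<lambda>_. {1..2 * m}"]]) auto

lemma finite_pattern_index[simp]: "finite (pattern_index m \<tau>)"
  by (simp add: pattern_index_def)

lemma no_overlap_in_patterns: "no_overlap m \<in> patterns m"
  by (auto simp: no_overlap_def patterns_def inj_on_def)

lemma glued_measurable:
  assumes [measurable]: "A \<in> sets (PiM {1..m} (\<lambda>_. \<nu>))" "B \<in> sets (PiM {1..m} (\<lambda>_. \<nu>))"
  shows "glued \<nu> m \<tau> A B \<in> sets (PiM (pattern_index m \<tau>) (\<lambda>_. \<nu>))"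
proof -
  have [measurable]: "(\<lambda>R. restrict R {1..m}) \<in> measurable (PiM (pattern_index m \<tau>) (\<lambda>_. \<nu>)) (PiM {1..m} (\<lambda>_. \<nu>))"
    by (rule measurable_restrict_subset) (auto simp: pattern_index_def)
  have [measurable]: "(\<lambda>R. \<lambda>j\<in>{1..m}. R (\<tau> j)) \<in> measurable (PiM (pattern_index m \<tau>) (\<lambda>_. \<nu>)) (PiM {1..m} (\<lambda>_. \<nu>))"
    by (rule measurable_restrict) (auto simp: pattern_index_def)
  show ?thesis unfolding glued_def by measurable
qed

text \<open>This turns the square of a tuple count into a sum of tuple counts over the patterns, to
  which \<open>factorial_moment\<close> applies.\<close>

lemma bij_betw_pairs:
  assumes X: "X \<subseteq> space \<nu>"
  shows "bij_betw (\<lambda>(\<tau>, R). (restrict R {1..m}, \<lambda>j\<in>{1..m}. R (\<tau> j)))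
    (SIGMA \<tau>:patterns m. tuples (pattern_index m \<tau>) X \<inter> glued \<nu> m \<tau> A B)
    ((tuples {1..m} X \<inter> A) \<times> (tuples {1..m} X \<inter> B))"
    (is "bij_betw ?f ?S ?T")
  unfolding bij_betw_def
proof (intro conjI equalityI subsetI)
  show "inj_on ?f ?S"
  proof (rule inj_onI, clarsimp)
    fix \<tau> R \<tau>' R'
    assume t: "\<tau> \<in> patterns m" "\<tau>' \<in> patterns m"
      and R: "R \<in> tuples (pattern_index m \<tau>) X" "R' \<in> tuples (pattern_index m \<tau>') X"
      and eq: "restrict R {Suc 0..m} = restrict R' {Suc 0..m}"
        "(\<lambda>j\<in>{Suc 0..m}. R (\<tau> j)) = (\<lambda>j\<in>{Suc 0..m}. R' (\<tau>' j))"
    have e1: "R i = R' i" if "i \<in> {1..m}" for i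
      using fun_cong[OF eq(1), of i] that by simp
    have e2: "R (\<tau> i) = R' (\<tau>' i)" if "i \<in> {1..m}" for i
      using fun_cong[OF eq(2), of i] that by simp
    have inj: "inj_on R (pattern_index m \<tau>)" "inj_on R' (pattern_index m \<tau>')"
      using R by (auto simp: tuples_def)
    \<comment> \<open>The pair determines the pattern: an old index \<open>\<tau> j\<close> is the
      position at which the point occurs in the first tuple, unique since \<open>R\<close> is
      injective, and a new index can only be \<open>m + j\<close>.\<close>
    have tt: "\<tau> j = \<tau>' j" if j: "j \<in> {1..m}" for j
    proof -
      have c: "\<tau> j \<in> {1..m} \<or> \<tau> j = m + j" "\<tau>' j \<in> {1..m} \<or> \<tau>' j = m + j"
        using t j by (auto simp: patterns_def)
      have m: "\<tau> j \<in> pattern_index m \<tau>" "\<tau>' j \<in> pattern_index m \<tau>'"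
        using j by (auto simp: pattern_index_def)
      show ?thesis
      proof (cases "\<tau> j \<in> {1..m}")
        case True
        then have "R' (\<tau> j) = R' (\<tau>' j)" using e1 e2[OF j] by auto
        moreover have "\<tau> j \<in> pattern_index m \<tau>'" using True by (auto simp: pattern_index_def)
        ultimately show ?thesis using inj(2) m by (auto dest: inj_onD)
      next
        case False
        show ?thesis
        proof (cases "\<tau>' j \<in> {1..m}")
          case True
          then have "R (\<tau> j) = R (\<tau>' j)" using e1 e2[OF j] by auto
          moreover have "\<tau>' j \<in> pattern_index m \<tau>" using True by (auto simp: pattern_index_def)
          ultimately show ?thesis using inj(1) m by (auto dest: inj_onD)
        qed (use False c in auto)
      qed
    qed
    have "\<tau> = \<tau>'"
      using t tt unfolding patterns_def by (intro PiE_ext[of \<tau> "{1..m}" "\<lambda>_. {1..2 * m}" \<tau>']) auto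
    moreover have "R = R'"
    proof (rule PiE_ext)
      show "R \<in> pattern_index m \<tau> \<rightarrow>\<^sub>E X" "R' \<in> pattern_index m \<tau> \<rightarrow>\<^sub>E X"
        using R \<open>\<tau> = \<tau>'\<close> by (auto simp: tuples_def)
      fix v assume "v \<in> pattern_index m \<tau>"
      then consider "v \<in> {1..m}" | j where "j \<in> {1..m}" "v = \<tau> j"
        by (auto simp: pattern_index_def)
      then show "R v = R' v"
        using e1 e2 \<open>\<tau> = \<tau>'\<close> by cases auto
    qed
    ultimately show "\<tau> = \<tau>' \<and> R = R'" by simp
  qed
next
  fix p assume "p \<in> ?f ` ?S"
  then obtain \<tau> R where p: "p = ?f (\<tau>, R)" and t: "\<tau> \<in> patterns m"
    and R: "R \<in> tuples (pattern_index m \<tau>) X" "R \<in> glued \<nu> m \<tau> A B" by auto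
  have inj: "inj_on \<tau> {1..m}" using t by (auto simp: patterns_def)
  have "restrict R {1..m} \<in> tuples {1..m} X"
    using R(1) by (auto simp: tuples_def pattern_index_def intro: inj_on_subset)
  moreover have "(\<lambda>j\<in>{1..m}. R (\<tau> j)) \<in> tuples {1..m} X"
  proof -
    have "inj_on R (\<tau> ` {1..m})"
      using R(1) by (auto simp: tuples_def pattern_index_def intro: inj_on_subset)
    then have "inj_on (R \<circ> \<tau>) {1..m}" by (rule comp_inj_on[OF inj])
    then have "inj_on (\<lambda>j\<in>{1..m}. R (\<tau> j)) {1..m}" by (simp only: inj_on_restrict_eq comp_def)
    moreover have "R (\<tau> j) \<in> X" if "j \<in> {1..m}" for j
      using R(1) that by (auto simp: tuples_def pattern_index_def)
    ultimately show ?thesis unfolding tuples_def by auto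
  qed
  ultimately show "p \<in> ?T" using R by (auto simp: p glued_def)
next
  fix p assume "p \<in> ?T"
  then obtain P Q where p: "p = (P, Q)" and P: "P \<in> tuples {1..m} X" "P \<in> A"
    and Q: "Q \<in> tuples {1..m} X" "Q \<in> B" by auto
  have injP: "inj_on P {1..m}" and injQ: "inj_on Q {1..m}"
    and PX: "\<And>i. i \<in> {1..m} \<Longrightarrow> P i \<in> X" and QX: "\<And>i. i \<in> {1..m} \<Longrightarrow> Q i \<in> X"
    using P Q by (auto simp: tuples_def)
  define \<tau> where "\<tau> = (\<lambda>j\<in>{1..m}. if Q j \<in> P ` {1..m} then inv_into {1..m} P (Q j) else m + j)"
  define R where "R = (\<lambda>v\<in>pattern_index m \<tau>. if v \<in> {1..m} then P v else Q (v - m))"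
  have t1: "\<tau> j \<in> {1..m} \<and> P (\<tau> j) = Q j" if "j \<in> {1..m}" "Q j \<in> P ` {1..m}" for j
    using that inv_into_into[of "Q j" P "{1..m}"] f_inv_into_f[of "Q j" P "{1..m}"]
    by (auto simp: \<tau>_def)
  have t2: "\<tau> j = m + j" if "j \<in> {1..m}" "Q j \<notin> P ` {1..m}" for j
    using that by (auto simp: \<tau>_def)
  have Rt: "R (\<tau> j) = Q j" if j: "j \<in> {1..m}" for j
  proof -
    have "\<tau> j \<in> pattern_index m \<tau>" using j by (auto simp: pattern_index_def)
    then show ?thesis
      using t1[OF j] t2[OF j] j by (cases "Q j \<in> P ` {1..m}") (auto simp: R_def)
  qed
  have R1: "R i = P i" if "i \<in> {1..m}" for i
    using that by (auto simp: R_def pattern_index_def)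
  have injt: "inj_on \<tau> {1..m}"
  proof (rule inj_onI)
    fix j k assume jk: "j \<in> {1..m}" "k \<in> {1..m}" "\<tau> j = \<tau> k"
    then have "Q j = Q k" using Rt[of j] Rt[of k] by simp
    then show "j = k" using inj_onD[OF injQ] jk by simp
  qed
  have tp: "\<tau> \<in> patterns m"
    unfolding patterns_def
  proof (intro CollectI conjI ballI injt)
    fix j assume j: "j \<in> {1..m}"
    show "\<tau> j \<in> {1..m} \<or> \<tau> j = m + j"
      using t1[OF j] t2[OF j] by blast
  next
    show "\<tau> \<in> {1..m} \<rightarrow>\<^sub>E {1..2 * m}"
    proof (rule PiE_I)
      fix j assume j: "j \<in> {1..m}"
      then show "\<tau> j \<in> {1..2 * m}" using t1[OF j] t2[OF j] by (cases "Q j \<in> P ` {1..m}") auto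
    qed (auto simp: \<tau>_def)
  qed
  have new: "\<tau> j = i" if j: "j \<in> {1..m}" and i: "i \<in> {1..m}" and eq: "R (\<tau> j) = R i" for i j
  proof -
    have "Q j = P i" using eq Rt[OF j] R1[OF i] by simp
    then have "\<tau> j \<in> {1..m}" "P (\<tau> j) = P i" using t1[OF j] i by auto
    then show ?thesis using injP i by (auto dest: inj_onD)
  qed
  have injR: "inj_on R (pattern_index m \<tau>)"
  proof (rule inj_onI)
    fix v w assume v: "v \<in> pattern_index m \<tau>" and w: "w \<in> pattern_index m \<tau>" and eq: "R v = R w"
    consider "v \<in> {1..m}" "w \<in> {1..m}" | j where "j \<in> {1..m}" "v = \<tau> j" "w \<in> {1..m}"
      | j where "j \<in> {1..m}" "w = \<tau> j" "v \<in> {1..m}"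
      | j k where "j \<in> {1..m}" "v = \<tau> j" "k \<in> {1..m}" "w = \<tau> k"
      using v w unfolding pattern_index_def by blast
    then show "v = w"
    proof cases
      case 1
      then show ?thesis using R1[of v] R1[of w] eq inj_onD[OF injP, of v w] by simp
    next
      case 2
      then show ?thesis using new[of j w] eq by simp
    next
      case 3
      then show ?thesis using new[of j v] eq by simp
    next
      case 4
      then show ?thesis using Rt[of j] Rt[of k] eq inj_onD[OF injQ, of j k] by simp
    qed
  qed
  have RX: "R v \<in> X" if "v \<in> pattern_index m \<tau>" for v
    using that R1 Rt PX QX by (auto simp: pattern_index_def)
  have Rext: "R \<in> extensional (pattern_index m \<tau>)" by (simp add: R_def)
  have "R \<in> tuples (pattern_index m \<tau>) X"
    using injR RX Rext by (simp add: tuples_def PiE_iff)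
  moreover have rP: "restrict R {1..m} = P"
    using P R1 by (intro ext) (auto simp: tuples_def PiE_iff extensional_def)
  moreover have rQ: "(\<lambda>j\<in>{1..m}. R (\<tau> j)) = Q"
    using Q Rt by (intro ext) (auto simp: tuples_def PiE_iff extensional_def)
  moreover have "R \<in> space (PiM (pattern_index m \<tau>) (\<lambda>_. \<nu>))"
    using RX X Rext by (auto simp: space_PiM PiE_iff)
  ultimately have "(\<tau>, R) \<in> ?S" using tp P(2) Q(2) by (simp add: glued_def)
  moreover have "?f (\<tau>, R) = p" using rP rQ p by simp
  ultimately show "p \<in> ?f ` ?S" by (rule image_eqI[rotated, OF _ sym])
qed

section \<open>Mean and variance of a tuple count\<close>

context separated_ppp
begin

lemma PiM_shift:
  assumes "finite (I :: nat set)"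
  shows "distr (PiM ((+) k ` I) (\<lambda>_. \<nu>)) (PiM I (\<lambda>_. \<nu>)) (\<lambda>y. \<lambda>j\<in>I. y (k + j)) = PiM I (\<lambda>_. \<nu>)"
proof (rule product.PiM_eqI[OF assms])
  fix A :: "nat \<Rightarrow> 'a set" assume A: "\<And>i. i \<in> I \<Longrightarrow> A i \<in> sets \<nu>"
  have [measurable]: "(\<lambda>y. \<lambda>j\<in>I. y (k + j)) \<in> measurable (PiM ((+) k ` I) (\<lambda>_. \<nu>)) (PiM I (\<lambda>_. \<nu>))"
    by (rule measurable_restrict) auto
  have "(\<lambda>y. \<lambda>j\<in>I. y (k + j)) -` Pi\<^sub>E I A \<inter> space (PiM ((+) k ` I) (\<lambda>_. \<nu>)) =
      Pi\<^sub>E ((+) k ` I) (\<lambda>i. A (i - k))"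
    using A sets.sets_into_space by (auto simp: space_PiM PiE_iff extensional_def; fastforce)
  note eq = this
  show "emeasure (distr (PiM ((+) k ` I) (\<lambda>_. \<nu>)) (PiM I (\<lambda>_. \<nu>)) (\<lambda>y. \<lambda>j\<in>I. y (k + j))) (Pi\<^sub>E I A)
      = (\<Prod>i\<in>I. emeasure \<nu> (A i))"
  proof (subst emeasure_distr)
    have "emeasure (PiM ((+) k ` I) (\<lambda>_. \<nu>)) (Pi\<^sub>E ((+) k ` I) (\<lambda>i. A (i - k))) =
        (\<Prod>i\<in>(+) k ` I. emeasure \<nu> (A (i - k)))"
      using assms A by (intro product.emeasure_PiM) auto
    then show "emeasure (PiM ((+) k ` I) (\<lambda>_. \<nu>)) ((\<lambda>y. \<lambda>j\<in>I. y (k + j)) -` Pi\<^sub>E I A \<inter> space (PiM ((+) k ` I) (\<lambda>_. \<nu>)))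
        = (\<Prod>i\<in>I. emeasure \<nu> (A i))"
      unfolding eq by (simp add: prod.reindex)
  qed (use assms A in \<open>auto intro!: sets_PiM_I_finite\<close>)
qed simp

text \<open>The two tuples use disjoint sets of coordinates, so the measure factorises. This is the
  squared mean, the term that the variance cancels.\<close>

lemma emeasure_glued_no_overlap:
  assumes [measurable]: "A \<in> sets (PiM {1..m} (\<lambda>_. \<nu>))" "B \<in> sets (PiM {1..m} (\<lambda>_. \<nu>))"
  shows "emeasure (PiM (pattern_index m (no_overlap m)) (\<lambda>_. \<nu>)) (glued \<nu> m (no_overlap m) A B)
    = emeasure (PiM {1..m} (\<lambda>_. \<nu>)) A * emeasure (PiM {1..m} (\<lambda>_. \<nu>)) B"
proof -
  let ?I = "{1..m}" and ?J = "(+) m ` {1..m}"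
  let ?G = "glued \<nu> m (no_overlap m) A B"
  have idx: "pattern_index m (no_overlap m) = ?I \<union> ?J"
    by (auto simp: pattern_index_def no_overlap_def)
  have G: "?G \<in> sets (PiM (?I \<union> ?J) (\<lambda>_. \<nu>))"
    using glued_measurable[OF assms, of "no_overlap m"] by (simp add: idx)
  have [measurable]: "(\<lambda>y. \<lambda>j\<in>?I. y (m + j)) \<in> measurable (PiM ?J (\<lambda>_. \<nu>)) (PiM ?I (\<lambda>_. \<nu>))"
    by (rule measurable_restrict) auto
  have dis: "?I \<inter> ?J = {}" by auto
  have "emeasure (PiM (?I \<union> ?J) (\<lambda>_. \<nu>)) ?G = (\<integral>\<^sup>+R. indicator ?G R \<partial>PiM (?I \<union> ?J) (\<lambda>_. \<nu>))"
    using G by simp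
  also have "\<dots> = (\<integral>\<^sup>+x. \<integral>\<^sup>+y. indicator ?G (merge ?I ?J (x, y)) \<partial>PiM ?J (\<lambda>_. \<nu>) \<partial>PiM ?I (\<lambda>_. \<nu>))"
    by (rule product.product_nn_integral_fold[OF dis]) (use G in auto)
  also have "\<dots> = (\<integral>\<^sup>+x. \<integral>\<^sup>+y. indicator A x * indicator B (\<lambda>j\<in>?I. y (m + j)) \<partial>PiM ?J (\<lambda>_. \<nu>) \<partial>PiM ?I (\<lambda>_. \<nu>))"
  proof (intro nn_integral_cong)
    fix x y assume x: "x \<in> space (PiM ?I (\<lambda>_. \<nu>))" and y: "y \<in> space (PiM ?J (\<lambda>_. \<nu>))"
    have 1: "restrict (merge ?I ?J (x, y)) ?I = x"
      using x by (simp add: space_PiM)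
    have 2: "(\<lambda>j\<in>?I. merge ?I ?J (x, y) (no_overlap m j)) = (\<lambda>j\<in>?I. y (m + j))"
      by (rule restrict_ext) (auto simp: merge_def no_overlap_def)
    have 3: "merge ?I ?J (x, y) \<in> space (PiM (?I \<union> ?J) (\<lambda>_. \<nu>))"
      using x y by (auto simp: space_PiM merge_def PiE_iff extensional_def)
    show "indicator ?G (merge ?I ?J (x, y)) = indicator A x * (indicator B (\<lambda>j\<in>?I. y (m + j)) :: ennreal)"
      using 1 2 3 unfolding glued_def idx by (simp add: indicator_def)
  qed
  also have "\<dots> = (\<integral>\<^sup>+x. indicator A x * emeasure (PiM ?I (\<lambda>_. \<nu>)) B \<partial>PiM ?I (\<lambda>_. \<nu>))"
  proof (intro nn_integral_cong)
    fix x
    have "(\<integral>\<^sup>+y. indicator B (\<lambda>j\<in>?I. y (m + j)) \<partial>PiM ?J (\<lambda>_. \<nu>)) =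
        (\<integral>\<^sup>+z. indicator B z \<partial>distr (PiM ?J (\<lambda>_. \<nu>)) (PiM ?I (\<lambda>_. \<nu>)) (\<lambda>y. \<lambda>j\<in>?I. y (m + j)))"
      by (rule nn_integral_distr[symmetric]) measurable
    also have "\<dots> = emeasure (PiM ?I (\<lambda>_. \<nu>)) B"
      unfolding PiM_shift[OF finite_atLeastAtMost] by (rule nn_integral_indicator) fact
    finally show "(\<integral>\<^sup>+y. indicator A x * indicator B (\<lambda>j\<in>?I. y (m + j)) \<partial>PiM ?J (\<lambda>_. \<nu>))
        = indicator A x * emeasure (PiM ?I (\<lambda>_. \<nu>)) B"
      by (subst nn_integral_cmult, measurable)
  qed
  also have "\<dots> = emeasure (PiM ?I (\<lambda>_. \<nu>)) A * emeasure (PiM ?I (\<lambda>_. \<nu>)) B"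
    by (subst nn_integral_multc) (use assms(1) in \<open>simp_all only: borel_measurable_indicator nn_integral_indicator\<close>)
  finally show ?thesis by (simp add: idx)
qed

theorem tuple_moments:
  assumes A: "A \<in> sets (PiM {1..m} (\<lambda>_. \<nu>))"
  defines "T \<equiv> \<lambda>\<omega>. real (card (tuples {1..m} (N \<omega>) \<inter> A))"
  shows "T \<in> borel_measurable M" "integrable M T" "integrable M (\<lambda>\<omega>. (T \<omega>)\<^sup>2)"
    "expectation T = measure (PiM {1..m} (\<lambda>_. \<nu>)) A"
    "variance T = (\<Sum>\<tau>\<in>patterns m - {no_overlap m}.
      measure (PiM (pattern_index m \<tau>) (\<lambda>_. \<nu>)) (glued \<nu> m \<tau> A A))"
proof -
  let ?\<mu> = "\<lambda>\<tau>. measure (PiM (pattern_index m \<tau>) (\<lambda>_. \<nu>)) (glued \<nu> m \<tau> A A)"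
  have em: "emeasure (PiM V (\<lambda>_. \<nu>)) B = ennreal (measure (PiM V (\<lambda>_. \<nu>)) B)" if "finite V" for V :: "nat set" and B
    using finite_measure_PiM[OF that, of B] by (simp add: emeasure_eq_ennreal_measure)
  have T: "ennreal (T \<omega>) = tuple_count {1..m} A \<omega>" if "\<omega> \<in> space M" for \<omega>
    using tuple_count_eq_card[OF _ that, of "{1..m}" A]
    by (simp add: T_def ennreal_of_nat_eq_real_of_nat)
  have fm: "tuple_count {1..m} A \<in> borel_measurable M"
    "(\<integral>\<^sup>+\<omega>. tuple_count {1..m} A \<omega> \<partial>M) = emeasure (PiM {1..m} (\<lambda>_. \<nu>)) A"
    using factorial_moment[OF _ A] by auto
  have "(\<lambda>\<omega>. ennreal (T \<omega>)) \<in> borel_measurable M"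
    using fm(1) by (subst measurable_cong[OF T]) auto
  then have "(\<lambda>\<omega>. enn2real (ennreal (T \<omega>))) \<in> borel_measurable M" by measurable
  moreover have T0: "0 \<le> T \<omega>" for \<omega> by (simp add: T_def)
  ultimately show Tm[measurable]: "T \<in> borel_measurable M" by simp
  have "(\<integral>\<^sup>+\<omega>. ennreal (T \<omega>) \<partial>M) = ennreal (measure (PiM {1..m} (\<lambda>_. \<nu>)) A)"
    using fm(2) by (subst nn_integral_cong[OF T]) (auto simp: em)
  then show Ti: "integrable M T" and Te: "expectation T = measure (PiM {1..m} (\<lambda>_. \<nu>)) A"
    using T0 by (auto simp: nn_integral_eq_integrable)
  have T2: "ennreal ((T \<omega>)\<^sup>2) = (\<Sum>\<tau>\<in>patterns m. tuple_count (pattern_index m \<tau>) (glued \<nu> m \<tau> A A) \<omega>)"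
    if w: "\<omega> \<in> space M" for \<omega>
  proof -
    have fin: "finite (N \<omega>)" "N \<omega> \<subseteq> space \<nu>" using w points_finite points_in_space by auto
    have "card (tuples {1..m} (N \<omega>) \<inter> A) * card (tuples {1..m} (N \<omega>) \<inter> A) =
      card (SIGMA \<tau>:patterns m. tuples (pattern_index m \<tau>) (N \<omega>) \<inter> glued \<nu> m \<tau> A A)"
      using bij_betw_same_card[OF bij_betw_pairs[OF fin(2), of m A A]] by (simp add: card_cartesian_product)
    also have "\<dots> = (\<Sum>\<tau>\<in>patterns m. card (tuples (pattern_index m \<tau>) (N \<omega>) \<inter> glued \<nu> m \<tau> A A))"
      by (rule card_SigmaI) (auto simp: finite_patterns finite_tuples fin)
    finally have "(T \<omega>)\<^sup>2 = real (\<Sum>\<tau>\<in>patterns m. card (tuples (pattern_index m \<tau>) (N \<omega>) \<inter> glued \<nu> m \<tau> A A))"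
      unfolding T_def power2_eq_square of_nat_mult[symmetric] by simp
    then show ?thesis
      using w by (simp add: tuple_count_eq_card ennreal_of_nat_eq_real_of_nat[symmetric] del: of_nat_sum)
        (simp)
  qed
  have "(\<integral>\<^sup>+\<omega>. ennreal ((T \<omega>)\<^sup>2) \<partial>M) = (\<Sum>\<tau>\<in>patterns m. ennreal (?\<mu> \<tau>))"
    using factorial_moment[OF finite_pattern_index glued_measurable[OF A A]]
    by (subst nn_integral_cong[OF T2], simp, subst nn_integral_sum) (auto simp: em)
  also have "\<dots> = ennreal (\<Sum>\<tau>\<in>patterns m. ?\<mu> \<tau>)" by (rule sum_ennreal) auto
  finally have "(\<integral>\<^sup>+\<omega>. ennreal ((T \<omega>)\<^sup>2) \<partial>M) = ennreal (\<Sum>\<tau>\<in>patterns m. ?\<mu> \<tau>)" .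
  then have Ti2: "integrable M (\<lambda>\<omega>. (T \<omega>)\<^sup>2)" and Te2: "expectation (\<lambda>\<omega>. (T \<omega>)\<^sup>2) = (\<Sum>\<tau>\<in>patterns m. ?\<mu> \<tau>)"
    by (auto simp: nn_integral_eq_integrable sum_nonneg)
  show "integrable M (\<lambda>\<omega>. (T \<omega>)\<^sup>2)" by (rule Ti2)
  have "ennreal (?\<mu> (no_overlap m)) = ennreal ((expectation T)\<^sup>2)"
    using emeasure_glued_no_overlap[OF A A]
    by (simp add: em Te power2_eq_square ennreal_mult)
  then have "?\<mu> (no_overlap m) = (expectation T)\<^sup>2" by simp
  then show "variance T = (\<Sum>\<tau>\<in>patterns m - {no_overlap m}. ?\<mu> \<tau>)"
    using Te2 no_overlap_in_patterns finite_patterns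
    by (subst variance_eq[OF Ti Ti2]) (simp add: sum.remove[of _ "no_overlap m"])
qed

end

section \<open>A spanning tree of two overlapping copies\<close>

locale overlap_pattern = rooted_tree m r pa dep for m r pa dep +
  fixes \<tau> :: "nat \<Rightarrow> nat"
  assumes pattern: "\<tau> \<in> patterns m" and overlap: "\<tau> \<noteq> no_overlap m"
begin

abbreviation V :: "nat set" where "V \<equiv> pattern_index m \<tau>"

definition shared :: "nat set" where "shared = {j \<in> {1..m}. \<tau> j \<in> {1..m}}"

definition new :: "nat set" where "new = {1..m} - shared"

lemma \<tau>_new: "j \<in> new \<Longrightarrow> \<tau> j = m + j"
  using pattern by (auto simp: new_def shared_def patterns_def)

lemma \<tau>_in: "j \<in> {1..m} \<Longrightarrow> \<tau> j \<in> V"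
  by (auto simp: pattern_index_def)

lemma new_sub: "new \<subseteq> {1..m}" and finite_new[simp]: "finite new"
  by (auto simp: new_def)

lemma index_eq: "V = {1..m} \<union> (+) m ` new"
proof -
  have "\<tau> ` {1..m} = \<tau> ` shared \<union> \<tau> ` new" by (auto simp: new_def shared_def)
  moreover have "\<tau> ` new = (+) m ` new" using \<tau>_new by (intro image_cong) auto
  moreover have "\<tau> ` shared \<subseteq> {1..m}" by (auto simp: shared_def)
  ultimately show ?thesis unfolding pattern_index_def by blast
qed

lemma shared_nonempty: "shared \<noteq> {}"
proof
  assume "shared = {}"
  then have "new = {1..m}" by (simp add: new_def)
  then have "\<tau> j = no_overlap m j" if "j \<in> {1..m}" for j
    using \<tau>_new[of j] that by (simp add: no_overlap_def)
  then have "\<tau> = no_overlap m"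
    using pattern by (intro PiE_ext[of \<tau> "{1..m}"]) (auto simp: patterns_def no_overlap_def)
  then show False using overlap by simp
qed

text \<open>
  The second copy is explored from a shared vertex \<open>j0\<close> of minimal depth, so that all its strict
  ancestors are new: upwards from \<open>j0\<close> to the root, and downwards everywhere else.
\<close>

definition j0 :: nat where "j0 = arg_min_on dep shared"

definition d :: nat where "d = dep j0"

definition path :: "nat \<Rightarrow> nat" where "path k = (pa ^^ k) j0"

definition anc :: "nat set" where "anc = path ` {1..d}"

text \<open>The neighbour one step closer to the root \<open>r\<close> of the first copy. The
  ancestor \<open>path k\<close> has depth \<open>d - k\<close>, hence
  \<open>d - dep (v - m) - 1\<close> is \<open>k - 1\<close>: ancestors of \<open>j0\<close> hang on
  their child, all other vertices on their parent.\<close>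

definition next_vertex :: "nat \<Rightarrow> nat" where
  "next_vertex v = (if v \<le> m then pa v
     else if v - m \<in> anc then \<tau> (path (d - dep (v - m) - 1)) else \<tau> (pa (v - m)))"

text \<open>Decreases along \<open>next_vertex\<close>. The first copy occupies the values below
  \<open>m\<close>, the new ancestors of \<open>j0\<close> those above \<open>m\<close> up to
  \<open>2 * m\<close>, and the remaining new vertices those from \<open>3 * m\<close> on. The depth
  of an ancestor enters with a minus sign because its edge is used backwards.\<close>

definition rank :: "nat \<Rightarrow> nat" where
  "rank v = (if v \<le> m then dep v
     else if v - m \<in> anc then 2 * m - dep (v - m) else 3 * m + dep (v - m))"

lemma finite_shared: "finite shared" by (simp add: shared_def)

lemma j0_shared: "j0 \<in> shared"
  unfolding j0_def by (rule arg_min_if_finite(1)[OF finite_shared shared_nonempty])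

lemma j0_min: "j \<in> shared \<Longrightarrow> d \<le> dep j"
  unfolding d_def j0_def by (rule arg_min_least[OF finite_shared shared_nonempty])

lemma j0_in: "j0 \<in> {1..m}" using j0_shared by (auto simp: shared_def)

lemma path_in: "k \<le> d \<Longrightarrow> path k \<in> {1..m} \<and> dep (path k) = d - k"
proof (induction k)
  case 0
  then show ?case using j0_in by (simp add: path_def d_def)
next
  case (Suc k)
  then have IH: "path k \<in> {1..m}" "dep (path k) = d - k" by auto
  then have "path k \<noteq> r" using dep_root Suc.prems by auto
  then have "dep (path k) = Suc (dep (pa (path k)))" "pa (path k) \<in> {1..m}"
    using IH dep_pa pa_in by auto
  moreover have "path (Suc k) = pa (path k)" by (simp add: path_def)
  ultimately show ?case using IH by simp
qed

lemma path_Suc: "path (Suc k) = pa (path k)" by (simp add: path_def)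

lemma path_ne_root: "k < d \<Longrightarrow> path k \<noteq> r"
  using path_in[of k] dep_root by auto

lemma path_d: "path d = r"
  using path_in[of d] dep_pa[of "path d"] by (cases "path d = r") auto

lemma inj_on_path: "inj_on path {..d}"
  by (rule inj_on_inverseI[of _ "\<lambda>v. d - dep v"]) (use path_in in auto)

lemma anc_new: "anc \<subseteq> new"
proof
  fix j assume "j \<in> anc"
  then obtain k where k: "1 \<le> k" "k \<le> d" "j = path k" by (auto simp: anc_def)
  then have "j \<in> {1..m}" "dep j < d" using path_in[of k] by auto
  then show "j \<in> new" using j0_min[of j] by (auto simp: new_def)
qed

lemma root_new: "r \<in> new \<longleftrightarrow> d \<noteq> 0"
proof
  assume r: "r \<in> new"
  show "d \<noteq> 0"
  proof
    assume "d = 0"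
    then have "r = j0" using path_d by (simp add: path_def)
    then show False using r j0_shared by (simp add: new_def)
  qed
next
  assume "d \<noteq> 0"
  then have "path d \<in> anc" by (auto simp: anc_def)
  then show "r \<in> new" using anc_new path_d by auto
qed

text \<open>Hence a new vertex that is not an ancestor of \<open>j0\<close> has a parent to hang
  on.\<close>

lemma root_anc: "r \<in> new \<Longrightarrow> r \<in> anc"
  using root_new path_d by (auto simp: anc_def intro!: image_eqI[of _ _ d])

lemma next_down:
  assumes "k \<in> {1..d}" shows "next_vertex (m + path k) = \<tau> (path (k - 1))"
proof -
  have "path k \<in> anc" "1 \<le> path k" "dep (path k) = d - k"
    using assms path_in[of k] by (auto simp: anc_def)
  moreover have "d - (d - k) - 1 = k - 1" using assms by auto
  ultimately show ?thesis by (simp add: next_vertex_def)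
qed

lemma next_other:
  assumes "j \<in> new - anc" shows "next_vertex (m + j) = \<tau> (pa j)" "j \<in> {1..m} - {r}"
  using assms root_anc new_sub by (auto simp: next_vertex_def)

lemma index_cases:
  assumes "v \<in> V"
  obtains (old) "v \<in> {1..m}"
  | (other) j where "j \<in> new - anc" "v = m + j" "v = \<tau> j"
  | (down) k where "k \<in> {1..d}" "v = m + path k" "v = \<tau> (path k)"
proof -
  consider "v \<in> {1..m}" | j where "j \<in> new" "v = m + j" using assms by (auto simp: index_eq)
  then show thesis
  proof cases
    case 2
    then have v: "v = \<tau> j" using \<tau>_new by simp
    show ?thesis
    proof (cases "j \<in> anc")
      case True
      then obtain k where "k \<in> {1..d}" "j = path k" by (auto simp: anc_def)
      then show ?thesis using down[of k] 2 v by simp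
    qed (use 2 v other in auto)
  qed (use old in auto)
qed

text \<open>Supplies the distance bound for every step of the spanning tree. The third alternative,
  an edge of the second copy used backwards, occurs on the way up from \<open>j0\<close>.\<close>

lemma next_vertex_edge:
  assumes v: "v \<in> V - {r}"
  shows "\<exists>c\<in>{1..m} - {r}. v = c \<and> next_vertex v = pa c \<or>
    v = \<tau> c \<and> next_vertex v = \<tau> (pa c) \<or> v = \<tau> (pa c) \<and> next_vertex v = \<tau> c"
proof -
  from v have "v \<in> V" by simp
  then show ?thesis
  proof (cases rule: index_cases)
    case old
    then show ?thesis using v by (intro bexI[of _ v]) (auto simp: next_vertex_def)
  next
    case (other j)
    then show ?thesis using next_other[of j] by (intro bexI[of _ j]) auto
  next
    case (down k)
    then have "pa (path (k - 1)) = path k" using path_Suc[of "k - 1"] by simp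
    moreover have "k - 1 < d" "k - 1 \<le> d" using down(1) by auto
    then have "path (k - 1) \<in> {1..m} - {r}"
      using path_in[of "k - 1"] path_ne_root[of "k - 1"] by auto
    ultimately show ?thesis
      using down next_down[of k] by (intro bexI[of _ "path (k - 1)"]) auto
  qed
qed

lemma next_vertex_in: "v \<in> V - {r} \<Longrightarrow> next_vertex v \<in> V"
  using next_vertex_edge[of v] pa_in \<tau>_in by (auto simp: pattern_index_def)

lemma rank_\<tau>:
  assumes j: "j \<in> {1..m}"
  shows "rank (\<tau> j) < m \<or> j \<in> anc \<and> rank (\<tau> j) = 2 * m - dep j
    \<or> j \<in> new - anc \<and> rank (\<tau> j) = 3 * m + dep j"
proof (cases "j \<in> new")
  case True
  then show ?thesis using j by (simp add: rank_def \<tau>_new)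
next
  case False
  then have "\<tau> j \<in> {1..m}" using j by (simp add: new_def shared_def)
  then show ?thesis using dep_less[of "\<tau> j"] by (simp add: rank_def)
qed

lemma rank_next_vertex:
  assumes v: "v \<in> V - {r}" shows "rank (next_vertex v) < rank v"
proof -
  from v have "v \<in> V" by simp
  then show ?thesis
  proof (cases rule: index_cases)
    case old
    then have "pa v \<le> m" "dep v = Suc (dep (pa v))" "v \<le> m"
      using v pa_in[of v] dep_pa[of v] by auto
    then show ?thesis by (simp add: next_vertex_def rank_def)
  next
    case (other j)
    note j = next_other[OF other(1)]
    have "rank v = 3 * m + dep j" using other(1) j(2) unfolding other(2) by (simp add: rank_def)
    moreover have "pa j \<in> {1..m}" "dep j = Suc (dep (pa j))" "dep (pa j) < m"
      using pa_in dep_pa j(2) dep_less by auto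
    ultimately have "rank (\<tau> (pa j)) < rank v" using rank_\<tau>[of "pa j"] by auto
    then show ?thesis using j(1) unfolding other(2) by simp
  next
    case (down k)
    have k: "path k \<in> anc" "dep (path k) = d - k" "path k \<in> {1..m}" "d < m"
      using path_in[of k] down(1) dep_less[OF j0_in] by (auto simp: anc_def d_def)
    have rv: "rank v = 2 * m - (d - k)" using k unfolding down(2) by (simp add: rank_def)
    have k1: "path (k - 1) \<in> {1..m}" "dep (path (k - 1)) = d - (k - 1)"
      using path_in[of "k - 1"] down(1) by auto
    \<comment> \<open>The vertex on which \<open>path k\<close> hangs is \<open>j0\<close>, which is
      shared, or a lower ancestor; either way its rank avoids the highest range.\<close>
    have "path (k - 1) \<notin> new - anc"
    proof (cases "k = 1")
      case True
      then show ?thesis using j0_shared by (auto simp: path_def new_def)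
    next
      case False
      then have "k - 1 \<in> {1..d}" using down(1) by auto
      then have "path (k - 1) \<in> anc" unfolding anc_def by (rule imageI)
      then show ?thesis by auto
    qed
    then have "rank (\<tau> (path (k - 1))) < m \<or> rank (\<tau> (path (k - 1))) = 2 * m - (d - (k - 1))"
      using rank_\<tau>[OF k1(1)] k1(2) by auto
    moreover have "next_vertex v = \<tau> (path (k - 1))" using next_down[OF down(1)] down(2) by simp
    moreover have "d - (k - 1) = Suc (d - k)" using down(1) by auto
    ultimately show ?thesis using rv k(4) by auto
  qed
qed

lemma sum_index:
  "(\<Sum>v\<in>V - {r}. f v) = (\<Sum>v\<in>{1..m} - {r}. f v) + (\<Sum>j\<in>new. f (m + j))"
  for f :: "nat \<Rightarrow> real"
proof -
  have "V - {r} = ({1..m} - {r}) \<union> (+) m ` new"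
    using index_eq new_sub root_in by fastforce
  moreover have "({1..m} - {r}) \<inter> (+) m ` new = {}" using new_sub by fastforce
  ultimately have "(\<Sum>v\<in>V - {r}. f v) = (\<Sum>v\<in>{1..m} - {r}. f v) + (\<Sum>v\<in>(+) m ` new. f v)"
    by (simp add: sum.union_disjoint)
  then show ?thesis by (simp add: sum.reindex)
qed

text \<open>
  The variables \<open>x v\<close> stand for \<open>- ln\<close> of the marks. The left-hand side is \<open>ln\<close> of the product
  of the connection radii (for \<open>\<beta> = 1\<close>) along the spanning tree given by \<open>next_vertex\<close>; the
  right-hand side is \<open>- ln\<close> of a product of integrable powers of the marks.
\<close>

theorem sum_log_radius_le:
  fixes x :: "nat \<Rightarrow> real" and \<gamma> \<delta> :: real
  assumes x0: "\<And>v. v \<in> V \<Longrightarrow> 0 \<le> x v"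
    and P: "\<And>v. v \<in> {1..m} - {r} \<Longrightarrow> x v \<le> x (pa v)"
    and Q: "\<And>v. v \<in> {1..m} - {r} \<Longrightarrow> x (\<tau> v) \<le> x (\<tau> (pa v))"
    and \<gamma>: "0 \<le> \<gamma>" and \<delta>: "0 < \<delta>" "(2 * m + 2) * \<delta> = 1 / 2 - \<gamma> * leaves"
  defines "e \<equiv> \<lambda>u w. \<gamma> * (max (x u) (x w) - min (x u) (x w)) + min (x u) (x w)"
  shows "(\<Sum>v\<in>V - {r}. e v (next_vertex v)) \<le> (1 - 2 * \<delta>) * x r + (\<Sum>v\<in>V - {r}. (1 - \<delta>) * x v)"
proof -
  define y where "y j = x (\<tau> j)" for j
  define f where "f c = \<gamma> * (y (pa c) - y c) + y c" for c
  \<comment> \<open>\<open>C\<close> consists of the lower ends of the edges of the second copy that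
    the spanning tree uses; those in \<open>W\<close> belong to edges used backwards.
    \<open>f c\<close> is the logarithm of the radius (for \<beta> equal to 1) of the edge above
    \<open>c\<close>.\<close>
  define W where "W = path ` {..<d}"
  define C where "C = W \<union> (new - anc)"
  have y0: "0 \<le> y j" if "j \<in> {1..m}" for j using x0[OF \<tau>_in[OF that]] by (simp add: y_def)
  have xr: "0 \<le> x r" using x0 root_in by (auto simp: pattern_index_def)
  have yr: "0 \<le> y r" using y0 root_in by auto
  have leP: "x v \<le> x r" if "v \<in> {1..m}" for v
    using root_le[of "\<lambda>v. - x v" v] P that by auto
  have leQ: "y v \<le> y r" if "v \<in> {1..m}" for v
    using root_le[of "\<lambda>v. - y v" v] Q that by (auto simp: y_def)
  have W_sub: "W \<subseteq> {1..m} - {r}"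
    using path_in path_ne_root by (force simp: W_def)
  have C_sub: "C \<subseteq> {1..m} - {r}"
    using W_sub next_other(2) by (auto simp: C_def)
  have W_disj: "W \<inter> (new - anc) = {}"
  proof -
    have "path k \<notin> new - anc" if "k < d" for k
    proof (cases k)
      case 0
      then show ?thesis using j0_shared by (auto simp: path_def new_def)
    next
      case (Suc l)
      then have "path k \<in> anc" using that by (auto simp: anc_def)
      then show ?thesis by simp
    qed
    then show ?thesis by (auto simp: W_def)
  qed
  have sP: "(\<Sum>v\<in>{1..m} - {r}. e v (next_vertex v)) = (\<Sum>v\<in>{1..m} - {r}. \<gamma> * (x (pa v) - x v) + x v)"
  proof (rule sum.cong[OF refl])
    fix v assume "v \<in> {1..m} - {r}"
    then show "e v (next_vertex v) = \<gamma> * (x (pa v) - x v) + x v"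
      using P[of v] by (auto simp: e_def next_vertex_def max_def min_def)
  qed
  have "(\<Sum>v\<in>{1..m} - {r}. \<gamma> * (x (pa v) - x v)) \<le> \<gamma> * (leaves * x r)"
    unfolding sum_distrib_left[symmetric] using P x0
    by (intro mult_left_mono \<gamma> sum_parent_diff_le) (auto simp: pattern_index_def)
  then have bP: "(\<Sum>v\<in>{1..m} - {r}. e v (next_vertex v)) \<le> \<gamma> * leaves * x r + (\<Sum>v\<in>{1..m} - {r}. x v)"
    unfolding sP sum.distrib by (simp add: algebra_simps)
  \<comment> \<open>The radius is symmetric in its two marks, so a backward edge still contributes
    the value \<open>f\<close> of its lower end, although its upper end is the point integrated
    out.\<close>
  have sQ: "(\<Sum>j\<in>new. e (m + j) (next_vertex (m + j))) = (\<Sum>c\<in>C. f c)"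
  proof -
    have "(\<Sum>j\<in>new. e (m + j) (next_vertex (m + j))) =
        (\<Sum>j\<in>new - anc. e (m + j) (next_vertex (m + j))) + (\<Sum>j\<in>anc. e (m + j) (next_vertex (m + j)))"
      by (rule sum.subset_diff[OF anc_new]) simp
    also have "(\<Sum>j\<in>new - anc. e (m + j) (next_vertex (m + j))) = (\<Sum>c\<in>new - anc. f c)"
    proof (rule sum.cong[OF refl])
      fix j assume j: "j \<in> new - anc"
      then have "x (m + j) = y j" by (simp add: y_def \<tau>_new)
      moreover have "x (next_vertex (m + j)) = y (pa j)" using next_other[OF j] by (simp add: y_def)
      ultimately show "e (m + j) (next_vertex (m + j)) = f j"
        using Q[of j] next_other(2)[OF j] by (simp add: e_def f_def y_def max_def min_def)
    qed
    also have "(\<Sum>j\<in>anc. e (m + j) (next_vertex (m + j))) = (\<Sum>k\<in>{1..d}. e (m + path k) (next_vertex (m + path k)))"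
      unfolding anc_def
      by (rule sum.reindex_cong[OF inj_on_subset[OF inj_on_path]]) auto
    also have "\<dots> = (\<Sum>k\<in>{1..d}. f (path (k - 1)))"
    proof (rule sum.cong[OF refl])
      fix k assume k: "k \<in> {1..d}"
      then have "path k \<in> new" using anc_new by (auto simp: anc_def)
      then have "x (m + path k) = y (path k)" by (simp add: y_def \<tau>_new)
      moreover have "x (next_vertex (m + path k)) = y (path (k - 1))"
        using next_down[OF k] by (simp add: y_def)
      moreover have pk: "path k = pa (path (k - 1))" using k path_Suc[of "k - 1"] by simp
      moreover have "k - 1 < d" "k - 1 \<le> d" using k by auto
      then have "path (k - 1) \<in> {1..m} - {r}"
        using path_in[of "k - 1"] path_ne_root[of "k - 1"] by auto
      then have "y (path (k - 1)) \<le> y (path k)" unfolding pk using Q by (simp add: y_def)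
      ultimately show "e (m + path k) (next_vertex (m + path k)) = f (path (k - 1))"
        by (simp add: e_def f_def max_def min_def)
    qed
    also have "\<dots> = (\<Sum>k\<in>{..<d}. f (path k))"
      by (rule sum.reindex_bij_witness[of _ Suc "\<lambda>k. k - 1"]) auto
    also have "\<dots> = (\<Sum>c\<in>W. f c)"
      unfolding W_def
      by (rule sum.reindex_cong[symmetric, OF inj_on_subset[OF inj_on_path]]) auto
    finally show ?thesis
      unfolding C_def using W_disj by (subst sum.union_disjoint) (auto simp: W_def)
  qed
  \<comment> \<open>Edges of the second copy outside the spanning tree are discarded as connections,
    but their mark order survives: their increments are nonnegative and may be added to complete the
    telescoping.\<close>
  have "(\<Sum>c\<in>C. y (pa c) - y c) \<le> (\<Sum>c\<in>{1..m} - {r}. y (pa c) - y c)"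
    by (rule sum_mono2) (use C_sub Q in \<open>auto simp: y_def\<close>)
  also have "\<dots> \<le> leaves * y r"
    using Q y0 by (intro sum_parent_diff_le) (auto simp: y_def)
  finally have "\<gamma> * (\<Sum>c\<in>C. y (pa c) - y c) \<le> \<gamma> * (leaves * y r)" using \<gamma> by (rule mult_left_mono)
  then have bQ: "(\<Sum>j\<in>new. e (m + j) (next_vertex (m + j))) \<le> \<gamma> * leaves * y r + (\<Sum>c\<in>C. y c)"
    unfolding sQ f_def sum.distrib sum_distrib_left by (simp add: algebra_simps)
  have xy: "x (m + j) = y j" if "j \<in> new" for j using \<tau>_new[OF that] by (simp add: y_def)
  have cm: "card new \<le> m" using card_mono[OF _ new_sub] by simp
  have gl: "\<gamma> * leaves = 1 / 2 - (2 * m + 2) * \<delta>" using \<delta> by simp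
  \<comment> \<open>The total price of lowering the exponent by \<delta> at every vertex: at most
    \<open>m\<close> shares at each of the two roots.\<close>
  have dP: "(\<Sum>v\<in>{1..m} - {r}. \<delta> * x v) \<le> m * \<delta> * x r"
  proof -
    have "(\<Sum>v\<in>{1..m} - {r}. \<delta> * x v) \<le> (\<Sum>v\<in>{1..m} - {r}. \<delta> * x r)"
      using leP \<delta> by (intro sum_mono mult_left_mono) auto
    also have "\<dots> = (m - 1) * (\<delta> * x r)" using root_in by simp
    also have "\<dots> \<le> m * (\<delta> * x r)" using \<delta> xr by (intro mult_right_mono) auto
    finally show ?thesis by simp
  qed
  have dQ: "(\<Sum>v\<in>new. \<delta> * y v) \<le> m * \<delta> * y r"
  proof -
    have "(\<Sum>v\<in>new. \<delta> * y v) \<le> (\<Sum>v\<in>new. \<delta> * y r)"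
      using leQ new_sub \<delta> by (intro sum_mono mult_left_mono) auto
    also have "\<dots> = card new * (\<delta> * y r)" by simp
    also have "\<dots> \<le> m * (\<delta> * y r)" using cm \<delta> yr by (intro mult_right_mono) auto
    finally show ?thesis by simp
  qed
  have goal: "(\<Sum>v\<in>V - {r}. (1 - \<delta>) * x v) =
      (\<Sum>v\<in>{1..m} - {r}. x v) - (\<Sum>v\<in>{1..m} - {r}. \<delta> * x v) + ((\<Sum>j\<in>new. y j) - (\<Sum>j\<in>new. \<delta> * y j))"
    unfolding sum_index using xy by (simp add: algebra_simps sum_subtractf)
  \<comment> \<open>Naming the products leaves an inequality that is linear in the named
    quantities.\<close>
  define gx gy dx dy mx my where "gx = \<gamma> * leaves * x r" and "gy = \<gamma> * leaves * y r"
    and "dx = \<delta> * x r" and "dy = \<delta> * y r" and "mx = m * \<delta> * x r" and "my = m * \<delta> * y r"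
  note gdefs = this
  have lin: "gx = x r / 2 - 2 * mx - 2 * dx" "gy = y r / 2 - 2 * my - 2 * dy"
    unfolding gdefs gl by (simp_all add: algebra_simps)
  have nonneg: "0 \<le> dx" "0 \<le> dy" "0 \<le> mx" "0 \<le> my"
    using xr yr \<delta> by (simp_all add: gdefs)
  have rhs: "(1 - 2 * \<delta>) * x r = x r - 2 * dx" by (simp add: gdefs algebra_simps)
  show ?thesis
  \<comment> \<open>If \<open>d = 0\<close>, the second root is a vertex of the first copy, so its
    logarithmic mark is at most \<open>x r\<close>, and twice \<gamma> times \<open>leaves\<close>
    being below 1 suffices.\<close>
  proof (cases "d = 0")
    case True
    then have "j0 = r" using path_d by (simp add: path_def)
    then have "\<tau> r \<in> {1..m}" using j0_shared by (simp add: shared_def)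
    then have le: "y r \<le> x r" using leP by (simp add: y_def)
    have "C = new" using True by (simp add: C_def W_def anc_def)
    then have total: "(\<Sum>v\<in>V - {r}. e v (next_vertex v)) \<le>
        \<gamma> * leaves * x r + (\<Sum>v\<in>{1..m} - {r}. x v) + (\<gamma> * leaves * y r + (\<Sum>c\<in>new. y c))"
      unfolding sum_index using bP bQ by simp
    have "gy \<le> gx" using le \<gamma> unfolding gdefs by (intro mult_left_mono) auto
    moreover have "my \<le> mx" using le \<delta> unfolding gdefs by (intro mult_left_mono) auto
    ultimately show ?thesis
      using total dP dQ lin nonneg unfolding goal rhs gdefs[symmetric] by linarith
  next
    case False
    have r_new: "r \<in> new" using root_new False by simp
    \<comment> \<open>Along the upward path each new ancestor is paid for by the vertex below it,
      which shifts the sum over \<open>new\<close> by one place: the second root drops out and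
      \<open>j0\<close> comes in.\<close>
    have C_eq: "C = insert j0 (new - {r})"
    proof -
      have "{..<d} = insert 0 {1..<d}" using False by auto
      moreover have "path 0 = j0" by (simp add: path_def)
      ultimately have W: "W = insert j0 (path ` {1..<d})"
        unfolding W_def by (simp only: image_insert)
      have "{1..d} = insert d {1..<d}" using False by auto
      then have A: "anc = insert r (path ` {1..<d})"
        unfolding anc_def by (simp only: image_insert path_d)
      have "r \<notin> path ` {1..<d}"
      proof
        assume "r \<in> path ` {1..<d}"
        then obtain k where "k < d" "path k = r" by auto
        then show False using path_ne_root by blast
      qed
      moreover have "path ` {1..<d} \<subseteq> new" using A anc_new by auto
      ultimately show ?thesis unfolding C_def W A using r_new by blast
    qed
    have j0n: "j0 \<notin> new" using j0_shared by (simp add: new_def)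
    have sC: "(\<Sum>c\<in>C. y c) = y j0 + ((\<Sum>c\<in>new. y c) - y r)"
      unfolding C_eq using j0n r_new by (simp add: sum_diff1)
    have "\<tau> j0 \<in> {1..m}" using j0_shared by (simp add: shared_def)
    then have "y j0 \<le> x r" "y j0 \<le> y r" using leP leQ j0_in by (auto simp: y_def)
    \<comment> \<open>The shared vertex belongs to both copies, so its logarithmic mark is bounded
      by that of either root, hence by their average.\<close>
    then have half: "y j0 \<le> x r / 2 + y r / 2" by simp
    have total: "(\<Sum>v\<in>V - {r}. e v (next_vertex v)) \<le>
        \<gamma> * leaves * x r + (\<Sum>v\<in>{1..m} - {r}. x v) + (\<gamma> * leaves * y r + (y j0 + ((\<Sum>c\<in>new. y c) - y r)))"
      unfolding sum_index using bP bQ sC by simp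
    show ?thesis
      using total dP dQ half lin nonneg unfolding goal rhs gdefs[symmetric] by linarith
  qed
qed

end

section \<open>Integration along spanning trees on the torus\<close>

text \<open>The shifts by -1, 0 and 1 period suffice for points of the fundamental domain, and a
  minimum of three terms is immediate to measure and to integrate.\<close>

definition wrap_dist :: "real \<Rightarrow> real \<Rightarrow> real \<Rightarrow> real" where
  "wrap_dist n x y = min \<bar>x - y\<bar> (min \<bar>x - y + n\<bar> \<bar>x - y - n\<bar>)"

lemma torus_dist_eq_wrap_dist:
  assumes n: "0 < n" and xy: "\<bar>x - y\<bar> \<le> n"
  shows "torus_dist n x y = wrap_dist n x y"
proof -
  have bdd: "bdd_below (range (\<lambda>z::int. \<bar>x - y + n * of_int z\<bar>))"
    by (rule bdd_belowI[of _ 0]) auto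
  have low: "torus_dist n x y \<le> \<bar>x - y + n * of_int z\<bar>" for z :: int
    unfolding torus_dist_def by (rule cINF_lower[OF bdd]) simp
  have "torus_dist n x y \<le> wrap_dist n x y"
    using low[of 0] low[of 1] low[of "-1"] by (simp add: wrap_dist_def)
  moreover have "wrap_dist n x y \<le> torus_dist n x y"
    unfolding torus_dist_def
  proof (rule cINF_greatest)
    fix z :: int
    consider "z = 0" | "z = 1" | "z = -1" | "2 \<le> \<bar>z\<bar>" by linarith
    then show "wrap_dist n x y \<le> \<bar>x - y + n * of_int z\<bar>"
    proof cases
      \<comment> \<open>A shift by at least two periods leaves a distance of at least
        \<open>2 * n\<close> minus \<open>\<bar>x - y\<bar>\<close>, which is no smaller than
        \<open>n\<close>.\<close>
      case 4
      then have "n * 2 \<le> n * \<bar>of_int z\<bar>" using n by (intro mult_left_mono) auto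
      then have "n * 2 - \<bar>x - y\<bar> \<le> \<bar>n * of_int z\<bar> - \<bar>x - y\<bar>" using n by (simp add: abs_mult)
      also have "\<dots> \<le> \<bar>x - y + n * of_int z\<bar>" by arith
      finally show ?thesis using xy n unfolding wrap_dist_def by linarith
    qed (auto simp: wrap_dist_def)
  qed simp
  ultimately show ?thesis by simp
qed

lemma wrap_dist_commute: "wrap_dist n x y = wrap_dist n y x"
  by (auto simp: wrap_dist_def min_def abs_if)

text \<open>Three intervals of length 2\<rho>, with possible overlaps ignored.\<close>

lemma emeasure_wrap_dist_le:
  assumes "0 \<le> \<rho>"
  shows "emeasure lborel {x. wrap_dist n x y \<le> \<rho>} \<le> ennreal (6 * \<rho>)"
proof -
  have "emeasure lborel {x. wrap_dist n x y \<le> \<rho>} \<le>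
      emeasure lborel (({y - \<rho>..y + \<rho>} \<union> {y - n - \<rho>..y - n + \<rho>}) \<union> {y + n - \<rho>..y + n + \<rho>})"
    by (rule emeasure_mono) (auto simp: wrap_dist_def min_le_iff_disj abs_le_iff)
  also have "\<dots> \<le> emeasure lborel {y - \<rho>..y + \<rho>} + emeasure lborel {y - n - \<rho>..y - n + \<rho>}
      + emeasure lborel {y + n - \<rho>..y + n + \<rho>}"
    by (intro order.trans[OF emeasure_subadditive] add_right_mono emeasure_subadditive) auto
  also have "\<dots> = ennreal (6 * \<rho>)"
    using assms by (simp add: ennreal_plus[symmetric] del: ennreal_plus)
  finally show ?thesis .
qed

lemma nn_integral_powr_unit:
  assumes "0 < (\<delta> :: real)"
  shows "(\<integral>\<^sup>+u. ennreal (u powr (\<delta> - 1)) * indicator {0..1} u \<partial>lborel) = ennreal (1 / \<delta>)"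
  using has_integral_powr_from_0[of "\<delta> - 1" 1] assms
  by (intro nn_integral_has_integral_lebesgue') auto

section \<open>The intensity measure on the marked torus\<close>

lemma space_unit_intensity[simp]: "space (unit_intensity n) = marked_torus n"
  by (simp add: unit_intensity_def space_restrict_space)

lemma marked_torus_measurable[measurable]: "marked_torus n \<in> sets borel"
  unfolding marked_torus_def by (intro borel_Times) auto

lemma sets_unit_intensity: "A \<in> sets (unit_intensity n) \<longleftrightarrow> A \<in> sets borel \<and> A \<subseteq> marked_torus n"
  unfolding unit_intensity_def by (subst sets_restrict_space_iff) auto

lemma measurable_unit_intensity:
  "f \<in> measurable borel M \<Longrightarrow> f \<in> measurable (unit_intensity n) M"
  unfolding unit_intensity_def by (rule measurable_restrict_space1) simp

lemma fst_snd_measurable: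
  "fst \<in> borel_measurable (unit_intensity n)" "snd \<in> borel_measurable (unit_intensity n)"
  by (auto intro!: measurable_unit_intensity borel_measurable_continuous_onI continuous_intros)

lemma emeasure_unit_intensity:
  "A \<in> sets borel \<Longrightarrow> A \<subseteq> marked_torus n \<Longrightarrow> emeasure (unit_intensity n) A = emeasure lborel A"
  unfolding unit_intensity_def by (rule emeasure_restrict_space) auto

lemma emeasure_lborel_Times:
  "A \<in> sets borel \<Longrightarrow> B \<in> sets borel \<Longrightarrow>
    emeasure lborel (A \<times> B :: (real \<times> real) set) = emeasure lborel A * emeasure lborel B"
  by (subst lborel_prod[symmetric]) (simp add: lborel.emeasure_pair_measure_Times)

lemma nn_integral_unit_intensity:
  "(\<integral>\<^sup>+q. f q \<partial>unit_intensity n) = (\<integral>\<^sup>+q. f q * indicator (marked_torus n) q \<partial>lborel)"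
  unfolding unit_intensity_def by (rule nn_integral_restrict_space) simp

lemma finite_measure_unit_intensity: "finite_measure (unit_intensity n)"
proof (rule finite_measureI)
  have "emeasure (unit_intensity n) (marked_torus n) = emeasure lborel (marked_torus n)"
    by (rule emeasure_unit_intensity) auto
  also have "\<dots> < \<infinity>"
    unfolding marked_torus_def by (subst emeasure_lborel_Times) (cases "0 \<le> n"; simp)+
  finally show "emeasure (unit_intensity n) (space (unit_intensity n)) \<noteq> \<infinity>" by simp
qed

interpretation unit: product_sigma_finite "\<lambda>_ :: nat. unit_intensity n" for n
  by (rule product_sigma_finite.intro)
    (rule finite_measure.axioms(1)[OF finite_measure_unit_intensity, unfolded finite_measure_axioms_def])

text \<open>Allows logarithms of the marks, and removes the points at which \<open>powr\<close>
  takes the conventional value 0.\<close>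

lemma AE_mark_pos:
  assumes V: "finite (V :: nat set)"
  shows "AE R in PiM V (\<lambda>_. unit_intensity n). \<forall>v\<in>V. 0 < snd (R v)"
proof (rule AE_finite_allI[OF V])
  fix v assume v: "v \<in> V"
  let ?Z = "marked_torus n \<inter> (UNIV \<times> {0})"
  let ?B = "\<lambda>w. if w = v then ?Z else marked_torus n"
  have "UNIV \<times> {0 :: real} \<in> sets (borel :: (real \<times> real) measure)" by (rule borel_Times) auto
  then have Z: "?Z \<in> sets (unit_intensity n)" by (auto simp: sets_unit_intensity)
  have B: "?B w \<in> sets (unit_intensity n)" for w
    using Z sets.top[of "unit_intensity n"] by auto
  have "emeasure (unit_intensity n) ?Z = emeasure lborel ?Z"
    by (rule emeasure_unit_intensity) (use Z in \<open>auto simp: sets_unit_intensity\<close>)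
  also have "\<dots> \<le> emeasure lborel ((UNIV :: real set) \<times> {0 :: real})"
    by (rule emeasure_mono) (auto intro: borel_Times)
  also have "\<dots> = 0" by (subst emeasure_lborel_Times) auto
  finally have Z0: "emeasure (unit_intensity n) ?Z = 0" by simp
  have "emeasure (PiM V (\<lambda>_. unit_intensity n)) (Pi\<^sub>E V ?B) = (\<Prod>w\<in>V. emeasure (unit_intensity n) (?B w))"
    by (rule unit.emeasure_PiM[OF V B])
  also have "\<dots> = 0" using V v Z0 by (auto intro!: prod_zero bexI[of _ v])
  finally have "Pi\<^sub>E V ?B \<in> null_sets (PiM V (\<lambda>_. unit_intensity n))"
    using V B by (auto intro!: null_setsI sets_PiM_I_finite)
  then show "AE R in PiM V (\<lambda>_. unit_intensity n). 0 < snd (R v)"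
  proof (rule AE_I')
    show "{R \<in> space (PiM V (\<lambda>_. unit_intensity n)). \<not> 0 < snd (R v)} \<subseteq> Pi\<^sub>E V ?B"
    proof
      fix R assume "R \<in> {R \<in> space (PiM V (\<lambda>_. unit_intensity n)). \<not> 0 < snd (R v)}"
      then have R: "R \<in> space (PiM V (\<lambda>_. unit_intensity n))" "\<not> 0 < snd (R v)" by auto
      then have "R v \<in> marked_torus n" using v by (auto simp: space_PiM)
      then have "R v \<in> ?Z" using R(2) by (cases "R v") (auto simp: marked_torus_def)
      then show "R \<in> Pi\<^sub>E V ?B" using R(1) by (auto simp: space_PiM PiE_iff)
    qed
  qed
qed

text \<open>A vertex of largest rank is the \<open>nxt\<close> of no other vertex, so it occurs in
  one kernel only and can be integrated out at the cost of a factor \<open>c\<close>. Repeating this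
  strips the tree down to its root.\<close>

lemma nn_integral_spanning_tree_le:
  fixes nxt rank :: "nat \<Rightarrow> nat" and K :: "'a \<Rightarrow> 'a \<Rightarrow> ennreal" and \<nu> :: "'a measure"
  assumes \<nu>: "sigma_finite_measure \<nu>" and V: "finite V" and r: "r \<notin> V"
    and nxt: "\<And>v. v \<in> V \<Longrightarrow> nxt v \<in> insert r V"
    and rank: "\<And>v. v \<in> V \<Longrightarrow> rank (nxt v) < rank v"
    and g[measurable]: "g \<in> borel_measurable \<nu>"
    and K[measurable]: "case_prod K \<in> borel_measurable (\<nu> \<Otimes>\<^sub>M \<nu>)"
    and c: "\<And>p. p \<in> space \<nu> \<Longrightarrow> (\<integral>\<^sup>+q. K q p \<partial>\<nu>) \<le> c"
  shows "(\<integral>\<^sup>+R. g (R r) * (\<Prod>v\<in>V. K (R v) (R (nxt v))) \<partial>PiM (insert r V) (\<lambda>_. \<nu>))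
    \<le> (\<integral>\<^sup>+q. g q \<partial>\<nu>) * c ^ card V"
proof -
  interpret product_sigma_finite "\<lambda>_ :: nat. \<nu>" by (rule product_sigma_finite.intro) (rule \<nu>)
  have meas: "(\<lambda>R. g (R r) * (\<Prod>v\<in>W. K (R v) (R (nxt v)))) \<in> borel_measurable (PiM (insert r W) (\<lambda>_. \<nu>))"
    if "\<And>v. v \<in> W \<Longrightarrow> nxt v \<in> insert r W" for W
  proof (intro borel_measurable_times_ennreal borel_measurable_prod_ennreal)
    show "(\<lambda>R. g (R r)) \<in> borel_measurable (PiM (insert r W) (\<lambda>_. \<nu>))"
      using measurable_compose[OF measurable_component_singleton[of r "insert r W" "\<lambda>_. \<nu>"] g] by simp
    fix v assume v: "v \<in> W"
    have "(\<lambda>R. (R v, R (nxt v))) \<in> measurable (PiM (insert r W) (\<lambda>_. \<nu>)) (\<nu> \<Otimes>\<^sub>M \<nu>)"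
      using that[OF v] v by (intro measurable_Pair measurable_component_singleton) auto
    from measurable_compose[OF this K]
    show "(\<lambda>R. K (R v) (R (nxt v))) \<in> borel_measurable (PiM (insert r W) (\<lambda>_. \<nu>))" by simp
  qed
  from V r nxt rank show ?thesis
  proof (induction V rule: finite_ranking_induct[where f = rank])
    case empty
    show ?case by (simp add: product_nn_integral_singleton)
  next
    case (insert v W)
    show ?case
    proof (cases "v \<in> W")
      case True
      then show ?thesis using insert by (simp add: insert_absorb)
    next
      case False
      have vr: "v \<noteq> r" "r \<notin> W" using insert.prems(1) by auto
      \<comment> \<open>If \<open>nxt w\<close> were \<open>v\<close>, the rank of \<open>v\<close>
        would lie strictly below that of \<open>w\<close>, against its maximality.\<close>
      have nW: "nxt w \<in> insert r W" if "w \<in> W" for w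
      proof -
        have "nxt w \<noteq> v" using insert.hyps(2)[OF that] insert.prems(3)[of w] that by auto
        then show ?thesis using insert.prems(2)[of w] that by auto
      qed
      have nv: "nxt v \<in> insert r W"
        using insert.prems(2)[of v] insert.prems(3)[of v] by auto
      define F where "F R = g (R r) * (\<Prod>w\<in>W. K (R w) (R (nxt w)))" for R
      have F[measurable]: "F \<in> borel_measurable (PiM (insert r W) (\<lambda>_. \<nu>))"
        unfolding F_def using meas[OF nW] by simp
      have ins: "insert r (insert v W) = insert v (insert r W)" by auto
      have "(\<integral>\<^sup>+R. g (R r) * (\<Prod>w\<in>insert v W. K (R w) (R (nxt w))) \<partial>PiM (insert r (insert v W)) (\<lambda>_. \<nu>))
        = (\<integral>\<^sup>+x. \<integral>\<^sup>+y. g ((x(v := y)) r) * (\<Prod>w\<in>insert v W. K ((x(v := y)) w) ((x(v := y)) (nxt w))) \<partial>\<nu>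
            \<partial>PiM (insert r W) (\<lambda>_. \<nu>))"
        unfolding ins
        by (rule product_nn_integral_insert)
          (use insert vr False meas[of "insert v W"] in \<open>auto simp: ins\<close>)
      also have "\<dots> = (\<integral>\<^sup>+x. \<integral>\<^sup>+y. F x * K y (x (nxt v)) \<partial>\<nu> \<partial>PiM (insert r W) (\<lambda>_. \<nu>))"
      proof (intro nn_integral_cong)
        fix x y
        have "(\<Prod>w\<in>W. K ((x(v := y)) w) ((x(v := y)) (nxt w))) = (\<Prod>w\<in>W. K (x w) (x (nxt w)))"
        proof (rule prod.cong[OF refl])
          fix w assume w: "w \<in> W"
          then have "w \<noteq> v" "nxt w \<noteq> v" using False nW[OF w] vr by auto
          then show "K ((x(v := y)) w) ((x(v := y)) (nxt w)) = K (x w) (x (nxt w))" by simp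
        qed
        moreover have "nxt v \<noteq> v" using nv False vr by auto
        ultimately show "g ((x(v := y)) r) * (\<Prod>w\<in>insert v W. K ((x(v := y)) w) ((x(v := y)) (nxt w))) =
            F x * K y (x (nxt v))"
          using insert.hyps(1) False vr unfolding F_def by (simp add: ac_simps)
      qed
      also have "\<dots> \<le> (\<integral>\<^sup>+x. F x * c \<partial>PiM (insert r W) (\<lambda>_. \<nu>))"
      proof (rule nn_integral_mono)
        fix x assume x: "x \<in> space (PiM (insert r W) (\<lambda>_. \<nu>))"
        then have xn: "x (nxt v) \<in> space \<nu>" using nv by (auto simp: space_PiM PiE_iff)
        then have "(\<lambda>y. K y (x (nxt v))) \<in> borel_measurable \<nu>"
          using measurable_compose[OF measurable_Pair2' K, of "x (nxt v)"] by simp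
        then have "(\<integral>\<^sup>+y. F x * K y (x (nxt v)) \<partial>\<nu>) = F x * (\<integral>\<^sup>+y. K y (x (nxt v)) \<partial>\<nu>)"
          by (rule nn_integral_cmult)
        also have "\<dots> \<le> F x * c" using c[OF xn] by (intro mult_left_mono) auto
        finally show "(\<integral>\<^sup>+y. F x * K y (x (nxt v)) \<partial>\<nu>) \<le> F x * c" .
      qed
      also have "\<dots> = (\<integral>\<^sup>+x. F x \<partial>PiM (insert r W) (\<lambda>_. \<nu>)) * c"
        by (rule nn_integral_multc) (rule F)
      also have "\<dots> \<le> ((\<integral>\<^sup>+q. g q \<partial>\<nu>) * c ^ card W) * c"
        unfolding F_def
        by (intro mult_right_mono insert.IH) (use insert vr nW in auto)
      also have "\<dots> = (\<integral>\<^sup>+q. g q \<partial>\<nu>) * c ^ card (insert v W)"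
        using insert.hyps(1) False by (simp add: ac_simps)
      finally show ?thesis .
    qed
  qed
qed

section \<open>Overlapping copies of the tree\<close>

locale adrcm_tree = rooted_tree m r pa dep for m r pa dep +
  fixes \<beta> \<gamma> :: real
  assumes \<beta>: "0 < \<beta>" and \<gamma>: "0 < \<gamma>" and \<gamma>_leaves: "2 * \<gamma> * leaves < 1"
begin

text \<open>The slack in the exponent cut into equal shares: \<open>m\<close> for the vertices of
  each copy, and two more for the first root, one making its mark integrable and the other producing
  \<open>\<kappa> powr \<delta>\<close>.\<close>

definition \<delta> :: real where "\<delta> = (1 / 2 - \<gamma> * leaves) / (2 * m + 2)"

lemma \<delta>_pos: "0 < \<delta>" using \<gamma>_leaves by (simp add: \<delta>_def)

lemma \<delta>_eq: "(2 * m + 2) * \<delta> = 1 / 2 - \<gamma> * leaves"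
proof -
  have "real (2 * m + 2) \<noteq> 0" by linarith
  then show ?thesis unfolding \<delta>_def by (metis nonzero_mult_div_cancel_left times_divide_eq_right)
qed

lemma \<gamma>_less: "\<gamma> < 1"
proof -
  have "1 \<le> leaves" unfolding leaves_eq_sum by simp
  then have "2 * \<gamma> * 1 \<le> 2 * \<gamma> * leaves" using \<gamma> by (intro mult_left_mono) auto
  then show ?thesis using \<gamma>_leaves by simp
qed

text \<open>Symmetric in the two marks, because the spanning tree uses some edges backwards.\<close>

definition radius :: "real \<Rightarrow> real \<Rightarrow> real" where
  "radius u w = \<beta> * min u w powr (- \<gamma>) * max u w powr (\<gamma> - 1)"

lemma radius_commute: "radius u w = radius w u"
  by (simp add: radius_def min.commute max.commute)

lemma radius_nonneg: "0 \<le> radius u w"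
  using \<beta> by (simp add: radius_def)

lemma radius_eq_exp:
  assumes "0 < u" "0 < w"
  shows "radius u w = \<beta> * exp (\<gamma> * (max (- ln u) (- ln w) - min (- ln u) (- ln w)) + min (- ln u) (- ln w))"
proof (cases "u \<le> w")
  case True
  then have "min u w = u" "max u w = w" "max (- ln u) (- ln w) = - ln u" "min (- ln u) (- ln w) = - ln w"
    using assms by auto
  then show ?thesis
    using assms by (simp add: radius_def powr_def exp_add[symmetric] algebra_simps)
next
  case False
  then have "min u w = w" "max u w = u" "max (- ln u) (- ln w) = - ln w" "min (- ln u) (- ln w) = - ln u"
    using assms by auto
  then show ?thesis
    using assms by (simp add: radius_def powr_def exp_add[symmetric] algebra_simps)
qed

text \<open>The indicator of being within connection range, divided by the radius and weighted by an
  integrable power of the mark. Integrating the position cancels the radius, so the integral is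
  bounded uniformly in \<open>p\<close>; the radii removed here are the ones that
  \<open>sum_log_radius_le\<close> estimates.\<close>

definition kernel :: "real \<Rightarrow> real \<times> real \<Rightarrow> real \<times> real \<Rightarrow> ennreal" where
  "kernel n q p = ennreal (if wrap_dist n (fst q) (fst p) \<le> radius (snd q) (snd p)
     then snd q powr (\<delta> - 1) / radius (snd q) (snd p) else 0)"

lemma wrap_dist_measurable:
  "f \<in> borel_measurable M \<Longrightarrow> f' \<in> borel_measurable M \<Longrightarrow> (\<lambda>P. wrap_dist n (f P) (f' P)) \<in> borel_measurable M"
  unfolding wrap_dist_def
  by (intro borel_measurable_min borel_measurable_abs borel_measurable_add borel_measurable_diff
      borel_measurable_const)

lemma radius_measurable:
  "g \<in> borel_measurable M \<Longrightarrow> g' \<in> borel_measurable M \<Longrightarrow> (\<lambda>P. radius (g P) (g' P)) \<in> borel_measurable M"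
  unfolding radius_def
  by (intro borel_measurable_times powr_real_measurable borel_measurable_min borel_measurable_max
      borel_measurable_const)

lemma kernel_formula_measurable:
  assumes m: "f \<in> borel_measurable M" "f' \<in> borel_measurable M"
    "g \<in> borel_measurable M" "g' \<in> borel_measurable M"
  shows "(\<lambda>P. ennreal (if wrap_dist n (f P) (f' P) \<le> radius (g P) (g' P)
     then g P powr (\<delta> - 1) / radius (g P) (g' P) else 0)) \<in> borel_measurable M"
  by (intro measurable_compose[OF _ measurable_ennreal] measurable_If borel_measurable_divide
      powr_real_measurable radius_measurable borel_measurable_le wrap_dist_measurable m borel_measurable_const)

lemma kernel_measurable:
  "case_prod (kernel n) \<in> borel_measurable (unit_intensity n \<Otimes>\<^sub>M unit_intensity n)"
  unfolding kernel_def split_beta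
  by (intro kernel_formula_measurable measurable_compose[OF measurable_fst fst_snd_measurable(1)]
      measurable_compose[OF measurable_snd fst_snd_measurable(1)]
      measurable_compose[OF measurable_fst fst_snd_measurable(2)]
      measurable_compose[OF measurable_snd fst_snd_measurable(2)])

lemma nn_integral_kernel_le: "(\<integral>\<^sup>+q. kernel n q p \<partial>unit_intensity n) \<le> ennreal (6 / \<delta>)"
proof -
  let ?c = "\<lambda>u. u powr (\<delta> - 1) / radius u (snd p)"
  let ?f = "\<lambda>z. kernel n z p * indicator {0..1} (snd z)"
  have f: "?f \<in> borel_measurable (lborel \<Otimes>\<^sub>M lborel)"
    unfolding kernel_def by (intro borel_measurable_times_ennreal kernel_formula_measurable) auto
  have "(\<integral>\<^sup>+q. kernel n q p \<partial>unit_intensity n) \<le> (\<integral>\<^sup>+q. ?f q \<partial>lborel)"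
    unfolding nn_integral_unit_intensity
    by (rule nn_integral_mono) (auto simp: indicator_def marked_torus_def)
  also have "\<dots> = (\<integral>\<^sup>+q. ?f q \<partial>(lborel \<Otimes>\<^sub>M lborel))" by (simp add: lborel_prod)
  also have "\<dots> = (\<integral>\<^sup>+u. \<integral>\<^sup>+x. ?f (x, u) \<partial>lborel \<partial>lborel)"
    by (rule lborel_pair.nn_integral_snd[symmetric]) (rule f)
  also have "\<dots> \<le> (\<integral>\<^sup>+u. 6 * (ennreal (u powr (\<delta> - 1)) * indicator {0..1} u) \<partial>lborel)"
  proof (rule nn_integral_mono)
    fix u :: real
    let ?r = "radius u (snd p)"
    have "{x \<in> space borel. wrap_dist n x (fst p) \<le> ?r} \<in> sets borel"
      by (intro borel_measurable_le wrap_dist_measurable borel_measurable_const) simp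
    then have [measurable]: "{x. wrap_dist n x (fst p) \<le> ?r} \<in> sets borel" by simp
    have "(\<integral>\<^sup>+x. ?f (x, u) \<partial>lborel) =
        (\<integral>\<^sup>+x. ennreal (?c u) * indicator {0..1} u * indicator {x. wrap_dist n x (fst p) \<le> ?r} x \<partial>lborel)"
      by (rule nn_integral_cong) (simp add: kernel_def indicator_def)
    also have "\<dots> = ennreal (?c u) * indicator {0..1} u * emeasure lborel {x. wrap_dist n x (fst p) \<le> ?r}"
      by (rule nn_integral_cmult_indicator) simp
    also have "\<dots> \<le> ennreal (?c u) * indicator {0..1} u * ennreal (6 * ?r)"
      by (intro mult_left_mono emeasure_wrap_dist_le radius_nonneg) auto
    also have "\<dots> \<le> 6 * (ennreal (u powr (\<delta> - 1)) * indicator {0..1} u)"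
    proof -
      \<comment> \<open>Equality fails only for radius 0, where the quotient is 0 by
        convention.\<close>
      have "?c u * (6 * ?r) \<le> 6 * u powr (\<delta> - 1)" by simp
      then have "ennreal (?c u) * ennreal (6 * ?r) \<le> 6 * ennreal (u powr (\<delta> - 1))"
        using radius_nonneg[of u "snd p"]
        by (simp add: ennreal_mult[symmetric] ennreal_mult'[symmetric] ennreal_leI flip: ennreal_numeral)
      then show ?thesis by (simp add: indicator_def ac_simps)
    qed
    finally show "(\<integral>\<^sup>+x. ?f (x, u) \<partial>lborel) \<le> 6 * (ennreal (u powr (\<delta> - 1)) * indicator {0..1} u)" .
  qed
  also have "\<dots> = 6 * ennreal (1 / \<delta>)"
    by (subst nn_integral_cmult) (auto simp: nn_integral_powr_unit \<delta>_pos)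
  also have "\<dots> = ennreal (6 / \<delta>)"
    using \<delta>_pos by (simp add: ennreal_mult'[symmetric] flip: ennreal_numeral)
  finally show ?thesis .
qed

lemma nn_integral_root_le:
  assumes D[measurable]: "D \<in> sets borel"
  shows "(\<integral>\<^sup>+q. indicator D (fst q) * ennreal (snd q powr (\<delta> - 1)) \<partial>unit_intensity n)
    \<le> ennreal (1 / \<delta>) * emeasure lborel D"
proof -
  let ?f = "\<lambda>z. indicator D (fst z) * (ennreal (snd z powr (\<delta> - 1)) * indicator {0..1} (snd z)) :: ennreal"
  have "(\<integral>\<^sup>+q. indicator D (fst q) * ennreal (snd q powr (\<delta> - 1)) \<partial>unit_intensity n) \<le> (\<integral>\<^sup>+q. ?f q \<partial>lborel)"
    unfolding nn_integral_unit_intensity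
    by (rule nn_integral_mono) (auto simp: indicator_def marked_torus_def)
  also have "\<dots> = (\<integral>\<^sup>+q. ?f q \<partial>(lborel \<Otimes>\<^sub>M lborel))" by (simp add: lborel_prod)
  also have "\<dots> = (\<integral>\<^sup>+x. \<integral>\<^sup>+u. ?f (x, u) \<partial>lborel \<partial>lborel)"
    by (rule lborel.nn_integral_fst[symmetric]) measurable
  also have "\<dots> = (\<integral>\<^sup>+x. indicator D x * ennreal (1 / \<delta>) \<partial>lborel)"
    by (simp add: nn_integral_cmult nn_integral_powr_unit \<delta>_pos)
  also have "\<dots> = ennreal (1 / \<delta>) * emeasure lborel D"
    by (subst nn_integral_multc) (auto simp: ac_simps)
  finally show ?thesis .
qed

definition tree_event :: "real \<Rightarrow> (nat \<Rightarrow> real \<times> real) set" where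
  "tree_event n = {P \<in> space (PiM {1..m} (\<lambda>_. unit_intensity n)).
     \<forall>v\<in>{1..m} - {r}. adrcm_edge n \<beta> \<gamma> (P v) (P (pa v))}"

lemma adrcm_edge_iff:
  assumes n: "0 < n" and q: "q \<in> marked_torus n" and p: "p \<in> marked_torus n"
  shows "adrcm_edge n \<beta> \<gamma> q p \<longleftrightarrow> snd p < snd q \<and> wrap_dist n (fst q) (fst p) \<le> radius (snd q) (snd p)"
proof -
  have "\<bar>fst p - fst q\<bar> \<le> n" using p q by (auto simp: marked_torus_def)
  then have "torus_dist n (fst p) (fst q) = wrap_dist n (fst q) (fst p)"
    using torus_dist_eq_wrap_dist[OF n] by (simp add: wrap_dist_commute)
  then show ?thesis
    unfolding adrcm_edge_def radius_def by (auto simp: min_def max_def)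
qed

lemma tree_event_iff:
  assumes n: "0 < n"
  shows "P \<in> tree_event n \<longleftrightarrow> P \<in> space (PiM {1..m} (\<lambda>_. unit_intensity n)) \<and>
    (\<forall>v\<in>{1..m} - {r}. snd (P (pa v)) < snd (P v) \<and>
      wrap_dist n (fst (P v)) (fst (P (pa v))) \<le> radius (snd (P v)) (snd (P (pa v))))"
proof -
  have "adrcm_edge n \<beta> \<gamma> (P v) (P (pa v)) \<longleftrightarrow> snd (P (pa v)) < snd (P v) \<and>
      wrap_dist n (fst (P v)) (fst (P (pa v))) \<le> radius (snd (P v)) (snd (P (pa v)))"
    if "P \<in> space (PiM {1..m} (\<lambda>_. unit_intensity n))" "v \<in> {1..m} - {r}" for v
  proof (rule adrcm_edge_iff[OF n])
    show "P v \<in> marked_torus n" "P (pa v) \<in> marked_torus n"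
      using that pa_in[of v] by (auto simp: space_PiM PiE_iff)
  qed
  then show ?thesis unfolding tree_event_def by blast
qed

lemma edge_measurable:
  assumes m: "f \<in> borel_measurable M" "f' \<in> borel_measurable M"
    "g \<in> borel_measurable M" "g' \<in> borel_measurable M"
  shows "{P \<in> space M. g' P < g P \<and> wrap_dist n (f P) (f' P) \<le> radius (g P) (g' P)} \<in> sets M"
  by (intro sets.sets_Collect_conj borel_measurable_less borel_measurable_le
      wrap_dist_measurable radius_measurable m)

lemma tree_event_measurable:
  assumes n: "0 < n" shows "tree_event n \<in> sets (PiM {1..m} (\<lambda>_. unit_intensity n))"
proof -
  have coord: "(\<lambda>P. fst (P v)) \<in> borel_measurable (PiM {1..m} (\<lambda>_. unit_intensity n))"
    "(\<lambda>P. snd (P v)) \<in> borel_measurable (PiM {1..m} (\<lambda>_. unit_intensity n))" if "v \<in> {1..m}" for v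
    using measurable_compose[OF measurable_component_singleton[OF that, of "\<lambda>_. unit_intensity n"]] fst_snd_measurable
    by blast+
  have "tree_event n = {P \<in> space (PiM {1..m} (\<lambda>_. unit_intensity n)).
    (\<forall>v\<in>{1..m} - {r}. snd (P (pa v)) < snd (P v) \<and>
      wrap_dist n (fst (P v)) (fst (P (pa v))) \<le> radius (snd (P v)) (snd (P (pa v))))}"
    using tree_event_iff[OF n] by blast
  also have "\<dots> \<in> sets (PiM {1..m} (\<lambda>_. unit_intensity n))"
  proof (intro sets.sets_Collect_finite_All)
    fix v assume "v \<in> {1..m} - {r}"
    then have v: "v \<in> {1..m}" "pa v \<in> {1..m}" using pa_in by auto
    show "{P \<in> space (PiM {1..m} (\<lambda>_. unit_intensity n)). snd (P (pa v)) < snd (P v) \<and>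
      wrap_dist n (fst (P v)) (fst (P (pa v))) \<le> radius (snd (P v)) (snd (P (pa v)))}
      \<in> sets (PiM {1..m} (\<lambda>_. unit_intensity n))"
      by (intro edge_measurable coord v)
  qed simp
  finally show ?thesis .
qed

lemma root_weight_measurable:
  assumes [measurable]: "f \<in> borel_measurable M" "g \<in> borel_measurable M" "D \<in> sets borel"
  shows "(\<lambda>P. indicator D (f P) * ennreal (g P powr (\<delta> - 1))) \<in> borel_measurable M"
    "{P \<in> space M. f P \<in> D \<and> g P \<le> \<kappa>} \<in> sets M"
  by measurable

text \<open>Each vertex other than the root contributes \<beta> from its radius and
  \<open>6 / \<delta>\<close> from its kernel; the last \<open>1 / \<delta>\<close> is the integral
  of the root mark.\<close>

definition pattern_const :: "(nat \<Rightarrow> nat) \<Rightarrow> real" where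
  "pattern_const \<tau> = (\<beta> * 6 / \<delta>) ^ card (pattern_index m \<tau> - {r}) / \<delta>"

lemma pattern_const_pos: "0 < pattern_const \<tau>"
  using \<beta> \<delta>_pos by (simp add: pattern_const_def)

text \<open>The indicator of the event is dominated almost everywhere by a constant times the root
  weight and the kernels along the spanning tree; this product is then integrated from the highest
  rank downwards. Both the confinement of the root to \<open>D\<close> and the smallness of its mark
  survive in the bound.\<close>

theorem emeasure_glued_le:
  assumes n: "0 < n" and pat: "\<tau> \<in> patterns m" "\<tau> \<noteq> no_overlap m"
    and D: "D \<in> sets borel" and \<kappa>: "0 < \<kappa>"
  defines "\<nu> \<equiv> unit_intensity n"
  shows "emeasure (PiM (pattern_index m \<tau>) (\<lambda>_. \<nu>))
      {R \<in> glued \<nu> m \<tau> (tree_event n) (tree_event n). fst (R r) \<in> D \<and> snd (R r) \<le> \<kappa>}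
    \<le> ennreal (pattern_const \<tau> * \<kappa> powr \<delta>) * emeasure lborel D"
proof -
  interpret overlap_pattern m r pa dep \<tau> using pat by unfold_locales
  let ?k = "card (V - {r})"
  have rV: "r \<in> V" "insert r (V - {r}) = V" using root_in by (auto simp: pattern_index_def)
  let ?G = "{R \<in> glued \<nu> m \<tau> (tree_event n) (tree_event n). fst (R r) \<in> D \<and> snd (R r) \<le> \<kappa>}"
  let ?c = "\<beta> ^ ?k * \<kappa> powr \<delta>"
  let ?g = "\<lambda>q. indicator D (fst q) * ennreal (snd q powr (\<delta> - 1))"
  let ?F = "\<lambda>R. ?g (R r) * (\<Prod>v\<in>V - {r}. kernel n (R v) (R (next_vertex v)))"
  have gm: "?g \<in> borel_measurable \<nu>"
    unfolding \<nu>_def by (intro root_weight_measurable fst_snd_measurable D)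
  have coord: "(\<lambda>P. fst (P r)) \<in> borel_measurable (PiM V (\<lambda>_. \<nu>))"
    "(\<lambda>P. snd (P r)) \<in> borel_measurable (PiM V (\<lambda>_. \<nu>))"
    using measurable_compose[OF measurable_component_singleton[OF rV(1), of "\<lambda>_. \<nu>"]] fst_snd_measurable
    unfolding \<nu>_def by blast+
  \<comment> \<open>In terms of \<open>x\<close>, this is the exponentiated form of
    \<open>sum_log_radius_le\<close>.\<close>
  have point: "1 \<le> ennreal ?c * ?F R" if R: "R \<in> ?G" and pos: "\<forall>v\<in>V. 0 < snd (R v)" for R
  proof -
    define x where "x v = - ln (snd (R v))" for v
    have RV: "R v \<in> marked_torus n" if "v \<in> V" for v
      using R that by (auto simp: glued_def space_PiM \<nu>_def)
    have P: "restrict R {1..m} \<in> tree_event n" and Q: "(\<lambda>j\<in>{1..m}. R (\<tau> j)) \<in> tree_event n"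
      using R by (auto simp: glued_def)
    have eP: "snd (R (pa v)) < snd (R v)"
      "wrap_dist n (fst (R v)) (fst (R (pa v))) \<le> radius (snd (R v)) (snd (R (pa v)))" if "v \<in> {1..m} - {r}" for v
      using conjunct2[OF P[unfolded tree_event_iff[OF n]], rule_format, OF that] that pa_in[of v] by simp_all
    have eQ: "snd (R (\<tau> (pa v))) < snd (R (\<tau> v))"
      "wrap_dist n (fst (R (\<tau> v))) (fst (R (\<tau> (pa v)))) \<le> radius (snd (R (\<tau> v))) (snd (R (\<tau> (pa v))))"
      if "v \<in> {1..m} - {r}" for v
      using conjunct2[OF Q[unfolded tree_event_iff[OF n]], rule_format, OF that] that pa_in[of v] by simp_all
    have V1: "{1..m} \<subseteq> V" by (auto simp: pattern_index_def)
    have near: "wrap_dist n (fst (R v)) (fst (R (next_vertex v))) \<le> radius (snd (R v)) (snd (R (next_vertex v)))"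
      if "v \<in> V - {r}" for v
    proof -
      obtain c where c: "c \<in> {1..m} - {r}" and "v = c \<and> next_vertex v = pa c \<or>
          v = \<tau> c \<and> next_vertex v = \<tau> (pa c) \<or> v = \<tau> (pa c) \<and> next_vertex v = \<tau> c"
        using next_vertex_edge[OF \<open>v \<in> V - {r}\<close>] by blast
      then consider "v = c" "next_vertex v = pa c" | "v = \<tau> c" "next_vertex v = \<tau> (pa c)"
        | "v = \<tau> (pa c)" "next_vertex v = \<tau> c" by blast
      then show ?thesis
      proof cases
        case 1
        show ?thesis unfolding 1(2) unfolding 1(1) by (rule eP(2)[OF c])
      next
        case 2
        show ?thesis unfolding 2(2) unfolding 2(1) by (rule eQ(2)[OF c])
      next
        case 3
        show ?thesis unfolding 3(2) unfolding 3(1)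
          by (subst wrap_dist_commute, subst radius_commute) (rule eQ(2)[OF c])
      qed
    qed
    have S: "(\<Sum>v\<in>V - {r}. \<gamma> * (max (x v) (x (next_vertex v)) - min (x v) (x (next_vertex v))) + min (x v) (x (next_vertex v)))
      \<le> (1 - 2 * \<delta>) * x r + (\<Sum>v\<in>V - {r}. (1 - \<delta>) * x v)" (is "(\<Sum>v\<in>V - {r}. ?e v) \<le> _")
    proof (rule sum_log_radius_le)
      show "0 \<le> x v" if "v \<in> V" for v
        using pos RV[OF that] that by (auto simp: x_def marked_torus_def)
      show "x v \<le> x (pa v)" if "v \<in> {1..m} - {r}" for v
      proof -
        have "0 < snd (R (pa v))" using pos V1 pa_in[of v] that by blast
        then show ?thesis using eP(1)[OF that] by (simp add: x_def)
      qed
      show "x (\<tau> v) \<le> x (\<tau> (pa v))" if "v \<in> {1..m} - {r}" for v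
      proof -
        have "0 < snd (R (\<tau> (pa v)))" using pos \<tau>_in pa_in[of v] that by blast
        then show ?thesis using eQ(1)[OF that] by (simp add: x_def)
      qed
    qed (use \<gamma> \<delta>_pos \<delta>_eq in auto)
    have kern: "kernel n (R v) (R (next_vertex v)) = ennreal (exp ((1 - \<delta>) * x v - ?e v) / \<beta>)"
      if v: "v \<in> V - {r}" for v
    proof -
      have p: "0 < snd (R v)" "0 < snd (R (next_vertex v))" using pos v next_vertex_in[OF v] by auto
      have "snd (R v) powr (\<delta> - 1) = exp ((1 - \<delta>) * x v)"
        using p by (simp add: powr_def x_def algebra_simps)
      then show ?thesis
        using near[OF v] unfolding kernel_def radius_eq_exp[OF p] x_def[symmetric]
        by (simp add: exp_diff mult.commute[of \<beta>])
    qed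
    have "(\<Prod>v\<in>V - {r}. kernel n (R v) (R (next_vertex v))) = (\<Prod>v\<in>V - {r}. ennreal (exp ((1 - \<delta>) * x v - ?e v) / \<beta>))"
      by (rule prod.cong[OF refl]) (rule kern)
    also have "\<dots> = ennreal (exp ((\<Sum>v\<in>V - {r}. (1 - \<delta>) * x v) - (\<Sum>v\<in>V - {r}. ?e v)) / \<beta> ^ ?k)"
      using \<beta> by (subst prod_ennreal) (auto simp: prod_dividef exp_sum[symmetric] sum_subtractf)
    finally have prod: "(\<Prod>v\<in>V - {r}. kernel n (R v) (R (next_vertex v))) =
        ennreal (exp ((\<Sum>v\<in>V - {r}. (1 - \<delta>) * x v) - (\<Sum>v\<in>V - {r}. ?e v)) / \<beta> ^ ?k)" (is "_ = ennreal (exp ?d / _)") .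
    have ur: "0 < snd (R r)" "snd (R r) \<le> \<kappa>" "fst (R r) \<in> D" using pos rV R by auto
    have g: "?g (R r) = ennreal (exp ((1 - \<delta>) * x r))"
      using ur by (simp add: powr_def x_def algebra_simps)
    have "ennreal ?c * ?F R = ennreal (?c * (exp ((1 - \<delta>) * x r) * (exp ?d / \<beta> ^ ?k)))"
      unfolding prod g using \<beta> by (simp add: ennreal_mult'[symmetric] ennreal_mult[symmetric])
    also have "?c * (exp ((1 - \<delta>) * x r) * (exp ?d / \<beta> ^ ?k)) = \<kappa> powr \<delta> * exp ((1 - \<delta>) * x r + ?d)"
      using \<beta> by (simp add: exp_add)
    finally have *: "ennreal ?c * ?F R = ennreal (\<kappa> powr \<delta> * exp ((1 - \<delta>) * x r + ?d))" .
    \<comment> \<open>The root weight uses one of the two shares that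
      \<open>sum_log_radius_le\<close> leaves at \<open>r\<close>; the other is traded here for the
      bound \<kappa> on the mark.\<close>
    have "1 \<le> (\<kappa> / snd (R r)) powr \<delta>"
      using ur \<delta>_pos by (intro ge_one_powr_ge_zero) auto
    also have "\<dots> = \<kappa> powr \<delta> * exp (\<delta> * x r)"
      using ur \<kappa> by (simp add: powr_divide) (simp add: powr_def x_def exp_minus field_simps)
    also have "\<dots> \<le> \<kappa> powr \<delta> * exp ((1 - \<delta>) * x r + ?d)"
      using S by (intro mult_left_mono) (auto simp: algebra_simps)
    finally show ?thesis unfolding * by simp
  qed
  have Gm: "?G \<in> sets (PiM V (\<lambda>_. \<nu>))"
  proof -
    have "glued \<nu> m \<tau> (tree_event n) (tree_event n) \<in> sets (PiM V (\<lambda>_. \<nu>))"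
      unfolding \<nu>_def by (intro glued_measurable tree_event_measurable n)
    moreover have "{R \<in> space (PiM V (\<lambda>_. \<nu>)). fst (R r) \<in> D \<and> snd (R r) \<le> \<kappa>} \<in> sets (PiM V (\<lambda>_. \<nu>))"
      by (intro root_weight_measurable coord D)
    moreover have "?G = glued \<nu> m \<tau> (tree_event n) (tree_event n) \<inter> {R \<in> space (PiM V (\<lambda>_. \<nu>)). fst (R r) \<in> D \<and> snd (R r) \<le> \<kappa>}"
      by (auto simp: glued_def)
    ultimately show ?thesis by simp
  qed
  have F_meas: "?F \<in> borel_measurable (PiM V (\<lambda>_. \<nu>))"
  proof (intro borel_measurable_times_ennreal[OF root_weight_measurable(1)[OF coord D]] borel_measurable_prod_ennreal)
    fix v assume v: "v \<in> V - {r}"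
    have "(\<lambda>R. (R v, R (next_vertex v))) \<in> measurable (PiM V (\<lambda>_. \<nu>)) (\<nu> \<Otimes>\<^sub>M \<nu>)"
      using next_vertex_in[OF v] v by (intro measurable_Pair measurable_component_singleton) auto
    from measurable_compose[OF this kernel_measurable[of n, folded \<nu>_def]]
    show "(\<lambda>R. kernel n (R v) (R (next_vertex v))) \<in> borel_measurable (PiM V (\<lambda>_. \<nu>))" by simp
  qed
  have "emeasure (PiM V (\<lambda>_. \<nu>)) ?G = (\<integral>\<^sup>+R. indicator ?G R \<partial>PiM V (\<lambda>_. \<nu>))"
    using Gm by simp
  also have "\<dots> \<le> (\<integral>\<^sup>+R. ennreal ?c * ?F R \<partial>PiM V (\<lambda>_. \<nu>))"
  proof (rule nn_integral_mono_AE)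
    have "AE R in PiM V (\<lambda>_. \<nu>). \<forall>v\<in>V. 0 < snd (R v)"
      unfolding \<nu>_def by (rule AE_mark_pos) simp
    then show "AE R in PiM V (\<lambda>_. \<nu>). indicator ?G R \<le> ennreal ?c * ?F R"
    proof eventually_elim
      case (elim R)
      show ?case
      proof (cases "R \<in> ?G")
        case True
        then show ?thesis using point[OF True elim] by (simp only: indicator_simps)
      next
        case False
        have "indicator ?G R = (0 :: ennreal)" by (rule indicator_simps(2)[OF False])
        then show ?thesis by (simp only: zero_le)
      qed
    qed
  qed
  also have "\<dots> = ennreal ?c * (\<integral>\<^sup>+R. ?F R \<partial>PiM V (\<lambda>_. \<nu>))"
    by (rule nn_integral_cmult) (rule F_meas)
  also have "(\<integral>\<^sup>+R. ?F R \<partial>PiM V (\<lambda>_. \<nu>)) \<le> (\<integral>\<^sup>+q. ?g q \<partial>\<nu>) * ennreal (6 / \<delta>) ^ ?k"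
  proof -
    have sf: "sigma_finite_measure \<nu>"
      unfolding \<nu>_def using finite_measure_unit_intensity[of n] by (rule finite_measure.axioms(1))
    have "(\<integral>\<^sup>+R. ?F R \<partial>PiM (insert r (V - {r})) (\<lambda>_. \<nu>)) \<le> (\<integral>\<^sup>+q. ?g q \<partial>\<nu>) * ennreal (6 / \<delta>) ^ ?k"
    proof (rule nn_integral_spanning_tree_le[where rank = rank, OF sf])
      show "case_prod (kernel n) \<in> borel_measurable (\<nu> \<Otimes>\<^sub>M \<nu>)"
        unfolding \<nu>_def by (rule kernel_measurable)
      show "(\<integral>\<^sup>+q. kernel n q p \<partial>\<nu>) \<le> ennreal (6 / \<delta>)" for p
        unfolding \<nu>_def by (rule nn_integral_kernel_le)
      show "next_vertex v \<in> insert r (V - {r})" if "v \<in> V - {r}" for v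
        using next_vertex_in[OF that] by auto
    qed (use gm rank_next_vertex in auto)
    then show ?thesis unfolding rV(2) .
  qed
  also have "ennreal ?c * ((\<integral>\<^sup>+q. ?g q \<partial>\<nu>) * ennreal (6 / \<delta>) ^ ?k) \<le>
      ennreal ?c * ((ennreal (1 / \<delta>) * emeasure lborel D) * ennreal (6 / \<delta>) ^ ?k)"
    unfolding \<nu>_def by (intro mult_left_mono mult_right_mono nn_integral_root_le D) auto
  also have "\<dots> = ennreal (?c * (1 / \<delta>) * (6 / \<delta>) ^ ?k) * emeasure lborel D"
  proof -
    have "ennreal (?c * (1 / \<delta>) * (6 / \<delta>) ^ ?k) = ennreal ?c * ennreal (1 / \<delta>) * ennreal (6 / \<delta>) ^ ?k"
      using \<beta> \<delta>_pos by (subst ennreal_mult, simp, simp, subst ennreal_mult, simp, simp) (simp add: ennreal_power)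
    then show ?thesis by (simp only: ac_simps)
  qed
  also have "?c * (1 / \<delta>) * (6 / \<delta>) ^ ?k = pattern_const \<tau> * \<kappa> powr \<delta>"
    by (simp add: pattern_const_def power_divide power_mult_distrib mult_ac)
  finally show ?thesis by (simp add: mult_left_mono)
qed

end

section \<open>Uniqueness and independence of Poisson processes\<close>

definition configs :: "'a measure \<Rightarrow> 'a set set" where
  "configs \<nu> = {X. finite X \<and> X \<subseteq> space \<nu>}"

text \<open>The constraints form a set of pairs, so that intersecting cylinders amounts to uniting
  these sets; contradictory constraints merely give the empty cylinder.\<close>

definition cylinder :: "'a measure \<Rightarrow> ('a set \<times> nat) set \<Rightarrow> 'a set set" where
  "cylinder \<nu> H = {X \<in> configs \<nu>. \<forall>(A, k)\<in>H. card (X \<inter> A) = k}"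

definition cylinders :: "'a measure \<Rightarrow> 'a set set set" where
  "cylinders \<nu> = cylinder \<nu> ` {H. finite H \<and> fst ` H \<subseteq> sets \<nu>}"

text \<open>The usual sigma-algebra on configurations, generated by the counts of measurable
  sets.\<close>

definition conf :: "'a measure \<Rightarrow> 'a set measure" where
  "conf \<nu> = sigma (configs \<nu>) (cylinders \<nu>)"

text \<open>For \<open>S\<close> a subset of \<open>\<A>\<close>, these are the atoms of the algebra
  generated by \<open>\<A>\<close>.\<close>

definition atom :: "'a measure \<Rightarrow> 'a set set \<Rightarrow> 'a set set \<Rightarrow> 'a set" where
  "atom \<nu> \<A> S = {x \<in> space \<nu>. \<forall>A\<in>\<A>. x \<in> A \<longleftrightarrow> A \<in> S}"

lemma cylinders_sub: "cylinders \<nu> \<subseteq> Pow (configs \<nu>)"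
  by (auto simp: cylinders_def cylinder_def)

lemma space_conf[simp]: "space (conf \<nu>) = configs \<nu>"
  unfolding conf_def by (rule space_measure_of) (rule cylinders_sub)

lemma sets_conf: "sets (conf \<nu>) = sigma_sets (configs \<nu>) (cylinders \<nu>)"
  unfolding conf_def by (rule sets_measure_of) (rule cylinders_sub)

lemma Int_stable_cylinders: "Int_stable (cylinders \<nu>)"
proof (rule Int_stableI)
  fix a b assume "a \<in> cylinders \<nu>" "b \<in> cylinders \<nu>"
  then obtain H H' where H: "finite H" "fst ` H \<subseteq> sets \<nu>" "a = cylinder \<nu> H"
    and H': "finite H'" "fst ` H' \<subseteq> sets \<nu>" "b = cylinder \<nu> H'" by (auto simp: cylinders_def)
  then have "a \<inter> b = cylinder \<nu> (H \<union> H')" by (auto simp only: cylinder_def ball_Un mem_Collect_eq Int_iff)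
  then show "a \<inter> b \<in> cylinders \<nu>"
    using H H' unfolding cylinders_def by (intro image_eqI[of _ _ "H \<union> H'"]) auto
qed

lemma configs_in_cylinders: "configs \<nu> \<in> cylinders \<nu>"
  unfolding cylinders_def by (intro image_eqI[of _ _ "{}"]) (auto simp: cylinder_def)

lemma measurable_conf_count:
  assumes A: "A \<in> sets \<nu>"
  shows "(\<lambda>X. card (X \<inter> A)) \<in> measurable (conf \<nu>) (count_space UNIV)"
  unfolding measurable_count_space_eq2_countable
proof (intro conjI ballI)
  fix k :: nat
  have "(\<lambda>X. card (X \<inter> A)) -` {k} \<inter> space (conf \<nu>) = cylinder \<nu> {(A, k)}"
    by (auto simp: cylinder_def)
  also have "\<dots> \<in> sets (conf \<nu>)"
    unfolding sets_conf cylinders_def using A by (intro sigma_sets.Basic imageI) auto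
  finally show "(\<lambda>X. card (X \<inter> A)) -` {k} \<inter> space (conf \<nu>) \<in> sets (conf \<nu>)" .
qed auto

lemma atom_measurable:
  assumes "finite \<A>" "\<A> \<subseteq> sets \<nu>" shows "atom \<nu> \<A> S \<in> sets \<nu>"
  unfolding atom_def
proof (rule sets.sets_Collect_finite_All[OF _ assms(1)])
  fix A assume "A \<in> \<A>"
  then have A: "A \<in> sets \<nu>" using assms by auto
  show "{x \<in> space \<nu>. x \<in> A \<longleftrightarrow> A \<in> S} \<in> sets \<nu>"
  proof (cases "A \<in> S")
    case True
    then have "{x \<in> space \<nu>. x \<in> A \<longleftrightarrow> A \<in> S} = A" using sets.sets_into_space[OF A] by auto
    then show ?thesis using A by simp
  next
    case False
    then have "{x \<in> space \<nu>. x \<in> A \<longleftrightarrow> A \<in> S} = space \<nu> - A" by auto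
    then show ?thesis using A by auto
  qed
qed

lemma atom_disjoint: "S \<subseteq> \<A> \<Longrightarrow> S' \<subseteq> \<A> \<Longrightarrow> S \<noteq> S' \<Longrightarrow> atom \<nu> \<A> S \<inter> atom \<nu> \<A> S' = {}"
  by (auto simp: atom_def)

lemma card_eq_sum_atoms:
  assumes X: "finite X" "X \<subseteq> space \<nu>" and \<A>: "finite \<A>" "A \<in> \<A>"
  shows "card (X \<inter> A) = (\<Sum>S\<in>{S \<in> Pow \<A>. A \<in> S}. card (X \<inter> atom \<nu> \<A> S))"
proof -
  have "X \<inter> A = (\<Union>S\<in>{S \<in> Pow \<A>. A \<in> S}. X \<inter> atom \<nu> \<A> S)"
  proof (intro equalityI subsetI)
    fix x assume x: "x \<in> X \<inter> A"
    then have "x \<in> atom \<nu> \<A> {B \<in> \<A>. x \<in> B}" using X by (auto simp: atom_def)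
    then show "x \<in> (\<Union>S\<in>{S \<in> Pow \<A>. A \<in> S}. X \<inter> atom \<nu> \<A> S)"
      using x \<A> by (intro UN_I[of "{B \<in> \<A>. x \<in> B}"]) auto
  qed (use \<A> in \<open>auto simp: atom_def\<close>)
  also have "card \<dots> = (\<Sum>S\<in>{S \<in> Pow \<A>. A \<in> S}. card (X \<inter> atom \<nu> \<A> S))"
  proof (rule card_UN_disjoint)
    show "\<forall>S\<in>{S \<in> Pow \<A>. A \<in> S}. \<forall>S'\<in>{S \<in> Pow \<A>. A \<in> S}. S \<noteq> S' \<longrightarrow>
        (X \<inter> atom \<nu> \<A> S) \<inter> (X \<inter> atom \<nu> \<A> S') = {}"
      using atom_disjoint[of _ \<A>] by blast
  qed (use X \<A> in auto)
  finally show ?thesis .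
qed

context poisson_point_process
begin

lemma N_configs: "\<omega> \<in> space M \<Longrightarrow> N \<omega> \<in> configs \<nu>"
  using points_finite points_in_space by (auto simp: configs_def)

lemma cylinder_event:
  assumes "finite H" "fst ` H \<subseteq> sets \<nu>"
  shows "N -` cylinder \<nu> H \<inter> space M = {\<omega> \<in> space M. \<forall>(A, k)\<in>H. count A \<omega> = k}"
    "{\<omega> \<in> space M. \<forall>(A, k)\<in>H. count A \<omega> = k} \<in> sets M"
proof -
  show "N -` cylinder \<nu> H \<inter> space M = {\<omega> \<in> space M. \<forall>(A, k)\<in>H. count A \<omega> = k}"
    using N_configs by (auto simp: cylinder_def)
  have "{\<omega> \<in> space M. \<forall>p\<in>H. count (fst p) \<omega> = snd p} \<in> sets M"
  proof (rule sets.sets_Collect_finite_All[OF _ assms(1)])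
    fix p assume "p \<in> H"
    then have "fst p \<in> sets \<nu>" using assms by auto
    from measurable_sets[OF count_measurable[OF this], of "{snd p}"]
    show "{\<omega> \<in> space M. count (fst p) \<omega> = snd p} \<in> sets M"
      by (simp add: vimage_def Int_def conj_commute)
  qed
  then show "{\<omega> \<in> space M. \<forall>(A, k)\<in>H. count A \<omega> = k} \<in> sets M"
    by (simp add: split_beta)
qed

lemma N_measurable: "N \<in> measurable M (conf \<nu>)"
  unfolding conf_def
proof (rule measurable_measure_of[OF cylinders_sub])
  fix y assume "y \<in> cylinders \<nu>"
  then obtain H where H: "finite H" "fst ` H \<subseteq> sets \<nu>" "y = cylinder \<nu> H"
    by (auto simp: cylinders_def)
  then show "N -` y \<inter> space M \<in> sets M"
    using cylinder_event[OF H(1,2)] by simp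
qed (use N_configs in auto)

text \<open>
  The counts of arbitrary sets are sums of the independent counts of the atoms that they generate.
  The atoms are numbered by \<open>to_nat_on\<close> since \<open>count_indep\<close> is stated for natural indices.
\<close>

theorem counts_indep:
  fixes \<A> :: "'i \<Rightarrow> 'a set set"
  assumes J: "finite J" and fin: "\<And>b. b \<in> J \<Longrightarrow> finite (\<A> b)"
    and sets: "\<And>b. b \<in> J \<Longrightarrow> \<A> b \<subseteq> sets \<nu>"
    and disj: "\<And>b c. b \<in> J \<Longrightarrow> c \<in> J \<Longrightarrow> b \<noteq> c \<Longrightarrow> \<Union> (\<A> b) \<inter> \<Union> (\<A> c) = {}"
  defines "I \<equiv> Sigma J (\<lambda>b. Pow (\<A> b) - {{}})"
  defines "X \<equiv> \<lambda>k \<omega>. real (count ((\<lambda>(b, S). atom \<nu> (\<A> b) S) (from_nat_into I k)) \<omega>)"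
  shows "indep_vars (\<lambda>_. borel) X (to_nat_on I ` I)"
    "\<And>b A \<omega>. b \<in> J \<Longrightarrow> A \<in> \<A> b \<Longrightarrow> \<omega> \<in> space M \<Longrightarrow>
      real (count A \<omega>) = (\<Sum>S\<in>{S \<in> Pow (\<A> b). A \<in> S}. X (to_nat_on I (b, S)) \<omega>)"
proof -
  have finI: "finite I" unfolding I_def using J fin by auto
  let ?A = "\<lambda>k. (\<lambda>(b, S). atom \<nu> (\<A> b) S) (from_nat_into I k)"
  have inv: "from_nat_into I (to_nat_on I p) = p" if "p \<in> I" for p
    using that finI by (simp add: countable_finite)
  have "indep_vars (\<lambda>_. count_space UNIV) (\<lambda>k \<omega>. count (?A k) \<omega>) (to_nat_on I ` I)"
  proof (rule count_indep)
    show "finite (to_nat_on I ` I)" using finI by simp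
    show "?A k \<in> sets \<nu>" if "k \<in> to_nat_on I ` I" for k
    proof -
      from that obtain b S where bS: "(b, S) \<in> I" "k = to_nat_on I (b, S)" by auto
      then have "?A k = atom \<nu> (\<A> b) S" using inv by simp
      moreover have "b \<in> J" using bS by (simp add: I_def)
      ultimately show ?thesis using atom_measurable[OF fin sets] by simp
    qed
    have atoms: "atom \<nu> (\<A> b) S \<inter> atom \<nu> (\<A> c) S' = {}"
      if "(b, S) \<in> I" "(c, S') \<in> I" "(b, S) \<noteq> (c, S')" for b c S S'
    proof (cases "b = c")
      case True
      then show ?thesis using that atom_disjoint[of S "\<A> b" S'] by (auto simp: I_def)
    next
      case False
      \<comment> \<open>This is why \<open>I\<close> omits the empty \<open>S\<close>: its atom is
        the complement of all the sets in the family, and such complements overlap for different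
        \<open>b\<close>.\<close>
      have "atom \<nu> (\<A> b) S \<subseteq> \<Union> (\<A> b)" "atom \<nu> (\<A> c) S' \<subseteq> \<Union> (\<A> c)"
        using that by (auto simp: I_def atom_def)
      then show ?thesis using disj[OF _ _ False] that by (auto simp: I_def)
    qed
    show "disjoint_family_on ?A (to_nat_on I ` I)"
      unfolding disjoint_family_on_def
    proof (intro ballI impI)
      fix k l assume kl: "k \<in> to_nat_on I ` I" "l \<in> to_nat_on I ` I" "k \<noteq> l"
      then obtain b S c S' where p: "(b, S) \<in> I" "k = to_nat_on I (b, S)" "(c, S') \<in> I" "l = to_nat_on I (c, S')"
        by auto
      then have "?A k = atom \<nu> (\<A> b) S" "?A l = atom \<nu> (\<A> c) S'" using inv by simp_all
      moreover have "(b, S) \<noteq> (c, S')" using p kl(3) by auto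
      ultimately show "?A k \<inter> ?A l = {}"
        using atoms[OF p(1,3)] by simp
    qed
  qed
  then show "indep_vars (\<lambda>_. borel) X (to_nat_on I ` I)"
    unfolding X_def by (rule indep_vars_compose2) simp
  show "real (count A \<omega>) = (\<Sum>S\<in>{S \<in> Pow (\<A> b). A \<in> S}. X (to_nat_on I (b, S)) \<omega>)"
    if "b \<in> J" "A \<in> \<A> b" "\<omega> \<in> space M" for b A \<omega>
  proof -
    have "X (to_nat_on I (b, S)) \<omega> = real (count (atom \<nu> (\<A> b) S) \<omega>)"
      if "S \<in> {S \<in> Pow (\<A> b). A \<in> S}" for S
    proof -
      have "(b, S) \<in> I" using that \<open>b \<in> J\<close> by (auto simp: I_def)
      then show ?thesis using inv by (simp add: X_def)
    qed
    then show ?thesis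
      using card_eq_sum_atoms[OF points_finite points_in_space fin, of \<omega> b A] that by simp
  qed
qed

end

lemma cylinder_sets_borel:
  assumes "finite H" "finite K" "\<And>A k S. (A, k) \<in> H \<Longrightarrow> S \<in> F A \<Longrightarrow> f S \<in> K"
  shows "{v \<in> space (PiM K (\<lambda>_. borel :: real measure)). \<forall>(A, k)\<in>H. real k = (\<Sum>S\<in>F A. v (f S))}
    \<in> sets (PiM K (\<lambda>_. borel))"
proof -
  have "{v \<in> space (PiM K (\<lambda>_. borel :: real measure)). \<forall>p\<in>H. real (snd p) = (\<Sum>S\<in>F (fst p). v (f S))}
    \<in> sets (PiM K (\<lambda>_. borel))"
  proof (rule sets.sets_Collect_finite_All[OF _ assms(1)])
    fix p assume p: "p \<in> H"
    have "(\<lambda>v. \<Sum>S\<in>F (fst p). v (f S)) \<in> borel_measurable (PiM K (\<lambda>_. borel :: real measure))"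
      using assms(3)[of "fst p" "snd p"] p by (intro borel_measurable_sum measurable_component_singleton) auto
    then show "{v \<in> space (PiM K (\<lambda>_. borel :: real measure)). real (snd p) = (\<Sum>S\<in>F (fst p). v (f S))}
        \<in> sets (PiM K (\<lambda>_. borel))"
      by (intro borel_measurable_eq borel_measurable_const)
  qed
  then show ?thesis by (simp add: split_beta)
qed

lemma ball_real_eq_iff:
  assumes "\<And>A k. (A, k) \<in> H \<Longrightarrow> F A = real (c A)"
  shows "(\<forall>(A, k)\<in>H. real k = F A) \<longleftrightarrow> (\<forall>(A, k)\<in>H. c A = k)"
proof (rule ball_cong[OF refl])
  fix p assume "p \<in> H"
  then show "(case p of (A, k) \<Rightarrow> real k = F A) \<longleftrightarrow> (case p of (A, k) \<Rightarrow> c A = k)"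
    using assms by (cases p) auto
qed

lemma Collect_eq_vimage: "(\<And>x. x \<in> S \<Longrightarrow> P x \<longleftrightarrow> f x \<in> B) \<Longrightarrow> {x \<in> S. P x} = f -` B \<inter> S"
  by auto

text \<open>A cylinder event is a Borel condition on the counts of finitely many atoms. These are
  independent with laws prescribed by the intensity, so their joint law is the same product measure
  for both processes, and cylinders form an intersection-stable generator.\<close>

theorem poisson_point_process_unique:
  assumes N: "poisson_point_process M \<nu> N" and N': "poisson_point_process M' \<nu> N'"
  shows "distr M (conf \<nu>) N = distr M' (conf \<nu>) N'"
proof -
  interpret A: poisson_point_process M \<nu> N by fact
  interpret B: poisson_point_process M' \<nu> N' by fact
  have count_distr: "distr M borel (\<lambda>\<omega>. real (card (N \<omega> \<inter> C))) = distr M' borel (\<lambda>\<omega>. real (card (N' \<omega> \<inter> C)))"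
    if C: "C \<in> sets \<nu>" for C
  proof -
    have "distr M (count_space UNIV) (\<lambda>\<omega>. card (N \<omega> \<inter> C)) = distr M' (count_space UNIV) (\<lambda>\<omega>. card (N' \<omega> \<inter> C))"
    proof (rule measure_eqI_countable[of _ UNIV])
      fix k
      have "(\<lambda>\<omega>. card (N \<omega> \<inter> C)) -` {k} \<inter> space M = {\<omega> \<in> space M. card (N \<omega> \<inter> C) = k}"
        "(\<lambda>\<omega>. card (N' \<omega> \<inter> C)) -` {k} \<inter> space M' = {\<omega> \<in> space M'. card (N' \<omega> \<inter> C) = k}" by auto
      then show "emeasure (distr M (count_space UNIV) (\<lambda>\<omega>. card (N \<omega> \<inter> C))) {k} =
          emeasure (distr M' (count_space UNIV) (\<lambda>\<omega>. card (N' \<omega> \<inter> C))) {k}"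
        using A.count_measurable[OF C] B.count_measurable[OF C] A.count_poisson[OF C] B.count_poisson[OF C]
        by (simp add: emeasure_distr A.emeasure_eq_measure B.emeasure_eq_measure)
    qed auto
    from arg_cong[OF this, of "\<lambda>Q. distr Q borel real"] show ?thesis
      using A.count_measurable[OF C] B.count_measurable[OF C] by (simp add: distr_distr comp_def)
  qed
  show ?thesis
  proof (rule measure_eqI_generator_eq[OF Int_stable_cylinders cylinders_sub])
    fix Y assume "Y \<in> cylinders \<nu>"
    then obtain H where H: "finite H" "fst ` H \<subseteq> sets \<nu>" and Y: "Y = cylinder \<nu> H"
      by (auto simp: cylinders_def)
    define \<A> where "\<A> = fst ` H"
    define I where "I = Sigma {()} (\<lambda>_. Pow \<A> - {{}})"
    define K where "K = to_nat_on I ` I"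
    define C where "C k = (\<lambda>(b :: unit, S). atom \<nu> \<A> S) (from_nat_into I k)" for k
    define X where "X k \<omega> = real (card (N \<omega> \<inter> C k))" for k \<omega>
    define X' where "X' k \<omega> = real (card (N' \<omega> \<inter> C k))" for k \<omega>
    define B where "B = {v \<in> space (PiM K (\<lambda>_. borel :: real measure)).
      \<forall>(A, k)\<in>H. real k = (\<Sum>S\<in>{S \<in> Pow \<A>. A \<in> S}. v (to_nat_on I ((), S)))}"
    have \<A>: "finite \<A>" "\<A> \<subseteq> sets \<nu>" using H by (auto simp: \<A>_def)
    note a = A.counts_indep[of "{()}" "\<lambda>_. \<A>", folded I_def, OF _ \<A>(1) \<A>(2), folded C_def, folded X_def K_def, simplified]
    note b = B.counts_indep[of "{()}" "\<lambda>_. \<A>", folded I_def, OF _ \<A>(1) \<A>(2), folded C_def, folded X'_def K_def, simplified]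
    have Cm: "C k \<in> sets \<nu>" for k
      using atom_measurable[OF \<A>] by (simp add: C_def split_beta)
    have IK: "to_nat_on I ((), S) \<in> K" if "S \<in> {S \<in> Pow \<A>. A \<in> S}" for A S
      unfolding K_def using that by (intro imageI) (auto simp: I_def)
    have finK: "finite K" unfolding K_def I_def using \<A> by auto
    have B: "B \<in> sets (PiM K (\<lambda>_. borel))"
      unfolding B_def by (rule cylinder_sets_borel[OF H(1) finK]) (use IK in auto)
    have Xm: "X k \<in> borel_measurable M" "X' k \<in> borel_measurable M'" for k
      unfolding X_def X'_def
      using measurable_compose[OF A.count_measurable[OF Cm[of k]], of real borel]
        measurable_compose[OF B.count_measurable[OF Cm[of k]], of real borel] by auto
    have XK: "(\<lambda>\<omega>. \<lambda>k\<in>K. X k \<omega>) \<in> measurable M (PiM K (\<lambda>_. borel))"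
      "(\<lambda>\<omega>. \<lambda>k\<in>K. X' k \<omega>) \<in> measurable M' (PiM K (\<lambda>_. borel))"
      using Xm by (auto intro!: measurable_restrict)
    have eqD: "distr M (PiM K (\<lambda>_. borel)) (\<lambda>\<omega>. \<lambda>k\<in>K. X k \<omega>) = distr M' (PiM K (\<lambda>_. borel)) (\<lambda>\<omega>. \<lambda>k\<in>K. X' k \<omega>)"
    proof (cases "K = {}")
      \<comment> \<open>The description of independence by product measures requires a nonempty
        index set; here the product space is a single point.\<close>
      case True
      have "prob_space (distr M (PiM K (\<lambda>_. borel)) (\<lambda>\<omega>. \<lambda>k\<in>K. X k \<omega>))"
        "prob_space (distr M' (PiM K (\<lambda>_. borel)) (\<lambda>\<omega>. \<lambda>k\<in>K. X' k \<omega>))"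
        using XK by (auto intro!: A.prob_space_distr B.prob_space_distr)
      note p = this[THEN prob_space.emeasure_space_1]
      show ?thesis
      proof (rule measure_eqI)
        fix Z assume "Z \<in> sets (distr M (PiM K (\<lambda>_. borel)) (\<lambda>\<omega>. \<lambda>k\<in>K. X k \<omega>))"
        then have "Z = {} \<or> Z = {\<lambda>_. undefined}" using True by (auto simp: sets_PiM_empty)
        then show "emeasure (distr M (PiM K (\<lambda>_. borel)) (\<lambda>\<omega>. \<lambda>k\<in>K. X k \<omega>)) Z =
          emeasure (distr M' (PiM K (\<lambda>_. borel)) (\<lambda>\<omega>. \<lambda>k\<in>K. X' k \<omega>)) Z"
          using p True by (auto simp: space_PiM)
      qed simp
    next
      case False
      have "distr M (PiM K (\<lambda>_. borel)) (\<lambda>\<omega>. \<lambda>k\<in>K. X k \<omega>) = PiM K (\<lambda>k. distr M borel (X k))"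
        using A.indep_vars_iff_distr_eq_PiM'[OF False, where M' = "\<lambda>_. borel" and X = X] a(1) Xm by blast
      also have "\<dots> = PiM K (\<lambda>k. distr M' borel (X' k))"
        using count_distr[OF Cm] unfolding X_def[abs_def] X'_def[abs_def] by (intro PiM_cong refl)
      moreover have "distr M' (PiM K (\<lambda>_. borel)) (\<lambda>\<omega>. \<lambda>k\<in>K. X' k \<omega>) = PiM K (\<lambda>k. distr M' borel (X' k))"
        using B.indep_vars_iff_distr_eq_PiM'[OF False, where M' = "\<lambda>_. borel" and X = X'] b(1) Xm by blast
      ultimately show ?thesis by simp
    qed
    have vec: "(\<forall>(A, k)\<in>H. card (Z \<inter> A) = k) \<longleftrightarrow> (\<lambda>k\<in>K. x k) \<in> B"
      if "\<And>A. A \<in> \<A> \<Longrightarrow> real (card (Z \<inter> A)) = (\<Sum>S\<in>{S \<in> Pow \<A>. A \<in> S}. x (to_nat_on I ((), S)))" for Z x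
    proof -
      have "(\<forall>(A, k)\<in>H. real k = (\<Sum>S\<in>{S \<in> Pow \<A>. A \<in> S}. (\<lambda>k\<in>K. x k) (to_nat_on I ((), S))))
          \<longleftrightarrow> (\<forall>(A, k)\<in>H. card (Z \<inter> A) = k)"
      proof (rule ball_real_eq_iff)
        fix A k assume "(A, k) \<in> H"
        then have "A \<in> \<A>" by (force simp: \<A>_def)
        have "(\<Sum>S\<in>{S \<in> Pow \<A>. A \<in> S}. (\<lambda>k\<in>K. x k) (to_nat_on I ((), S))) =
            (\<Sum>S\<in>{S \<in> Pow \<A>. A \<in> S}. x (to_nat_on I ((), S)))"
          by (rule sum.cong[OF refl]) (simp only: IK restrict_apply' if_True)
        then show "(\<Sum>S\<in>{S \<in> Pow \<A>. A \<in> S}. (\<lambda>k\<in>K. x k) (to_nat_on I ((), S))) = real (card (Z \<inter> A))"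
          using that[OF \<open>A \<in> \<A>\<close>] by simp
      qed
      then show ?thesis unfolding B_def by (auto simp: space_PiM)
    qed
    have "(\<forall>(A, k)\<in>H. card (N \<omega> \<inter> A) = k) \<longleftrightarrow> (\<lambda>k\<in>K. X k \<omega>) \<in> B" if "\<omega> \<in> space M" for \<omega>
      by (rule vec) (use a(2) that in simp)
    then have "N -` Y \<inter> space M = (\<lambda>\<omega>. \<lambda>k\<in>K. X k \<omega>) -` B \<inter> space M"
      unfolding Y A.cylinder_event(1)[OF H] by (rule Collect_eq_vimage)
    moreover have "(\<forall>(A, k)\<in>H. card (N' \<omega> \<inter> A) = k) \<longleftrightarrow> (\<lambda>k\<in>K. X' k \<omega>) \<in> B" if "\<omega> \<in> space M'" for \<omega>
      by (rule vec) (use b(2) that in simp)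
    then have "N' -` Y \<inter> space M' = (\<lambda>\<omega>. \<lambda>k\<in>K. X' k \<omega>) -` B \<inter> space M'"
      unfolding Y B.cylinder_event(1)[OF H] by (rule Collect_eq_vimage)
    moreover have Ys: "Y \<in> sets (conf \<nu>)" using \<open>Y \<in> cylinders \<nu>\<close> by (auto simp: sets_conf)
    ultimately show "emeasure (distr M (conf \<nu>) N) Y = emeasure (distr M' (conf \<nu>) N') Y"
      using arg_cong[OF eqD, of "\<lambda>Q. emeasure Q B"] B XK A.N_measurable B.N_measurable
      by (simp add: emeasure_distr)
  next
    show "range (\<lambda>_ :: nat. configs \<nu>) \<subseteq> cylinders \<nu>" using configs_in_cylinders by auto
    show "emeasure (distr M (conf \<nu>) N) (configs \<nu>) \<noteq> \<infinity>"
      using A.prob_space_distr[OF A.N_measurable]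
      by (simp add: prob_space.finite_measure finite_measure.emeasure_finite)
  qed (auto simp: sets_conf)
qed

text \<open>\<open>\<Phi> b A\<close> stands for the part of the region \<open>D b\<close> whose
  points are seen by \<open>Y b\<close> in \<open>A\<close>. Cylinder events of different blocks
  depend on disjoint groups of independent atom counts, and independence extends from cylinders to
  the generated sigma-algebras.\<close>

theorem (in poisson_point_process) indep_blocks:
  fixes Y :: "nat \<Rightarrow> 'w \<Rightarrow> 'b set" and \<Phi> :: "nat \<Rightarrow> 'b set \<Rightarrow> 'a set"
  assumes Y: "\<And>b. b \<in> J \<Longrightarrow> Y b \<in> measurable M (conf \<nu>')"
    and \<Phi>: "\<And>b A. b \<in> J \<Longrightarrow> A \<in> sets \<nu>' \<Longrightarrow> \<Phi> b A \<in> sets \<nu> \<and> \<Phi> b A \<subseteq> D b"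
    and D: "disjoint_family_on D J"
    and card: "\<And>b A \<omega>. b \<in> J \<Longrightarrow> A \<in> sets \<nu>' \<Longrightarrow> \<omega> \<in> space M \<Longrightarrow> card (Y b \<omega> \<inter> A) = count (\<Phi> b A) \<omega>"
  shows "indep_vars (\<lambda>_. conf \<nu>') Y J"
proof -
  have Yc: "Y b \<in> space M \<rightarrow> configs \<nu>'" if "b \<in> J" for b
    using measurable_space[OF Y[OF that]] by auto
  let ?G = "\<lambda>b. {Y b -` A \<inter> space M | A. A \<in> cylinders \<nu>'}"
  have "indep_sets ?G J"
  proof (rule indep_setsI)
    show "?G b \<subseteq> events" if "b \<in> J" for b
      using measurable_sets[OF Y[OF that]] by (auto simp: sets_conf)
    fix E L assume L: "L \<noteq> {}" "L \<subseteq> J" "finite L" and E: "\<forall>b\<in>L. E b \<in> ?G b"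
    have "\<forall>b\<in>L. \<exists>H. finite H \<and> fst ` H \<subseteq> sets \<nu>' \<and> E b = Y b -` cylinder \<nu>' H \<inter> space M"
    proof
      fix b assume "b \<in> L"
      then have "E b \<in> ?G b" using E by blast
      then show "\<exists>H. finite H \<and> fst ` H \<subseteq> sets \<nu>' \<and> E b = Y b -` cylinder \<nu>' H \<inter> space M"
        unfolding cylinders_def by blast
    qed
    then obtain H where H: "\<And>b. b \<in> L \<Longrightarrow> finite (H b)" "\<And>b. b \<in> L \<Longrightarrow> fst ` H b \<subseteq> sets \<nu>'"
      "\<And>b. b \<in> L \<Longrightarrow> E b = Y b -` cylinder \<nu>' (H b) \<inter> space M" by metis
    define \<A> where "\<A> b = \<Phi> b ` fst ` H b" for b
    define I where "I = Sigma L (\<lambda>b. Pow (\<A> b) - {{}})"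
    define X where "X k \<omega> = real (count ((\<lambda>(b, S). atom \<nu> (\<A> b) S) (from_nat_into I k)) \<omega>)" for k \<omega>
    \<comment> \<open>The numbers of the atoms that belong to block \<open>b\<close>; they are
      disjoint for different blocks because the numbering is injective.\<close>
    define K where "K b = to_nat_on I ` ({b} \<times> (Pow (\<A> b) - {{}}))" for b
    have A1: "finite (\<A> b)" "\<A> b \<subseteq> sets \<nu>" "\<Union> (\<A> b) \<subseteq> D b" if "b \<in> L" for b
      using H(1,2)[OF that] \<Phi>[of b] that L(2) by (auto simp: \<A>_def)
    have disj: "\<Union> (\<A> b) \<inter> \<Union> (\<A> c) = {}" if "b \<in> L" "c \<in> L" "b \<noteq> c" for b c
    proof -
      have "D b \<inter> D c = {}" using D that L(2) by (auto simp: disjoint_family_on_def)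
      then show ?thesis using A1(3)[OF that(1)] A1(3)[OF that(2)] by blast
    qed
    have X1: "indep_vars (\<lambda>_. borel) X (to_nat_on I ` I)"
      unfolding X_def I_def using L(3) A1(1,2) disj by (rule counts_indep(1))
    have X2: "real (count A \<omega>) = (\<Sum>S\<in>{S \<in> Pow (\<A> b). A \<in> S}. X (to_nat_on I (b, S)) \<omega>)"
      if "b \<in> L" "A \<in> \<A> b" "\<omega> \<in> space M" for b A \<omega>
      unfolding X_def I_def using L(3) A1(1,2) disj that by (rule counts_indep(2))
    have finI: "finite I" unfolding I_def using L A1 by auto
    have inj: "inj_on (to_nat_on I) I" using finI by (simp add: countable_finite inj_on_to_nat_on)
    have KI: "{b} \<times> (Pow (\<A> b) - {{}}) \<subseteq> I" if "b \<in> L" for b using that by (auto simp: I_def)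
    have Kd: "disjoint_family_on K L"
      unfolding disjoint_family_on_def K_def
    proof (intro ballI impI)
      fix b c assume bc: "b \<in> L" "c \<in> L" "b \<noteq> c"
      have "to_nat_on I ` (({b} \<times> (Pow (\<A> b) - {{}})) \<inter> ({c} \<times> (Pow (\<A> c) - {{}}))) =
          to_nat_on I ` ({b} \<times> (Pow (\<A> b) - {{}})) \<inter> to_nat_on I ` ({c} \<times> (Pow (\<A> c) - {{}}))"
        by (rule inj_on_image_Int[OF inj KI[OF bc(1)] KI[OF bc(2)]])
      moreover have "({b} \<times> (Pow (\<A> b) - {{}})) \<inter> ({c} \<times> (Pow (\<A> c) - {{}})) = {}" using bc by auto
      ultimately show "to_nat_on I ` ({b} \<times> (Pow (\<A> b) - {{}})) \<inter> to_nat_on I ` ({c} \<times> (Pow (\<A> c) - {{}})) = {}"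
        by simp
    qed
    have indep: "indep_vars (\<lambda>b. PiM (K b) (\<lambda>_. borel)) (\<lambda>b \<omega>. \<lambda>k\<in>K b. X k \<omega>) L"
      using X1 by (rule indep_vars_restrict[OF _ _ Kd]) (use KI in \<open>auto simp: K_def\<close>)
    define B where "B b = {v \<in> space (PiM (K b) (\<lambda>_. borel :: real measure)).
      \<forall>(A, k)\<in>H b. real k = (\<Sum>S\<in>{S \<in> Pow (\<A> b). \<Phi> b A \<in> S}. v (to_nat_on I (b, S)))}" for b
    have IK: "to_nat_on I (b, S) \<in> K b" if "S \<in> {S \<in> Pow (\<A> b). A \<in> S}" for A S b
      unfolding K_def using that by (intro imageI) auto
    have B: "B b \<in> sets (PiM (K b) (\<lambda>_. borel))" if b: "b \<in> L" for b
      unfolding B_def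
    proof (rule cylinder_sets_borel[OF H(1)[OF b]])
      show "finite (K b)" unfolding K_def using A1[OF b] by auto
    qed (use IK in auto)
    have EB: "E b = (\<lambda>\<omega>. \<lambda>k\<in>K b. X k \<omega>) -` B b \<inter> space M" if b: "b \<in> L" for b
    proof -
      have "Y b \<omega> \<in> cylinder \<nu>' (H b) \<longleftrightarrow> (\<lambda>k\<in>K b. X k \<omega>) \<in> B b" if w: "\<omega> \<in> space M" for \<omega>
      proof -
        have s: "(\<Sum>S\<in>{S \<in> Pow (\<A> b). \<Phi> b A \<in> S}. (\<lambda>k\<in>K b. X k \<omega>) (to_nat_on I (b, S))) = real (card (Y b \<omega> \<inter> A))"
          if "(A, k) \<in> H b" for A k
        proof -
          have A: "A \<in> sets \<nu>'" "\<Phi> b A \<in> \<A> b" using H(2)[OF b] that by (force simp: \<A>_def)+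
          have "(\<Sum>S\<in>{S \<in> Pow (\<A> b). \<Phi> b A \<in> S}. (\<lambda>k\<in>K b. X k \<omega>) (to_nat_on I (b, S))) =
              (\<Sum>S\<in>{S \<in> Pow (\<A> b). \<Phi> b A \<in> S}. X (to_nat_on I (b, S)) \<omega>)"
            using IK by (intro sum.cong) auto
          also have "\<dots> = real (count (\<Phi> b A) \<omega>)" using X2[OF b A(2) w] by simp
          finally show ?thesis using card[OF _ A(1) w] b L(2) by auto
        qed
        have "(\<forall>(A, k)\<in>H b. real k = (\<Sum>S\<in>{S \<in> Pow (\<A> b). \<Phi> b A \<in> S}. (\<lambda>k\<in>K b. X k \<omega>) (to_nat_on I (b, S))))
            \<longleftrightarrow> (\<forall>(A, k)\<in>H b. card (Y b \<omega> \<inter> A) = k)"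
          by (rule ball_real_eq_iff) (rule s)
        moreover have "Y b \<omega> \<in> configs \<nu>'" using Yc w b L(2) by blast
        ultimately show ?thesis unfolding B_def cylinder_def by (auto simp: space_PiM)
      qed
      then show ?thesis unfolding H(3)[OF b] by auto
    qed
    have "prob (\<Inter>b\<in>L. (\<lambda>\<omega>. \<lambda>k\<in>K b. X k \<omega>) -` B b \<inter> space M) = (\<Prod>b\<in>L. prob ((\<lambda>\<omega>. \<lambda>k\<in>K b. X k \<omega>) -` B b \<inter> space M))"
      by (rule indep_varsD_finite[OF indep L(1,3) B])
    then show "prob (\<Inter>b\<in>L. E b) = (\<Prod>b\<in>L. prob (E b))" using EB by simp
  qed
  then have "indep_sets (\<lambda>b. sigma_sets (space M) (?G b)) J"
  proof (rule indep_sets_sigma)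
    show "Int_stable (?G b)" for b
    proof (rule Int_stableI)
      fix a c assume "a \<in> ?G b" "c \<in> ?G b"
      then obtain A C where "A \<in> cylinders \<nu>'" "C \<in> cylinders \<nu>'" "a = Y b -` A \<inter> space M" "c = Y b -` C \<inter> space M"
        by blast
      then show "a \<inter> c \<in> ?G b"
        using Int_stable_cylinders[of \<nu>'] by (intro CollectI exI[of _ "A \<inter> C"]) (auto simp: Int_stable_def)
    qed
  qed
  moreover have "sigma_sets (space M) (?G b) = sigma_sets (space M) {Y b -` A \<inter> space M | A. A \<in> sets (conf \<nu>')}"
    if "b \<in> J" for b
    unfolding sets_conf sigma_sets_vimage_commute[OF Yc[OF that]]
    by (rule sigma_sets_sigma_sets_eq[symmetric]) auto
  ultimately show ?thesis
    unfolding indep_vars_def using Y by (simp cong: indep_sets_cong)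
qed

section \<open>Characteristic functions of normalised sums\<close>

lemma (in prob_space) char_distr_scaled_sum:
  assumes indep: "indep_vars (\<lambda>_. borel) X {..<K :: nat}"
    and X: "\<And>b. b < K \<Longrightarrow> distr M borel (X b) = \<mu>"
  shows "char (distr M borel (\<lambda>\<omega>. (\<Sum>b<K. X b \<omega>) / c)) t = char \<mu> (t / c) ^ K"
proof -
  have [measurable]: "random_variable borel (X b)" if "b < K" for b
    using indep that by (auto simp: indep_vars_def)
  have "char (distr M borel (\<lambda>\<omega>. (\<Sum>b<K. X b \<omega>) / c)) t = char (distr M borel (\<lambda>\<omega>. \<Sum>b<K. X b \<omega>)) (t / c)"
    by (simp add: char_def integral_distr)
  also have "\<dots> = (\<Prod>b<K. char (distr M borel (X b)) (t / c))"
    by (rule char_distr_sum[OF indep])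
  also have "\<dots> = char \<mu> (t / c) ^ K" using X by simp
  finally show ?thesis .
qed

lemma (in prob_space) indep_centered_sum:
  fixes X :: "'b \<Rightarrow> 'a \<Rightarrow> real"
  assumes "finite K" and "indep_vars (\<lambda>_. borel) X K"
    and "\<And>b. b \<in> K \<Longrightarrow> integrable M (\<lambda>\<omega>. (X b \<omega>)\<^sup>2)" and "\<And>b. b \<in> K \<Longrightarrow> expectation (X b) = 0"
  shows "expectation (\<lambda>\<omega>. \<Sum>b\<in>K. X b \<omega>) = 0 \<and> integrable M (\<lambda>\<omega>. (\<Sum>b\<in>K. X b \<omega>)\<^sup>2) \<and>
    expectation (\<lambda>\<omega>. (\<Sum>b\<in>K. X b \<omega>)\<^sup>2) = (\<Sum>b\<in>K. expectation (\<lambda>\<omega>. (X b \<omega>)\<^sup>2))"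
  using assms
proof (induction K rule: finite_induct)
  case (insert c K)
  let ?S = "\<lambda>\<omega>. \<Sum>b\<in>K. X b \<omega>"
  have [measurable]: "random_variable borel (X b)" if "b \<in> insert c K" for b
    using insert.prems(1) that by (auto simp: indep_vars_def)
  have IH: "expectation ?S = 0" "integrable M (\<lambda>\<omega>. (?S \<omega>)\<^sup>2)"
    "expectation (\<lambda>\<omega>. (?S \<omega>)\<^sup>2) = (\<Sum>b\<in>K. expectation (\<lambda>\<omega>. (X b \<omega>)\<^sup>2))"
    using insert.IH[OF indep_vars_subset[OF insert.prems(1)]] insert.prems by auto
  have S: "integrable M ?S"
    by (rule square_integrable_imp_integrable[OF _ IH(2)]) (auto intro!: borel_measurable_sum)
  have c2: "integrable M (\<lambda>\<omega>. (X c \<omega>)\<^sup>2)" and c0: "expectation (X c) = 0" using insert.prems by auto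
  have c1: "integrable M (X c)"
    by (rule square_integrable_imp_integrable[OF _ c2]) simp
  have ind: "indep_var borel (X c) borel ?S"
    by (rule indep_vars_sum[OF insert.hyps insert.prems(1)])
  have cS: "expectation (\<lambda>\<omega>. X c \<omega> * ?S \<omega>) = 0" "integrable M (\<lambda>\<omega>. X c \<omega> * ?S \<omega>)"
    using indep_var_lebesgue_integral[OF ind c1 S] indep_var_integrable[OF ind c1 S] c0 by auto
  have sq: "(\<Sum>b\<in>insert c K. X b \<omega>)\<^sup>2 = (X c \<omega>)\<^sup>2 + (?S \<omega>)\<^sup>2 + 2 * (X c \<omega> * ?S \<omega>)" for \<omega>
    using insert.hyps by (simp add: power2_sum)
  show ?case
    unfolding sq using insert.hyps c0 c1 c2 cS S IH by simp
qed simp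

text \<open>The central limit theorem, applied on an infinite product space and restated through
  \<mu> alone. In this form it no longer refers to a fixed probability space, so it can be used for
  block sums that live on a different space for every torus.\<close>

lemma iid_char_limit:
  assumes \<mu>: "real_distribution \<mu>" and sq: "integrable \<mu> (\<lambda>x. x\<^sup>2)"
    and mean: "(\<integral>x. x \<partial>\<mu>) = 0" and var: "(\<integral>x. x\<^sup>2 \<partial>\<mu>) = \<sigma>\<^sup>2" and \<sigma>: "0 < \<sigma>"
  shows "(\<lambda>n. char \<mu> (t / sqrt (real n * \<sigma>\<^sup>2)) ^ n) \<longlonglongrightarrow> char std_normal_distribution t"
proof -
  interpret \<mu>: real_distribution \<mu> by fact
  let ?P = "PiM UNIV (\<lambda>_ :: nat. \<mu>)"
  interpret P: prob_space ?P by (rule prob_space_PiM) (rule \<mu>.prob_space_axioms)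
  have X[measurable]: "(\<lambda>\<omega>. \<omega> i) \<in> borel_measurable ?P" for i :: nat
    using measurable_component_singleton[of i UNIV "\<lambda>_. \<mu>"] by (simp cong: measurable_cong_sets)
  have distr: "distr ?P borel (\<lambda>\<omega>. \<omega> i) = \<mu>" for i :: nat
  proof -
    have "distr ?P borel (\<lambda>\<omega>. \<omega> i) = distr ?P \<mu> (\<lambda>\<omega>. \<omega> i)" by (rule distr_cong) auto
    also have "\<dots> = \<mu>" by (rule distr_PiM_component) (auto intro: \<mu>.prob_space_axioms)
    finally show ?thesis .
  qed
  have indep: "P.indep_vars (\<lambda>_. borel) (\<lambda>i \<omega>. \<omega> i) (UNIV :: nat set)"
  proof (subst P.indep_vars_iff_distr_eq_PiM)
    have "distr ?P (PiM UNIV (\<lambda>_ :: nat. borel)) (\<lambda>\<omega>. \<lambda>i\<in>UNIV. \<omega> i) = ?P"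
      by (simp add: restrict_def) (rule distr_id2, rule sets_PiM_cong, auto)
    then show "distr ?P (PiM UNIV (\<lambda>_ :: nat. borel)) (\<lambda>\<omega>. \<lambda>i\<in>UNIV. \<omega> i) = PiM UNIV (\<lambda>i. distr ?P borel (\<lambda>\<omega>. \<omega> i))"
      by (simp add: distr)
  qed (use X in auto)
  have int: "P.expectation (\<lambda>\<omega>. f (\<omega> i)) = (\<integral>x. f x \<partial>\<mu>)" "integrable ?P (\<lambda>\<omega>. f (\<omega> i)) \<longleftrightarrow> integrable \<mu> f"
    if "f \<in> borel_measurable borel" for f :: "real \<Rightarrow> real" and i :: nat
    using integral_distr[OF X[of i] that] integrable_distr_eq[OF X[of i] that] by (simp_all add: distr)
  have weak: "weak_conv_m (\<lambda>n. distr ?P borel (\<lambda>\<omega>. (\<Sum>i<n. \<omega> i) / sqrt (n * \<sigma>\<^sup>2))) std_normal_distribution"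
  proof (rule P.central_limit_theorem_zero_mean[OF indep])
    show "P.expectation (\<lambda>\<omega>. \<omega> i) = 0" for i using int(1)[of "\<lambda>x. x"] mean by simp
    then show "P.variance (\<lambda>\<omega>. \<omega> i) = \<sigma>\<^sup>2" for i using int(1)[of "\<lambda>x. x\<^sup>2"] var by simp
    show "integrable ?P (\<lambda>\<omega>. (\<omega> i)\<^sup>2)" for i using int(2)[of "\<lambda>x. x\<^sup>2"] sq by simp
  qed (use \<sigma> distr in auto)
  have "(\<lambda>n. char (distr ?P borel (\<lambda>\<omega>. (\<Sum>i<n. \<omega> i) / sqrt (n * \<sigma>\<^sup>2))) t) \<longlonglongrightarrow> char std_normal_distribution t"
    by (rule levy_continuity1[OF _ real_dist_normal_dist weak]) (auto intro!: P.real_distribution_distr)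
  then show ?thesis
    using P.char_distr_scaled_sum[OF P.indep_vars_subset[OF indep], of _ \<mu>] distr by simp
qed

lemma cmod_iexp_diff_le: "cmod (iexp x - iexp y) \<le> \<bar>x - y\<bar>"
proof -
  have "iexp x - iexp y = iexp y * (iexp (x - y) - 1)"
    by (simp add: algebra_simps exp_add[symmetric])
  then have "cmod (iexp x - iexp y) = cmod (iexp (x - y) - 1)"
    by (simp add: norm_mult)
  also have "\<dots> \<le> \<bar>x - y\<bar>" using iexp_approx1[of "x - y" 0] by simp
  finally show ?thesis .
qed

text \<open>The exponential is 1-Lipschitz on the imaginary axis, and the mean of \<open>?D\<close>
  is at most its root mean square because variances are nonnegative.\<close>

lemma (in prob_space) cmod_char_diff_le:
  fixes Z W :: "'a \<Rightarrow> real"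
  assumes [measurable]: "Z \<in> borel_measurable M" "W \<in> borel_measurable M"
    and sq: "integrable M (\<lambda>\<omega>. (Z \<omega> - W \<omega>)\<^sup>2)"
  shows "cmod (char (distr M borel Z) t - char (distr M borel W) t)
    \<le> \<bar>t\<bar> * sqrt (expectation (\<lambda>\<omega>. (Z \<omega> - W \<omega>)\<^sup>2))"
proof -
  let ?D = "\<lambda>\<omega>. \<bar>Z \<omega> - W \<omega>\<bar>"
  have sq': "integrable M (\<lambda>\<omega>. (?D \<omega>)\<^sup>2)" using sq by simp
  have D: "integrable M ?D"
    by (rule square_integrable_imp_integrable[OF _ sq']) simp
  have "(expectation ?D)\<^sup>2 \<le> expectation (\<lambda>\<omega>. (?D \<omega>)\<^sup>2)"
    using variance_positive[of ?D] variance_eq[OF D sq'] by simp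
  then have L2: "expectation ?D \<le> sqrt (expectation (\<lambda>\<omega>. (Z \<omega> - W \<omega>)\<^sup>2))"
    by (intro real_le_rsqrt) simp
  have i: "integrable M (\<lambda>\<omega>. iexp (t * Z \<omega>))" "integrable M (\<lambda>\<omega>. iexp (t * W \<omega>))"
    by (auto intro!: integrable_iexp)
  have "char (distr M borel Z) t - char (distr M borel W) t = (CLINT \<omega>|M. iexp (t * Z \<omega>) - iexp (t * W \<omega>))"
    using i by (simp add: char_def integral_distr)
  also have "cmod \<dots> \<le> expectation (\<lambda>\<omega>. \<bar>t\<bar> * ?D \<omega>)"
  proof (rule order.trans[OF integral_norm_bound integral_mono])
    show "cmod (iexp (t * Z \<omega>) - iexp (t * W \<omega>)) \<le> \<bar>t\<bar> * ?D \<omega>" for \<omega>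
      using cmod_iexp_diff_le[of "t * Z \<omega>" "t * W \<omega>"] by (simp add: abs_mult right_diff_distrib[symmetric])
  qed (use i D in auto)
  also have "\<dots> = \<bar>t\<bar> * expectation ?D" by simp
  also have "\<dots> \<le> \<bar>t\<bar> * sqrt (expectation (\<lambda>\<omega>. (Z \<omega> - W \<omega>)\<^sup>2))"
    by (intro mult_left_mono L2) simp
  finally show ?thesis .
qed

text \<open>
  With \<open>\<sigma>\<close>, \<open>s\<close>, \<open>d\<close> the standard deviations of \<open>T\<close>, \<open>S\<close> and \<open>T - S\<close>, the squared distance of the
  normalisations is \<open>(d\<^sup>2 - (\<sigma> - s)\<^sup>2) / (\<sigma> s)\<close>.
\<close>

lemma (in prob_space) char_normalized_diff_le:
  fixes T S :: "'a \<Rightarrow> real"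
  assumes [measurable]: "T \<in> borel_measurable M" "S \<in> borel_measurable M"
    and T2: "integrable M (\<lambda>\<omega>. (T \<omega>)\<^sup>2)" and S2: "integrable M (\<lambda>\<omega>. (S \<omega>)\<^sup>2)"
    and close: "4 * variance (\<lambda>\<omega>. T \<omega> - S \<omega>) \<le> \<epsilon>\<^sup>2 * variance T" and \<epsilon>: "0 < \<epsilon>" "\<epsilon> \<le> 1" and pos: "0 < variance T"
  shows "0 < variance S"
    "cmod (char (distr M borel (\<lambda>\<omega>. (T \<omega> - expectation T) / sqrt (variance T))) t -
           char (distr M borel (\<lambda>\<omega>. (S \<omega> - expectation S) / sqrt (variance S))) t) \<le> \<bar>t\<bar> * \<epsilon>"
proof -
  define A B where "A \<omega> = T \<omega> - expectation T" and "B \<omega> = S \<omega> - expectation S" for \<omega>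
  define \<sigma> s where "\<sigma> = sqrt (variance T)" and "s = sqrt (variance S)"
  define v where "v = variance (\<lambda>\<omega>. T \<omega> - S \<omega>)"
  have [measurable]: "A \<in> borel_measurable M" "B \<in> borel_measurable M"
    unfolding A_def B_def by measurable
  have T1: "integrable M T" and S1: "integrable M S"
    using square_integrable_imp_integrable[OF _ T2] square_integrable_imp_integrable[OF _ S2] by auto
  have A2: "integrable M (\<lambda>\<omega>. (A \<omega>)\<^sup>2)" and B2: "integrable M (\<lambda>\<omega>. (B \<omega>)\<^sup>2)"
    using T1 S1 T2 S2 by (simp_all add: A_def B_def power2_diff)
  have AB: "integrable M (\<lambda>\<omega>. (A \<omega> - B \<omega>)\<^sup>2)"
  proof (rule Bochner_Integration.integrable_bound[where f = "\<lambda>\<omega>. 2 * (A \<omega>)\<^sup>2 + 2 * (B \<omega>)\<^sup>2"])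
    show "AE \<omega> in M. norm ((A \<omega> - B \<omega>)\<^sup>2) \<le> norm (2 * (A \<omega>)\<^sup>2 + 2 * (B \<omega>)\<^sup>2)"
    proof (rule AE_I2)
      fix \<omega>
      have "0 \<le> (A \<omega> + B \<omega>)\<^sup>2" by simp
      then have "(A \<omega> - B \<omega>)\<^sup>2 \<le> 2 * (A \<omega>)\<^sup>2 + 2 * (B \<omega>)\<^sup>2"
        by (simp add: power2_sum power2_diff)
      then show "norm ((A \<omega> - B \<omega>)\<^sup>2) \<le> norm (2 * (A \<omega>)\<^sup>2 + 2 * (B \<omega>)\<^sup>2)" by simp
    qed
  qed (use A2 B2 in auto)
  have eA: "expectation (\<lambda>\<omega>. (A \<omega>)\<^sup>2) = \<sigma>\<^sup>2" and eB: "expectation (\<lambda>\<omega>. (B \<omega>)\<^sup>2) = s\<^sup>2"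
    using variance_positive[of T] variance_positive[of S] by (simp_all add: A_def B_def \<sigma>_def s_def)
  have eAB: "expectation (\<lambda>\<omega>. (A \<omega> - B \<omega>)\<^sup>2) = v"
    unfolding v_def A_def B_def using T1 S1
    by (intro Bochner_Integration.integral_cong) (auto simp: algebra_simps)
  have norm_eq: "expectation (\<lambda>\<omega>. (A \<omega> / x - B \<omega> / y)\<^sup>2) = \<sigma>\<^sup>2 / x\<^sup>2 + s\<^sup>2 / y\<^sup>2 - (\<sigma>\<^sup>2 + s\<^sup>2 - v) / (x * y)"
    and norm_int: "integrable M (\<lambda>\<omega>. (A \<omega> / x - B \<omega> / y)\<^sup>2)" if "0 < x" "0 < y" for x y
  proof -
    \<comment> \<open>Polarisation expresses the mixed term through squares whose expectations are
      known.\<close>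
    have eq: "(A \<omega> / x - B \<omega> / y)\<^sup>2 =
        (A \<omega>)\<^sup>2 / x\<^sup>2 + (B \<omega>)\<^sup>2 / y\<^sup>2 - ((A \<omega>)\<^sup>2 + (B \<omega>)\<^sup>2 - (A \<omega> - B \<omega>)\<^sup>2) / (x * y)" for \<omega>
      using that by (simp add: power2_diff power_divide)
    show "expectation (\<lambda>\<omega>. (A \<omega> / x - B \<omega> / y)\<^sup>2) = \<sigma>\<^sup>2 / x\<^sup>2 + s\<^sup>2 / y\<^sup>2 - (\<sigma>\<^sup>2 + s\<^sup>2 - v) / (x * y)"
      unfolding eq using A2 B2 AB by (simp add: eA eB eAB)
    show "integrable M (\<lambda>\<omega>. (A \<omega> / x - B \<omega> / y)\<^sup>2)"
      unfolding eq using A2 B2 AB by simp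
  qed
  have \<sigma>: "0 < \<sigma>" using pos by (simp add: \<sigma>_def)
  have s0: "0 \<le> s" by (simp add: s_def)
  have v: "4 * v \<le> \<epsilon>\<^sup>2 * \<sigma>\<^sup>2" using close pos by (simp add: v_def \<sigma>_def)
  have v1: "4 * v \<le> \<sigma>\<^sup>2"
  proof -
    have "\<epsilon>\<^sup>2 * \<sigma>\<^sup>2 \<le> 1 * \<sigma>\<^sup>2" using \<epsilon> by (intro mult_right_mono) (auto simp: power_le_one)
    then show ?thesis using v by simp
  qed
  have half: "\<sigma> / 2 \<le> s"
  proof -
    have ge: "(\<sigma> - s)\<^sup>2 \<le> v"
    proof (cases "s = 0")
      case True
      have "AE \<omega> in M. (B \<omega>)\<^sup>2 = 0"
        using integral_nonneg_eq_0_iff_AE[OF B2] eB True by auto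
      then have "expectation (\<lambda>\<omega>. (A \<omega> - B \<omega>)\<^sup>2) = expectation (\<lambda>\<omega>. (A \<omega>)\<^sup>2)"
        by (intro integral_cong_AE) auto
      then show ?thesis using eA eAB True by simp
    next
      case False
      then have s: "0 < s" using s0 by simp
      have "0 \<le> expectation (\<lambda>\<omega>. (A \<omega> / \<sigma> - B \<omega> / s)\<^sup>2)" by simp
      also have "\<dots> = 2 - (\<sigma>\<^sup>2 + s\<^sup>2 - v) / (\<sigma> * s)" using norm_eq[OF \<sigma> s] \<sigma> s by simp
      finally have "(\<sigma>\<^sup>2 + s\<^sup>2 - v) / (\<sigma> * s) \<le> 2" by simp
      then have "\<sigma>\<^sup>2 + s\<^sup>2 - v \<le> 2 * (\<sigma> * s)" using \<sigma> s by (simp add: pos_divide_le_eq)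
      then show ?thesis by (simp add: power2_diff)
    qed
    then have "(\<sigma> - s)\<^sup>2 \<le> (\<sigma> / 2)\<^sup>2" using v1 by (simp add: power_divide)
    then have "\<bar>\<sigma> - s\<bar> \<le> \<sigma> / 2" using \<sigma> by (simp add: abs_le_square_iff[symmetric])
    then show ?thesis by linarith
  qed
  then have s: "0 < s" using \<sigma> by linarith
  then show "0 < variance S" by (simp add: s_def)
  have "expectation (\<lambda>\<omega>. (A \<omega> / \<sigma> - B \<omega> / s)\<^sup>2) = 2 - (\<sigma>\<^sup>2 + s\<^sup>2 - v) / (\<sigma> * s)"
    using norm_eq[OF \<sigma> s] \<sigma> s by simp
  also have "\<dots> = (v - (\<sigma> - s)\<^sup>2) / (\<sigma> * s)"
    using \<sigma> s by (simp add: field_simps power2_eq_square)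
  also have "\<dots> \<le> v / (\<sigma> * s)" using \<sigma> s by (intro divide_right_mono) auto
  also have "\<dots> \<le> \<epsilon>\<^sup>2"
  proof -
    have "0 \<le> v" using variance_positive by (simp add: v_def)
    \<comment> \<open>The factor 4 in the hypothesis leaves room to replace half of \<sigma> by the
      smaller-or-larger \<open>s\<close>, using that \<open>s\<close> is at least half of
      \<sigma>.\<close>
    then have "v \<le> \<epsilon>\<^sup>2 * \<sigma>\<^sup>2 / 2" using v by simp
    then have "v \<le> \<epsilon>\<^sup>2 * (\<sigma> * (\<sigma> / 2))" by (simp add: power2_eq_square)
    also have "\<dots> \<le> \<epsilon>\<^sup>2 * (\<sigma> * s)" using half \<sigma> by (intro mult_left_mono) auto
    finally show ?thesis using \<sigma> s by (simp add: pos_divide_le_eq)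
  qed
  finally have e: "expectation (\<lambda>\<omega>. (A \<omega> / \<sigma> - B \<omega> / s)\<^sup>2) \<le> \<epsilon>\<^sup>2" .
  have "cmod (char (distr M borel (\<lambda>\<omega>. A \<omega> / \<sigma>)) t - char (distr M borel (\<lambda>\<omega>. B \<omega> / s)) t)
      \<le> \<bar>t\<bar> * sqrt (expectation (\<lambda>\<omega>. (A \<omega> / \<sigma> - B \<omega> / s)\<^sup>2))"
    by (rule cmod_char_diff_le) (use norm_int[OF \<sigma> s] in auto)
  also have "\<dots> \<le> \<bar>t\<bar> * \<epsilon>"
    using e \<epsilon> by (intro mult_left_mono real_le_lsqrt) auto
  finally show "cmod (char (distr M borel (\<lambda>\<omega>. (T \<omega> - expectation T) / sqrt (variance T))) t -
      char (distr M borel (\<lambda>\<omega>. (S \<omega> - expectation S) / sqrt (variance S))) t) \<le> \<bar>t\<bar> * \<epsilon>"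
    by (simp add: A_def B_def \<sigma>_def s_def)
qed

section \<open>Variance bounds\<close>

definition dyadic_cell :: "nat \<Rightarrow> real \<times> real \<Rightarrow> int \<times> int" where
  "dyadic_cell k q = (\<lfloor>2 ^ k * fst q\<rfloor>, \<lfloor>2 ^ k * snd q\<rfloor>)"

lemma floor_half_eq:
  fixes x y :: real
  assumes "\<lfloor>2 * x\<rfloor> = \<lfloor>2 * y\<rfloor>" shows "\<lfloor>x\<rfloor> = \<lfloor>y\<rfloor>"
  using floor_divide_real_eq_div[of 2 "2 * x"] floor_divide_real_eq_div[of 2 "2 * y"] assms by simp

lemma floor_separate:
  assumes "x \<noteq> (y :: real)" shows "\<exists>k. \<lfloor>2 ^ k * x\<rfloor> \<noteq> \<lfloor>2 ^ k * y\<rfloor>"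
proof -
  obtain k :: nat where k: "1 / \<bar>x - y\<bar> < 2 ^ k"
    using real_arch_pow[of 2 "1 / \<bar>x - y\<bar>"] by auto
  then have "1 < 2 ^ k * \<bar>x - y\<bar>" using assms by (simp add: pos_divide_less_eq)
  also have "2 ^ k * \<bar>x - y\<bar> = \<bar>2 ^ k * x - 2 ^ k * y\<bar>"
    by (simp add: right_diff_distrib[symmetric] abs_mult)
  finally have "1 < \<bar>2 ^ k * x - 2 ^ k * y\<bar>" .
  then have "\<lfloor>2 ^ k * x\<rfloor> \<noteq> \<lfloor>2 ^ k * y\<rfloor>" by linarith
  then show ?thesis by blast
qed

lemma separated_ppp_unit:
  assumes "poisson_point_process M (unit_intensity n) N"
  shows "separated_ppp M (unit_intensity n) N dyadic_cell"
proof -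
  interpret poisson_point_process M "unit_intensity n" N by fact
  show ?thesis
  proof
    fix k and c :: "int \<times> int"
    have "dyadic_cell k -` {c} \<inter> space (unit_intensity n) =
      {q \<in> space (unit_intensity n). of_int (fst c) \<le> 2 ^ k * fst q \<and> 2 ^ k * fst q < of_int (fst c) + 1
         \<and> of_int (snd c) \<le> 2 ^ k * snd q \<and> 2 ^ k * snd q < of_int (snd c) + 1}"
      by (auto simp: dyadic_cell_def prod_eq_iff floor_eq_iff)
    also have "\<dots> \<in> sets (unit_intensity n)"
      by (intro sets.sets_Collect_conj borel_measurable_le borel_measurable_less borel_measurable_times
          borel_measurable_const fst_snd_measurable)
    finally show "dyadic_cell k -` {c} \<inter> space (unit_intensity n) \<in> sets (unit_intensity n)" .
  next
    fix k
    have "dyadic_cell k ` space (unit_intensity n) \<subseteq>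
        {\<lfloor>2 ^ k * (- n / 2)\<rfloor>..\<lfloor>2 ^ k * (n / 2)\<rfloor>} \<times> {\<lfloor>2 ^ k * (0 :: real)\<rfloor>..\<lfloor>2 ^ k * (1 :: real)\<rfloor>}"
    proof
      fix c assume "c \<in> dyadic_cell k ` space (unit_intensity n)"
      then obtain q where q: "q \<in> marked_torus n" "c = dyadic_cell k q" by auto
      then have "- n / 2 \<le> fst q" "fst q \<le> n / 2" "0 \<le> snd q" "snd q \<le> 1"
        by (auto simp: marked_torus_def)
      then have "2 ^ k * (- n / 2) \<le> 2 ^ k * fst q" "2 ^ k * fst q \<le> 2 ^ k * (n / 2)"
        "2 ^ k * 0 \<le> 2 ^ k * snd q" "2 ^ k * snd q \<le> 2 ^ k * 1"
        by (intro mult_left_mono; simp)+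
      then show "c \<in> {\<lfloor>2 ^ k * (- n / 2)\<rfloor>..\<lfloor>2 ^ k * (n / 2)\<rfloor>} \<times> {\<lfloor>2 ^ k * (0 :: real)\<rfloor>..\<lfloor>2 ^ k * (1 :: real)\<rfloor>}"
        unfolding q(2) dyadic_cell_def by (intro SigmaI) (simp_all only: atLeastAtMost_iff floor_mono)
    qed
    then show "finite (dyadic_cell k ` space (unit_intensity n))"
      by (rule finite_subset) auto
  next
    fix k and x y :: "real \<times> real"
    assume "dyadic_cell (Suc k) x = dyadic_cell (Suc k) y"
    then show "dyadic_cell k x = dyadic_cell k y"
      using floor_half_eq[of "2 ^ k * fst x" "2 ^ k * fst y"] floor_half_eq[of "2 ^ k * snd x" "2 ^ k * snd y"]
      by (simp add: dyadic_cell_def mult.assoc)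
  next
    fix x y :: "real \<times> real" assume "x \<noteq> y"
    then show "\<exists>k. dyadic_cell k x \<noteq> dyadic_cell k y"
      using floor_separate[of "fst x" "fst y"] floor_separate[of "snd x" "snd y"]
      by (auto simp: dyadic_cell_def prod_eq_iff)
  next
    fix x :: "real \<times> real"
    show "emeasure (unit_intensity n) {x} = 0"
    proof (cases "x \<in> marked_torus n")
      case True
      then show ?thesis by (subst emeasure_unit_intensity) auto
    next
      case False
      then show ?thesis by (intro emeasure_notin_sets) (auto simp: sets_unit_intensity)
    qed
  qed
qed

definition diagonal_pattern :: "nat \<Rightarrow> nat \<Rightarrow> nat" where
  "diagonal_pattern m = (\<lambda>j\<in>{1..m}. j)"

lemma diagonal_pattern:
  assumes "1 \<le> m"
  shows "diagonal_pattern m \<in> patterns m - {no_overlap m}" "pattern_index m (diagonal_pattern m) = {1..m}"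
    "A \<in> sets (PiM {1..m} (\<lambda>_. \<nu>)) \<Longrightarrow> glued \<nu> m (diagonal_pattern m) A A = A"
proof -
  have "diagonal_pattern m 1 \<noteq> no_overlap m 1"
    using assms by (auto simp: diagonal_pattern_def no_overlap_def)
  then have "diagonal_pattern m \<noteq> no_overlap m" by metis
  moreover have "diagonal_pattern m \<in> patterns m"
    by (auto simp: diagonal_pattern_def patterns_def inj_on_def)
  ultimately show "diagonal_pattern m \<in> patterns m - {no_overlap m}" by simp
  show idx: "pattern_index m (diagonal_pattern m) = {1..m}"
    by (auto simp: pattern_index_def diagonal_pattern_def)
  assume A: "A \<in> sets (PiM {1..m} (\<lambda>_. \<nu>))"
  have "restrict R {1..m} = R" "(\<lambda>j\<in>{1..m}. R (diagonal_pattern m j)) = R"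
    if "R \<in> space (PiM {1..m} (\<lambda>_. \<nu>))" for R
    using that by (auto simp: space_PiM PiE_iff extensional_def diagonal_pattern_def restrict_def)
  then show "glued \<nu> m (diagonal_pattern m) A A = A"
    using sets.sets_into_space[OF A] unfolding glued_def idx by auto
qed

section \<open>Upper and lower bounds of linear order\<close>

context adrcm_tree
begin

lemma tree_count_eq:
  assumes X: "X \<subseteq> marked_torus n" and E: "E = (\<lambda>v. (v, pa v)) ` ({1..m} - {r})"
  shows "tree_count n \<beta> \<gamma> m E X = card (tuples {1..m} X \<inter> tree_event n)"
proof -
  have "{P \<in> {1..m} \<rightarrow>\<^sub>E X. inj_on P {1..m} \<and> (\<forall>(i, j)\<in>E. adrcm_edge n \<beta> \<gamma> (P i) (P j))} =
      tuples {1..m} X \<inter> tree_event n"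
    using X unfolding E by (auto simp: tuples_def tree_event_def space_PiM PiE_iff)
  then show ?thesis by (simp add: tree_count_def)
qed

definition var_const :: real where
  "var_const = (\<Sum>\<tau>\<in>patterns m - {no_overlap m}. pattern_const \<tau>)"

lemma m_pos: "1 \<le> m" using root_in by simp

lemma var_const_pos: "0 < var_const"
  unfolding var_const_def using diagonal_pattern(1)[OF m_pos] finite_patterns pattern_const_pos
  by (intro sum_pos) auto

text \<open>Serves both the full count and the remainder outside the blocks: a family of copies has
  small variance if their roots are confined to a small set, up to roots of small mark.\<close>

theorem variance_part_le:
  assumes n: "0 < n" and N: "poisson_point_process M (unit_intensity n) N"
    and A': "A' \<in> sets (PiM {1..m} (\<lambda>_. unit_intensity n))" "A' \<subseteq> tree_event n"
    and D: "D \<in> sets borel" "emeasure lborel D \<le> ennreal d" and d: "0 \<le> d" and \<kappa>: "0 < \<kappa>"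
    and cover: "\<And>P. P \<in> A' \<Longrightarrow> fst (P r) \<in> D \<or> snd (P r) \<le> \<kappa>"
  shows "prob_space.variance M (\<lambda>\<omega>. real (card (tuples {1..m} (N \<omega>) \<inter> A'))) \<le> var_const * (d + \<kappa> powr \<delta> * n)"
proof -
  interpret separated_ppp M "unit_intensity n" N dyadic_cell by (rule separated_ppp_unit[OF N])
  let ?\<nu> = "unit_intensity n"
  have "measure (PiM (pattern_index m \<tau>) (\<lambda>_. ?\<nu>)) (glued ?\<nu> m \<tau> A' A') \<le> pattern_const \<tau> * (d + \<kappa> powr \<delta> * n)"
    if \<tau>: "\<tau> \<in> patterns m - {no_overlap m}" for \<tau>
  proof -
    let ?P = "PiM (pattern_index m \<tau>) (\<lambda>_. ?\<nu>)"
    let ?G = "glued ?\<nu> m \<tau> (tree_event n) (tree_event n)"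
    let ?G1 = "{R \<in> ?G. fst (R r) \<in> D \<and> snd (R r) \<le> 1}"
    let ?I = "{- n / 2..<n / 2}"
    let ?G2 = "{R \<in> ?G. fst (R r) \<in> ?I \<and> snd (R r) \<le> \<kappa>}"
    have rV: "r \<in> pattern_index m \<tau>" using root_in by (auto simp: pattern_index_def)
    have tor: "R r \<in> marked_torus n" if "R \<in> space ?P" for R
      using that rV by (auto simp: space_PiM PiE_iff)
    have coord: "(\<lambda>P. fst (P r)) \<in> borel_measurable ?P" "(\<lambda>P. snd (P r)) \<in> borel_measurable ?P"
      using measurable_compose[OF measurable_component_singleton[OF rV, of "\<lambda>_. ?\<nu>"]] fst_snd_measurable by blast+
    have G: "?G \<in> sets ?P" by (intro glued_measurable tree_event_measurable n)
    have meas: "{R \<in> ?G. fst (R r) \<in> D' \<and> snd (R r) \<le> k} \<in> sets ?P" if "D' \<in> sets borel" for D' k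
    proof -
      have "{R \<in> ?G. fst (R r) \<in> D' \<and> snd (R r) \<le> k} = ?G \<inter> {R \<in> space ?P. fst (R r) \<in> D' \<and> snd (R r) \<le> k}"
        by (auto simp: glued_def)
      then show ?thesis using sets.Int[OF G root_weight_measurable(2)[OF coord that]] by simp
    qed
    have "glued ?\<nu> m \<tau> A' A' \<subseteq> ?G1 \<union> ?G2"
    proof
      fix R assume R: "R \<in> glued ?\<nu> m \<tau> A' A'"
      then have "restrict R {1..m} \<in> A'" "R \<in> space ?P" by (auto simp: glued_def)
      moreover have "restrict R {1..m} r = R r" using root_in by simp
      ultimately have "fst (R r) \<in> D \<or> snd (R r) \<le> \<kappa>" using cover[of "restrict R {1..m}"] by simp
      moreover have "fst (R r) \<in> ?I" "snd (R r) \<le> 1"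
        using tor[OF \<open>R \<in> space ?P\<close>] by (auto simp: marked_torus_def)
      moreover have "R \<in> ?G" using R A'(2) by (auto simp: glued_def)
      ultimately show "R \<in> ?G1 \<union> ?G2" by auto
    qed
    then have "emeasure ?P (glued ?\<nu> m \<tau> A' A') \<le> emeasure ?P (?G1 \<union> ?G2)"
      by (rule emeasure_mono) (intro sets.Un meas D atLeastLessThan_borel)
    also have "\<dots> \<le> emeasure ?P ?G1 + emeasure ?P ?G2"
      by (intro emeasure_subadditive meas D) simp
    also have "\<dots> \<le> ennreal (pattern_const \<tau> * 1 powr \<delta>) * emeasure lborel D
        + ennreal (pattern_const \<tau> * \<kappa> powr \<delta>) * emeasure lborel ?I"
      using \<tau> D \<kappa> n by (intro add_mono emeasure_glued_le) auto
    also have "\<dots> \<le> ennreal (pattern_const \<tau> * 1 powr \<delta>) * ennreal d + ennreal (pattern_const \<tau> * \<kappa> powr \<delta>) * ennreal n"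
      using D n by (intro add_mono mult_left_mono) auto
    also have "\<dots> = ennreal (pattern_const \<tau> * (d + \<kappa> powr \<delta> * n))"
      using pattern_const_pos[of \<tau>] d n
      by (simp add: ennreal_mult[symmetric] ennreal_plus[symmetric] distrib_left mult.assoc del: ennreal_plus)
    finally show ?thesis
      using pattern_const_pos[of \<tau>] d n
      by (simp add: measure_def enn2real_leI)
  qed
  then have "(\<Sum>\<tau>\<in>patterns m - {no_overlap m}. measure (PiM (pattern_index m \<tau>) (\<lambda>_. ?\<nu>)) (glued ?\<nu> m \<tau> A' A'))
      \<le> (\<Sum>\<tau>\<in>patterns m - {no_overlap m}. pattern_const \<tau> * (d + \<kappa> powr \<delta> * n))"
    by (rule sum_mono)
  then show ?thesis
    unfolding tuple_moments(5)[OF A'(1)] var_const_def sum_distrib_right .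
qed

text \<open>With window length \<open>min \<beta> 1\<close>, the torus holds at least
  \<open>n / (2 * min \<beta> 1)\<close> disjoint windows, each contributing the volume of one box
  per vertex.\<close>

definition mean_const :: real where
  "mean_const = (min \<beta> 1 / m) ^ m / (2 * min \<beta> 1)"

lemma mean_const_pos: "0 < mean_const"
  using \<beta> m_pos by (simp add: mean_const_def)

text \<open>All positions are put into one window of length at most \<beta>, and a vertex of depth
  \<open>k\<close> gets a mark between \<open>k / m\<close> and \<open>(k + 1) / m\<close>. Marks
  then increase away from the root, and since they are at most 1 every radius is at least \<beta>,
  so all edges are present.\<close>

lemma measure_tree_event_ge:
  assumes n: "1 \<le> n"
  shows "mean_const * n \<le> measure (PiM {1..m} (\<lambda>_. unit_intensity n)) (tree_event n)"
proof -
  let ?\<nu> = "unit_intensity n" and ?w = "min \<beta> 1"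
  let ?P = "PiM {1..m} (\<lambda>_. ?\<nu>)"
  \<comment> \<open>As the quotient is at least 1, rounding it down loses at most a factor
    2.\<close>
  define K where "K = nat \<lfloor>n / ?w\<rfloor>"
  have w: "0 < ?w" using \<beta> by simp
  have nw: "1 \<le> n / ?w" using n w by (simp add: pos_le_divide_eq)
  have K: "n / (2 * ?w) \<le> real K" "real K * ?w \<le> n"
  proof -
    have "real K = of_int \<lfloor>n / ?w\<rfloor>" using nw by (simp add: K_def)
    moreover have "1 \<le> \<lfloor>n / ?w\<rfloor>" using nw by (simp add: le_floor_iff)
    ultimately have "real K \<le> n / ?w" "n / ?w < real K + 1" "1 \<le> real K" by linarith+
    then show "n / (2 * ?w) \<le> real K" "real K * ?w \<le> n"
      using w by (simp_all add: pos_le_divide_eq)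
  qed
  \<comment> \<open>The mark intervals are open on the left: marks stay positive, and a child
    exceeds its parent strictly.\<close>
  define B where "B b v = {- n / 2 + real b * ?w ..< - n / 2 + (real b + 1) * ?w} \<times>
      {real (dep v) / m <.. (real (dep v) + 1) / m}" for b :: nat and v
  have Bm: "B b v \<subseteq> marked_torus n" if "b < K" "v \<in> {1..m}" for b v
  proof -
    have "(real b + 1) * ?w \<le> real K * ?w" using that w by (intro mult_right_mono) auto
    then have "- n / 2 + (real b + 1) * ?w \<le> n / 2" using K by simp
    moreover have "0 \<le> real b * ?w" using w by simp
    ultimately have 1: "{- n / 2 + real b * ?w ..< - n / 2 + (real b + 1) * ?w} \<subseteq> {- n / 2 ..< n / 2}"
      by auto
    have 2: "{real (dep v) / m <.. (real (dep v) + 1) / m} \<subseteq> {0..1}"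
    proof
      fix u assume u: "u \<in> {real (dep v) / m <.. (real (dep v) + 1) / m}"
      have "0 \<le> real (dep v) / m" by simp
      also have "\<dots> \<le> u" using u by simp
      finally have "0 \<le> u" .
      moreover have "(real (dep v) + 1) / m \<le> 1" using dep_less[OF that(2)] by simp
      then have "u \<le> 1" using u by simp
      ultimately show "u \<in> {0..1}" by simp
    qed
    show ?thesis unfolding B_def marked_torus_def by (rule Sigma_mono[OF 1 2])
  qed
  have Bb: "B b v \<in> sets borel" for b v unfolding B_def by (intro borel_Times) auto
  have Bs: "B b v \<in> sets ?\<nu>" if "b < K" "v \<in> {1..m}" for b v
    using Bb Bm[OF that] by (simp add: sets_unit_intensity)
  have Be: "emeasure ?\<nu> (B b v) = ennreal (?w / m)" if "b < K" "v \<in> {1..m}" for b v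
  proof -
    have "emeasure ?\<nu> (B b v) = emeasure lborel (B b v)"
      by (rule emeasure_unit_intensity[OF Bb Bm[OF that]])
    also have "\<dots> = ennreal ?w * ennreal (1 / m)"
      unfolding B_def using w by (subst emeasure_lborel_Times) (auto simp: divide_right_mono algebra_simps diff_divide_distrib[symmetric])
    finally show ?thesis using w by (simp add: ennreal_mult[symmetric])
  qed
  have sub: "Pi\<^sub>E {1..m} (B b) \<subseteq> tree_event n" if b: "b < K" for b
  proof
    fix P assume P: "P \<in> Pi\<^sub>E {1..m} (B b)"
    show "P \<in> tree_event n"
      unfolding tree_event_iff[OF less_le_trans[OF zero_less_one n]]
    proof (intro conjI ballI)
      show "P \<in> space ?P" using P Bm[OF b] by (fastforce simp: space_PiM PiE_iff)
    next
      fix v assume v: "v \<in> {1..m} - {r}"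
      have vb: "P v \<in> B b v" "P (pa v) \<in> B b (pa v)" using P v pa_in[of v] by auto
      have dv: "real (dep v) = real (dep (pa v)) + 1" using v dep_pa[of v] by simp
      show lt: "snd (P (pa v)) < snd (P v)" using vb dv by (auto simp: B_def mem_Times_iff)
      have tor: "P v \<in> marked_torus n" "P (pa v) \<in> marked_torus n" using vb Bm[OF b] v pa_in[of v] by auto
      have u: "0 < snd (P (pa v))" "snd (P v) \<le> 1" 
        using vb(2) tor by (auto simp: B_def mem_Times_iff marked_torus_def intro: le_less_trans[of 0 "real (dep (pa v)) / m"])
      have "\<bar>fst (P v) - fst (P (pa v))\<bar> \<le> ?w"
        using vb by (auto simp: B_def mem_Times_iff algebra_simps abs_le_iff)
      then have "wrap_dist n (fst (P v)) (fst (P (pa v))) \<le> \<beta>" by (auto simp: wrap_dist_def)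
      also have "\<beta> = \<beta> * 1 * 1" by simp
      also have "\<beta> * 1 * 1 \<le> radius (snd (P v)) (snd (P (pa v)))"
        unfolding radius_def
      proof (intro mult_mono)
        let ?a = "min (snd (P v)) (snd (P (pa v)))" and ?b = "max (snd (P v)) (snd (P (pa v)))"
        have "0 < ?a" "?a \<le> 1" "0 < ?b" "?b \<le> 1" using u lt by auto
        moreover have "1 \<le> x powr (- c)" if "0 < x" "x \<le> 1" "0 \<le> c" for x c :: real
          using powr_mono'[of "- c" 0 x] that by simp
        ultimately show "1 \<le> ?a powr (- \<gamma>)" "1 \<le> ?b powr (\<gamma> - 1)"
          using \<gamma> \<gamma>_less by (metis less_imp_le, metis less_imp_le minus_diff_eq diff_ge_0_iff_ge)
      qed (use \<beta> in auto)
      finally show "wrap_dist n (fst (P v)) (fst (P (pa v))) \<le> radius (snd (P v)) (snd (P (pa v)))" .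
    qed
  qed
  have n0: "0 < n" using n by simp
  interpret fin: finite_measure ?\<nu> by (rule finite_measure_unit_intensity)
  have box: "Pi\<^sub>E {1..m} (B b) \<in> sets ?P" if "b < K" for b
    using Bs[OF that] by (intro sets_PiM_I_finite) auto
  have "ennreal (real K * (?w / m) ^ m) = (\<Sum>b<K. emeasure ?P (Pi\<^sub>E {1..m} (B b)))"
  proof -
    have "emeasure ?P (Pi\<^sub>E {1..m} (B b)) = ennreal ((?w / m) ^ m)" if "b < K" for b
      using Bs[OF that] Be[OF that] w by (subst unit.emeasure_PiM) (auto simp: ennreal_power)
    then show ?thesis using w by (simp add: ennreal_mult ennreal_of_nat_eq_real_of_nat)
  qed
  also have "\<dots> = emeasure ?P (\<Union>b<K. Pi\<^sub>E {1..m} (B b))"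
  proof (rule sum_emeasure)
    show "(\<lambda>b. Pi\<^sub>E {1..m} (B b)) ` {..<K} \<subseteq> sets ?P" using box by auto
    show "disjoint_family_on (\<lambda>b. Pi\<^sub>E {1..m} (B b)) {..<K}"
      unfolding disjoint_family_on_def
    proof (intro ballI impI)
      fix b c assume bc: "b \<in> {..<K}" "c \<in> {..<K}" "b \<noteq> c"
      have "B b r \<inter> B c r = {}"
      proof -
        have "real b + 1 \<le> real c \<or> real c + 1 \<le> real b" using bc(3) by linarith
        then have "(real b + 1) * ?w \<le> real c * ?w \<or> (real c + 1) * ?w \<le> real b * ?w"
          using w by (auto intro: mult_right_mono)
        then show ?thesis by (auto simp: B_def)
      qed
      moreover have "P r \<in> B b r \<inter> B c r" if "P \<in> Pi\<^sub>E {1..m} (B b) \<inter> Pi\<^sub>E {1..m} (B c)" for P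
        using that root_in by blast
      ultimately show "Pi\<^sub>E {1..m} (B b) \<inter> Pi\<^sub>E {1..m} (B c) = {}" by blast
    qed
  qed simp
  also have "\<dots> \<le> emeasure ?P (tree_event n)"
    using sub by (intro emeasure_mono tree_event_measurable n0) auto
  finally have le: "ennreal (real K * (?w / m) ^ m) \<le> emeasure ?P (tree_event n)" .
  have "emeasure ?P (tree_event n) \<le> emeasure ?P (space ?P)" by (rule emeasure_space)
  also have "\<dots> = (\<Prod>v\<in>{1..m}. emeasure ?\<nu> (space ?\<nu>))" unfolding space_PiM by (rule unit.emeasure_PiM) (simp_all only: finite_atLeastAtMost sets.top)
  also have "\<dots> < \<infinity>" using less_top[THEN iffD1, OF fin.emeasure_finite[unfolded infinity_ennreal_def], of "space ?\<nu>"]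
    by (simp add: power_less_top_ennreal)
  finally have "emeasure ?P (tree_event n) = ennreal (measure ?P (tree_event n))"
    by (simp add: emeasure_eq_ennreal_measure)
  then have "real K * (?w / m) ^ m \<le> measure ?P (tree_event n)" using le by simp
  moreover have "mean_const * n \<le> real K * (?w / m) ^ m"
  proof -
    have "mean_const * n = n / (2 * ?w) * (?w / m) ^ m" by (simp add: mean_const_def)
    also have "\<dots> \<le> real K * (?w / m) ^ m" using w by (intro mult_right_mono K) auto
    finally show ?thesis .
  qed
  ultimately show ?thesis by linarith
qed

theorem variance_bounds:
  assumes n: "1 \<le> n" and N: "poisson_point_process M (unit_intensity n) N"
  shows "mean_const * n \<le> prob_space.variance M (\<lambda>\<omega>. real (card (tuples {1..m} (N \<omega>) \<inter> tree_event n)))"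
    "prob_space.variance M (\<lambda>\<omega>. real (card (tuples {1..m} (N \<omega>) \<inter> tree_event n))) \<le> 2 * var_const * n"
proof -
  interpret separated_ppp M "unit_intensity n" N dyadic_cell by (rule separated_ppp_unit[OF N])
  let ?\<nu> = "unit_intensity n"
  have n0: "0 < n" using n by simp
  note A = tree_event_measurable[OF n0]
  have "mean_const * n \<le> measure (PiM {1..m} (\<lambda>_. ?\<nu>)) (tree_event n)"
    by (rule measure_tree_event_ge[OF n])
  also have "\<dots> = measure (PiM (pattern_index m (diagonal_pattern m)) (\<lambda>_. ?\<nu>)) (glued ?\<nu> m (diagonal_pattern m) (tree_event n) (tree_event n))"
    using diagonal_pattern(2)[OF m_pos] diagonal_pattern(3)[OF m_pos A] by simp
  also have "\<dots> \<le> (\<Sum>\<tau>\<in>patterns m - {no_overlap m}. measure (PiM (pattern_index m \<tau>) (\<lambda>_. ?\<nu>)) (glued ?\<nu> m \<tau> (tree_event n) (tree_event n)))"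
    using diagonal_pattern(1)[OF m_pos] finite_patterns by (intro member_le_sum) auto
  finally show "mean_const * n \<le> variance (\<lambda>\<omega>. real (card (tuples {1..m} (N \<omega>) \<inter> tree_event n)))"
    unfolding tuple_moments(5)[OF A] .
  \<comment> \<open>With \<open>D\<close> the whole torus and mark bound 1, both terms of the
    general bound equal \<open>n\<close>, which explains the factor 2.\<close>
  have "variance (\<lambda>\<omega>. real (card (tuples {1..m} (N \<omega>) \<inter> tree_event n))) \<le> var_const * (n + 1 powr \<delta> * n)"
  proof (rule variance_part_le[OF n0 N A order_refl, where D = "{- n / 2..<n / 2}"])
    fix P assume "P \<in> tree_event n"
    then have "P r \<in> marked_torus n" using root_in by (auto simp: tree_event_def space_PiM PiE_iff)
    then show "fst (P r) \<in> {- n / 2..<n / 2} \<or> snd (P r) \<le> 1" by (auto simp: marked_torus_def)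
  qed (use n in auto)
  then show "variance (\<lambda>\<omega>. real (card (tuples {1..m} (N \<omega>) \<inter> tree_event n))) \<le> 2 * var_const * n"
    by simp
qed

end

section \<open>Decomposition into blocks\<close>

context poisson_point_process
begin

lemma card_image_count:
  assumes "inj_on g D"
  shows "card (g ` (N \<omega> \<inter> D) \<inter> A) = count (D \<inter> g -` A) \<omega>"
proof -
  have "g ` (N \<omega> \<inter> D) \<inter> A = g ` (N \<omega> \<inter> (D \<inter> g -` A))" by auto
  moreover have "inj_on g (N \<omega> \<inter> (D \<inter> g -` A))" by (rule inj_on_subset[OF assms]) auto
  ultimately show ?thesis by (simp add: card_image)
qed

lemma image_ppp:
  assumes fin: "finite_measure \<nu>'" and inj: "inj_on g D" and into: "g ` D \<subseteq> space \<nu>'"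
    and pre: "\<And>A. A \<in> sets \<nu>' \<Longrightarrow> D \<inter> g -` A \<in> sets \<nu>"
    and eq: "\<And>A. A \<in> sets \<nu>' \<Longrightarrow> measure \<nu> (D \<inter> g -` A) = measure \<nu>' A"
  shows "poisson_point_process M \<nu>' (\<lambda>\<omega>. g ` (N \<omega> \<inter> D))"
proof -
  interpret fin: finite_measure \<nu>' by (rule fin)
  show ?thesis
  proof (unfold_locales, goal_cases)
    case (1 \<omega>)
    then show ?case using points_finite by auto
  next
    case (2 \<omega>)
    then show ?case using into by auto
  next
    case (3 A)
    then show ?case using count_measurable[OF pre] by (simp add: card_image_count[OF inj])
  next
    case (4 A k)
    then show ?case using count_poisson[OF pre] eq by (simp add: card_image_count[OF inj])
  next
    case (5 I A)
    have "disjoint_family_on (\<lambda>i. D \<inter> g -` A i) I"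
      using 5(3) by (auto simp: disjoint_family_on_def)
    then show ?case
      using count_indep[of I "\<lambda>i. D \<inter> g -` A i"] 5 pre by (simp add: card_image_count[OF inj])
  qed
qed

text \<open>On configuration space the process is the identity map, so the moment theorem applied
  there yields measurability of a count as a function of the configuration.\<close>

lemma canonical_ppp: "poisson_point_process (distr M (conf \<nu>) N) \<nu> (\<lambda>X. X)"
proof -
  let ?Q = "distr M (conf \<nu>) N"
  interpret Q: prob_space ?Q by (rule prob_space_distr[OF N_measurable])
  have cm: "(\<lambda>X. card (X \<inter> A)) \<in> measurable ?Q (count_space UNIV)" if "A \<in> sets \<nu>" for A
    using measurable_conf_count[OF that] by simp
  show ?thesis
  proof (unfold_locales, goal_cases)
    case (3 A)
    then show ?case by (rule cm)
  next
    case (4 A k)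
    have "{X \<in> space ?Q. card (X \<inter> A) = k} = (\<lambda>X. card (X \<inter> A)) -` {k} \<inter> space (conf \<nu>)" by auto
    also have "\<dots> \<in> sets (conf \<nu>)" by (rule measurable_sets[OF measurable_conf_count[OF 4]]) simp
    finally have m: "{X \<in> space ?Q. card (X \<inter> A) = k} \<in> sets (conf \<nu>)" .
    have "N -` {X \<in> space ?Q. card (X \<inter> A) = k} \<inter> space M = {\<omega> \<in> space M. count A \<omega> = k}"
      using N_configs by auto
    then have "Q.prob {X \<in> space ?Q. card (X \<inter> A) = k} = prob {\<omega> \<in> space M. count A \<omega> = k}"
      using measure_distr[OF N_measurable m] by simp
    then show ?case using count_poisson[OF 4] by simp
  next
    case (5 I A)
    show ?case
    proof (cases "I = {}")
      case True
      then show ?thesis by (simp add: Q.indep_vars_def Q.indep_sets_def)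
    next
      case False
      have [measurable]: "(\<lambda>X. \<lambda>i\<in>I. card (X \<inter> A i)) \<in> measurable (conf \<nu>) (PiM I (\<lambda>_. count_space UNIV))"
        using measurable_conf_count 5(2) by (intro measurable_restrict) auto
      have "distr ?Q (PiM I (\<lambda>_. count_space UNIV)) (\<lambda>X. \<lambda>i\<in>I. card (X \<inter> A i)) =
          distr M (PiM I (\<lambda>_. count_space UNIV)) (\<lambda>\<omega>. \<lambda>i\<in>I. count (A i) \<omega>)"
        using N_measurable by (subst distr_distr) (auto simp: comp_def)
      also have "\<dots> = PiM I (\<lambda>i. distr M (count_space UNIV) (count (A i)))"
        using indep_vars_iff_distr_eq_PiM'[OF False, where M' = "\<lambda>_. count_space UNIV" and X = "\<lambda>i. count (A i)"]
          count_indep[OF 5] count_measurable[OF 5(2)] by blast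
      also have "\<dots> = PiM I (\<lambda>i. distr ?Q (count_space UNIV) (\<lambda>X. card (X \<inter> A i)))"
      proof (rule PiM_cong[OF refl])
        fix i assume "i \<in> I"
        then show "distr M (count_space UNIV) (count (A i)) = distr ?Q (count_space UNIV) (\<lambda>X. card (X \<inter> A i))"
          using distr_distr[OF measurable_conf_count[OF 5(2)] N_measurable] by (simp add: comp_def)
      qed
      finally show ?thesis
        using Q.indep_vars_iff_distr_eq_PiM'[OF False, where M' = "\<lambda>_. count_space UNIV" and X = "\<lambda>i X. card (X \<inter> A i)"]
          cm[OF 5(2)] by blast
    qed
  qed (auto simp: configs_def)
qed

end

section \<open>Blocks of the torus and the copies inside them\<close>

context adrcm_tree
begin

definition block :: "real \<Rightarrow> real \<Rightarrow> nat \<Rightarrow> real set" where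
  "block n L b = {- n / 2 + real b * L ..< - n / 2 + (real b + 1) * L}"

definition slab :: "real \<Rightarrow> real \<Rightarrow> nat \<Rightarrow> (real \<times> real) set" where
  "slab n L b = block n L b \<times> {0..1}"

definition num_blocks :: "real \<Rightarrow> real \<Rightarrow> nat" where
  "num_blocks n L = nat \<lfloor>n / L\<rfloor>"

definition centre :: "real \<Rightarrow> real \<Rightarrow> nat \<Rightarrow> real" where
  "centre n L b = - n / 2 + real b * L + L / 2"

definition shift :: "real \<Rightarrow> real \<Rightarrow> nat \<Rightarrow> real \<times> real \<Rightarrow> real \<times> real" where
  "shift n L b q = (- centre n L b, 0) + q"

text \<open>Ordinary distance instead of the distance of the short torus: a block cut out of a long
  torus has no periodic boundary. The event depends on \<open>L\<close> only, which makes the block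
  counts identically distributed for all \<open>n\<close>.\<close>

definition plain_event :: "real \<Rightarrow> (nat \<Rightarrow> real \<times> real) set" where
  "plain_event L = {P \<in> space (PiM {1..m} (\<lambda>_. unit_intensity L)). \<forall>v\<in>{1..m} - {r}.
     snd (P (pa v)) < snd (P v) \<and> \<bar>fst (P v) - fst (P (pa v))\<bar> \<le> radius (snd (P v)) (snd (P (pa v)))}"

definition block_event :: "real \<Rightarrow> real \<Rightarrow> nat \<Rightarrow> (nat \<Rightarrow> real \<times> real) set" where
  "block_event n L b = {P \<in> tree_event n. \<forall>i\<in>{1..m}. fst (P i) \<in> block n L b}"

lemma num_blocks_bounds:
  assumes "0 < L" "0 \<le> n"
  shows "real (num_blocks n L) * L \<le> n" "n - L < real (num_blocks n L) * L"
proof -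
  have "0 \<le> n / L" using assms by simp
  then have "real (num_blocks n L) = of_int \<lfloor>n / L\<rfloor>" by (simp add: num_blocks_def)
  then have "real (num_blocks n L) \<le> n / L" "n / L < real (num_blocks n L) + 1" by linarith+
  then show "real (num_blocks n L) * L \<le> n" "n - L < real (num_blocks n L) * L"
    using assms by (simp_all add: pos_le_divide_eq pos_divide_less_eq algebra_simps)
qed

lemma block_subset:
  assumes "0 < L" "0 \<le> n" "b < num_blocks n L"
  shows "block n L b \<subseteq> {- n / 2..<n / 2}"
proof -
  have "(real b + 1) * L \<le> real (num_blocks n L) * L" using assms by (intro mult_right_mono) auto
  then have "(real b + 1) * L \<le> n" using num_blocks_bounds(1)[OF assms(1,2)] by (rule order.trans)
  then have "- n / 2 + (real b + 1) * L \<le> n / 2" by linarith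
  moreover have "0 \<le> real b * L" using assms by simp
  ultimately show ?thesis by (auto simp: block_def)
qed

lemma block_disjoint:
  assumes "0 < L" "b \<noteq> c" shows "block n L b \<inter> block n L c = {}"
proof -
  have "real b + 1 \<le> real c \<or> real c + 1 \<le> real b" using assms(2) by linarith
  then have "(real b + 1) * L \<le> real c * L \<or> (real c + 1) * L \<le> real b * L"
    using assms by (auto intro: mult_right_mono)
  then show ?thesis by (auto simp: block_def)
qed

lemma slab_subset: "0 < L \<Longrightarrow> 0 \<le> n \<Longrightarrow> b < num_blocks n L \<Longrightarrow> slab n L b \<subseteq> marked_torus n"
  using block_subset[of L n b] by (auto simp: slab_def marked_torus_def)

lemma shift_in_iff: "shift n L b q \<in> marked_torus L \<longleftrightarrow> q \<in> slab n L b"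
  by (cases q) (auto simp: shift_def centre_def slab_def block_def marked_torus_def algebra_simps)

lemma inj_shift: "inj (shift n L b)"
  by (auto simp: shift_def inj_on_def)

lemma fst_snd_shift: "fst (shift n L b q) = fst q - centre n L b" "snd (shift n L b q) = snd q"
  by (simp_all add: shift_def)

lemma shift_preimage:
  assumes L: "0 < L" "0 \<le> n" "b < num_blocks n L" and A: "A \<in> sets (unit_intensity L)"
  shows "slab n L b \<inter> shift n L b -` A \<in> sets (unit_intensity n)"
    "measure (unit_intensity n) (slab n L b \<inter> shift n L b -` A) = measure (unit_intensity L) A"
proof -
  have A': "A \<in> sets borel" "A \<subseteq> marked_torus L" using A by (auto simp: sets_unit_intensity)
  have eq: "slab n L b \<inter> shift n L b -` A = (+) (- centre n L b, 0) -` A"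
  proof -
    have "slab n L b \<inter> shift n L b -` A = shift n L b -` A" using A'(2) shift_in_iff[of n L b] by blast
    moreover have "shift n L b = (+) (- centre n L b, 0)" by (rule ext) (simp add: shift_def)
    ultimately show ?thesis by simp
  qed
  have meas: "(+) (- centre n L b, 0 :: real) \<in> borel_measurable borel"
    by (intro borel_measurable_continuous_onI continuous_intros)
  have borel: "slab n L b \<inter> shift n L b -` A \<in> sets borel"
    unfolding eq using measurable_sets[OF meas A'(1)] by simp
  have sub: "slab n L b \<inter> shift n L b -` A \<subseteq> marked_torus n" using slab_subset[OF L] by auto
  show "slab n L b \<inter> shift n L b -` A \<in> sets (unit_intensity n)"
    using borel sub by (simp add: sets_unit_intensity)
  have "emeasure (unit_intensity n) (slab n L b \<inter> shift n L b -` A) = emeasure lborel ((+) (- centre n L b, 0) -` A)"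
    using emeasure_unit_intensity[OF borel sub] unfolding eq .
  also have "\<dots> = emeasure (distr lborel borel ((+) (- centre n L b, 0))) A"
    using meas A'(1) by (subst emeasure_distr) auto
  also have "\<dots> = emeasure lborel A" by (simp add: lborel_distr_plus)
  also have "\<dots> = emeasure (unit_intensity L) A" using emeasure_unit_intensity[OF A'] by simp
  finally show "measure (unit_intensity n) (slab n L b \<inter> shift n L b -` A) = measure (unit_intensity L) A"
    by (simp add: measure_def)
qed

lemma block_ppp:
  assumes L: "0 < L" "0 \<le> n" "b < num_blocks n L" and N: "poisson_point_process M (unit_intensity n) N"
  shows "poisson_point_process M (unit_intensity L) (\<lambda>\<omega>. shift n L b ` (N \<omega> \<inter> slab n L b))"
proof (rule poisson_point_process.image_ppp[OF N finite_measure_unit_intensity])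
  show "inj_on (shift n L b) (slab n L b)" by (rule inj_on_subset[OF inj_shift]) simp
  show "shift n L b ` slab n L b \<subseteq> space (unit_intensity L)" using shift_in_iff by auto
qed (use shift_preimage[OF L] in auto)

lemma wrap_dist_eq_abs:
  assumes "\<bar>x - y\<bar> \<le> n / 2" shows "wrap_dist n x y = \<bar>x - y\<bar>"
proof -
  have "\<bar>x - y\<bar> \<le> \<bar>x - y + n\<bar>" "\<bar>x - y\<bar> \<le> \<bar>x - y - n\<bar>" using assms by arith+
  then show ?thesis by (simp add: wrap_dist_def)
qed

text \<open>Translation matches the copies in the block with those near the origin;
  \<open>2 * L \<le> n\<close> ensures that wrapped and ordinary distances agree within a
  block.\<close>

lemma block_event_card:
  assumes L: "0 < L" "2 * L \<le> n" "b < num_blocks n L" and X: "X \<subseteq> marked_torus n"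
  shows "card (tuples {1..m} X \<inter> block_event n L b) =
    card (tuples {1..m} (shift n L b ` (X \<inter> slab n L b)) \<inter> plain_event L)"
proof -
  have n: "0 < n" using L by simp
  let ?g = "shift n L b"
  let ?h = "\<lambda>q. (centre n L b, 0) + q :: real \<times> real"
  have hg: "?h (?g q) = q" and gh: "?g (?h q) = q" for q
    by (simp_all add: shift_def add.assoc[symmetric] zero_prod_def[symmetric])
  have edge: "(snd (P (pa v)) < snd (P v) \<and> wrap_dist n (fst (P v)) (fst (P (pa v))) \<le> radius (snd (P v)) (snd (P (pa v))))
     \<longleftrightarrow> (snd (?g (P (pa v))) < snd (?g (P v)) \<and> \<bar>fst (?g (P v)) - fst (?g (P (pa v)))\<bar> \<le> radius (snd (?g (P v))) (snd (?g (P (pa v)))))"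
    if "v \<in> {1..m} - {r}" "\<And>i. i \<in> {1..m} \<Longrightarrow> fst (P i) \<in> block n L b" for P v
  proof -
    have "fst (P v) \<in> block n L b" "fst (P (pa v)) \<in> block n L b" using that pa_in[of v] by auto
    then have "\<bar>fst (P v) - fst (P (pa v))\<bar> \<le> L" by (auto simp: block_def algebra_simps abs_le_iff)
    then have "wrap_dist n (fst (P v)) (fst (P (pa v))) = \<bar>fst (P v) - fst (P (pa v))\<bar>"
      using L by (intro wrap_dist_eq_abs) simp
    then show ?thesis by (simp add: fst_snd_shift)
  qed
  have "bij_betw (\<lambda>P. \<lambda>i\<in>{1..m}. ?g (P i)) (tuples {1..m} X \<inter> block_event n L b)
      (tuples {1..m} (?g ` (X \<inter> slab n L b)) \<inter> plain_event L)"
  proof (rule bij_betw_byWitness[where f' = "\<lambda>Q. \<lambda>i\<in>{1..m}. ?h (Q i)"])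
    show "\<forall>P\<in>tuples {1..m} X \<inter> block_event n L b. (\<lambda>i\<in>{1..m}. ?h ((\<lambda>i\<in>{1..m}. ?g (P i)) i)) = P"
      by (auto simp: hg tuples_def PiE_iff extensional_def fun_eq_iff)
    show "\<forall>Q\<in>tuples {1..m} (?g ` (X \<inter> slab n L b)) \<inter> plain_event L. (\<lambda>i\<in>{1..m}. ?g ((\<lambda>i\<in>{1..m}. ?h (Q i)) i)) = Q"
      by (auto simp: gh tuples_def PiE_iff extensional_def fun_eq_iff)
    show "(\<lambda>P. \<lambda>i\<in>{1..m}. ?g (P i)) ` (tuples {1..m} X \<inter> block_event n L b) \<subseteq> tuples {1..m} (?g ` (X \<inter> slab n L b)) \<inter> plain_event L"
    proof (rule image_subsetI)
      fix P assume P: "P \<in> tuples {1..m} X \<inter> block_event n L b"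
      have PX: "P i \<in> X" and Pb: "fst (P i) \<in> block n L b" if "i \<in> {1..m}" for i
        using P that by (auto simp: tuples_def block_event_def)
      have Ps: "P i \<in> slab n L b" if "i \<in> {1..m}" for i
      proof -
        have "P i \<in> marked_torus n" using PX[OF that] X by auto
        then show ?thesis using Pb[OF that] by (auto simp: slab_def marked_torus_def mem_Times_iff)
      qed
      have "inj_on P {1..m}" using P by (auto simp: tuples_def)
      then have "inj_on (\<lambda>i. ?g (P i)) {1..m}"
        using comp_inj_on[of P "{1..m}" ?g] inj_on_subset[OF inj_shift[of n L b]] by (auto simp: comp_def)
      then have "(\<lambda>i\<in>{1..m}. ?g (P i)) \<in> tuples {1..m} (?g ` (X \<inter> slab n L b))"
        using PX Ps by (auto simp: tuples_def inj_on_restrict_eq)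
      moreover have "(\<lambda>i\<in>{1..m}. ?g (P i)) \<in> plain_event L"
        unfolding plain_event_def
      proof (intro CollectI conjI ballI)
        show "(\<lambda>i\<in>{1..m}. ?g (P i)) \<in> space (PiM {1..m} (\<lambda>_. unit_intensity L))"
          using Ps shift_in_iff by (auto simp: space_PiM)
        fix v assume v: "v \<in> {1..m} - {r}"
        have "P \<in> tree_event n" using P by (auto simp: block_event_def)
        then have "snd (P (pa v)) < snd (P v) \<and> wrap_dist n (fst (P v)) (fst (P (pa v))) \<le> radius (snd (P v)) (snd (P (pa v)))"
          using v unfolding tree_event_iff[OF n] by blast
        then have "snd (?g (P (pa v))) < snd (?g (P v)) \<and> \<bar>fst (?g (P v)) - fst (?g (P (pa v)))\<bar> \<le> radius (snd (?g (P v))) (snd (?g (P (pa v))))"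
          using edge[where P = P, OF v Pb] by blast
        then show "snd ((\<lambda>i\<in>{1..m}. ?g (P i)) (pa v)) < snd ((\<lambda>i\<in>{1..m}. ?g (P i)) v)"
          "\<bar>fst ((\<lambda>i\<in>{1..m}. ?g (P i)) v) - fst ((\<lambda>i\<in>{1..m}. ?g (P i)) (pa v))\<bar> \<le>
             radius (snd ((\<lambda>i\<in>{1..m}. ?g (P i)) v)) (snd ((\<lambda>i\<in>{1..m}. ?g (P i)) (pa v)))"
          using v pa_in[of v] by simp_all
      qed
      ultimately show "(\<lambda>i\<in>{1..m}. ?g (P i)) \<in> tuples {1..m} (?g ` (X \<inter> slab n L b)) \<inter> plain_event L" by blast
    qed
    show "(\<lambda>Q. \<lambda>i\<in>{1..m}. ?h (Q i)) ` (tuples {1..m} (?g ` (X \<inter> slab n L b)) \<inter> plain_event L) \<subseteq> tuples {1..m} X \<inter> block_event n L b"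
    proof (rule image_subsetI)
      fix Q assume Q: "Q \<in> tuples {1..m} (?g ` (X \<inter> slab n L b)) \<inter> plain_event L"
      let ?P = "\<lambda>i\<in>{1..m}. ?h (Q i)"
      have P: "?P i \<in> X" "?P i \<in> slab n L b" "?g (?P i) = Q i" if i: "i \<in> {1..m}" for i
      proof -
        have "Q i \<in> ?g ` (X \<inter> slab n L b)" using Q i by (auto simp: tuples_def)
        then obtain q where "q \<in> X \<inter> slab n L b" "Q i = ?g q" by blast
        then show "?P i \<in> X" "?P i \<in> slab n L b" "?g (?P i) = Q i" using i by (simp_all add: hg)
      qed
      have "inj_on Q {1..m}" using Q by (auto simp: tuples_def)
      moreover have "inj_on ?h S" for S by (rule inj_on_inverseI[of _ ?g]) (rule gh)
      ultimately have "inj_on (?h \<circ> Q) {1..m}" by (rule comp_inj_on)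
      then have "inj_on ?P {1..m}" by (simp only: inj_on_restrict_eq comp_def)
      moreover have "?h (Q i) \<in> X" if "i \<in> {1..m}" for i using P(1)[OF that] that by simp
      then have "?P \<in> {1..m} \<rightarrow>\<^sub>E X" by (intro restrict_PiE_iff[THEN iffD2] ballI)
      ultimately have "?P \<in> tuples {1..m} X" unfolding tuples_def by blast
      moreover have "?P \<in> block_event n L b"
      proof -
        have b: "fst (?P i) \<in> block n L b" if "i \<in> {1..m}" for i
          using P(2)[OF that] by (auto simp: slab_def mem_Times_iff)
        have "?P \<in> tree_event n"
          unfolding tree_event_iff[OF n]
        proof (rule conjI)
          have "?P i \<in> marked_torus n" if "i \<in> {1..m}" for i using P(1)[OF that] X by blast
          then show "?P \<in> space (PiM {1..m} (\<lambda>_. unit_intensity n))"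
            unfolding space_PiM by (intro restrict_PiE_iff[THEN iffD2] ballI) simp
          show "\<forall>v\<in>{1..m} - {r}. snd (?P (pa v)) < snd (?P v) \<and>
              wrap_dist n (fst (?P v)) (fst (?P (pa v))) \<le> radius (snd (?P v)) (snd (?P (pa v)))"
          proof
            fix v assume v: "v \<in> {1..m} - {r}"
            have "snd (Q (pa v)) < snd (Q v) \<and> \<bar>fst (Q v) - fst (Q (pa v))\<bar> \<le> radius (snd (Q v)) (snd (Q (pa v)))"
              using Q v by (auto simp: plain_event_def)
            then show "snd (?P (pa v)) < snd (?P v) \<and>
              wrap_dist n (fst (?P v)) (fst (?P (pa v))) \<le> radius (snd (?P v)) (snd (?P (pa v)))"
              using edge[where P = ?P, OF v b] P(3)[of v] P(3)[of "pa v"] v pa_in[of v] by simp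
          qed
        qed
        then show ?thesis using b unfolding block_event_def by blast
      qed
      ultimately show "?P \<in> tuples {1..m} X \<inter> block_event n L b" by blast
    qed
  qed
  then show ?thesis by (rule bij_betw_same_card)
qed

lemma plain_event_measurable: "plain_event L \<in> sets (PiM {1..m} (\<lambda>_. unit_intensity L))"
proof -
  let ?P = "PiM {1..m} (\<lambda>_. unit_intensity L)"
  have coord: "(\<lambda>P. fst (P v)) \<in> borel_measurable ?P" "(\<lambda>P. snd (P v)) \<in> borel_measurable ?P" if "v \<in> {1..m}" for v
    using measurable_compose[OF measurable_component_singleton[OF that, of "\<lambda>_. unit_intensity L"]] fst_snd_measurable
    by blast+
  show ?thesis
    unfolding plain_event_def
  proof (intro sets.sets_Collect_finite_All)
    fix v assume "v \<in> {1..m} - {r}"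
    then have v: "v \<in> {1..m}" "pa v \<in> {1..m}" using pa_in by auto
    show "{P \<in> space ?P. snd (P (pa v)) < snd (P v) \<and> \<bar>fst (P v) - fst (P (pa v))\<bar> \<le> radius (snd (P v)) (snd (P (pa v)))} \<in> sets ?P"
      by (intro sets.sets_Collect_conj borel_measurable_less borel_measurable_le borel_measurable_abs
          borel_measurable_diff radius_measurable coord v)
  qed simp
qed

definition plain_count :: "real \<Rightarrow> (real \<times> real) set \<Rightarrow> real" where
  "plain_count L X = real (card (tuples {1..m} X \<inter> plain_event L))"

lemma plain_count_measurable:
  assumes "poisson_point_process M (unit_intensity L) N"
  shows "plain_count L \<in> borel_measurable (conf (unit_intensity L))"
proof -
  interpret poisson_point_process M "unit_intensity L" N by fact
  interpret Q: separated_ppp "distr M (conf (unit_intensity L)) N" "unit_intensity L" "\<lambda>X. X" dyadic_cell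
    by (rule separated_ppp_unit[OF canonical_ppp])
  show ?thesis
    using Q.tuple_moments(1)[OF plain_event_measurable] by (simp add: plain_count_def[abs_def])
qed

lemma radius_le:
  assumes "0 < \<kappa>" "\<kappa> \<le> u" "\<kappa> \<le> w" shows "radius u w \<le> \<beta> / \<kappa>"
proof -
  have "min u w powr (- \<gamma>) \<le> \<kappa> powr (- \<gamma>)" "max u w powr (\<gamma> - 1) \<le> \<kappa> powr (\<gamma> - 1)"
    using assms \<gamma> \<gamma>_less by (auto intro!: powr_mono2')
  then have "min u w powr (- \<gamma>) * max u w powr (\<gamma> - 1) \<le> \<kappa> powr (- \<gamma>) * \<kappa> powr (\<gamma> - 1)"
    by (intro mult_mono) auto
  also have "\<dots> = \<kappa> powr (- \<gamma> + (\<gamma> - 1))" by (rule powr_add[symmetric])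
  also have "\<dots> = 1 / \<kappa>" using assms by (simp add: powr_minus_divide)
  finally have "\<beta> * (min u w powr (- \<gamma>) * max u w powr (\<gamma> - 1)) \<le> \<beta> * (1 / \<kappa>)"
    using \<beta> by (intro mult_left_mono) auto
  then show ?thesis by (simp add: radius_def mult.assoc)
qed

text \<open>
  If the mark of the root exceeds \<open>\<kappa>\<close> then all edges are shorter than \<open>\<beta> / \<kappa>\<close>.
\<close>

lemma tree_in_block:
  assumes n: "0 < L" "0 < n" "b < num_blocks n L" and P: "P \<in> tree_event n"
    and \<kappa>: "0 < \<kappa>" "\<kappa> < snd (P r)" and R: "R = m * (\<beta> / \<kappa>)"
    and root: "- n / 2 + real b * L + R \<le> fst (P r)" "fst (P r) < - n / 2 + (real b + 1) * L - R"
  shows "P \<in> block_event n L b"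
proof -
  let ?h = "\<beta> / \<kappa>"
  let ?s = "- n / 2 + real b * L" and ?e = "- n / 2 + (real b + 1) * L"
  have h: "0 < ?h" using \<beta> \<kappa> by simp
  have se: "{?s..<?e} \<subseteq> {- n / 2..<n / 2}" using block_subset[of L n b] n by (simp add: block_def)
  have edge: "snd (P (pa v)) < snd (P v)" "wrap_dist n (fst (P v)) (fst (P (pa v))) \<le> radius (snd (P v)) (snd (P (pa v)))"
    if "v \<in> {1..m} - {r}" for v
    using P that unfolding tree_event_iff[OF n(2)] by blast+
  have tor: "fst (P v) \<in> {- n / 2..<n / 2}" if "v \<in> {1..m}" for v
  proof -
    have "P v \<in> marked_torus n" using P that by (auto simp: tree_event_def space_PiM PiE_iff)
    then show ?thesis by (auto simp: marked_torus_def)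
  qed
  have mark: "\<kappa> \<le> snd (P v)" if "v \<in> {1..m}" for v
    using root_le[of "\<lambda>v. snd (P v)" v] edge(1) that \<kappa> by force
  have claim: "?s + R - real (dep v) * ?h \<le> fst (P v) \<and> fst (P v) < ?e - R + real (dep v) * ?h" if "v \<in> {1..m}" for v
    using that
  proof (induction "dep v" arbitrary: v)
    case 0
    then have "v = r" using dep_pa[of v] by (cases "v = r") auto
    then show ?case using root dep_root by simp
  next
    case (Suc d)
    then have vr: "v \<in> {1..m} - {r}" using dep_root by auto
    then have pv: "pa v \<in> {1..m}" "dep v = Suc (dep (pa v))" using pa_in dep_pa by auto
    have d: "real (dep v) * ?h = real (dep (pa v)) * ?h + ?h" using pv(2) by (simp add: algebra_simps)
    have "real (dep v) * ?h \<le> m * ?h"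
      using dep_less[OF Suc(3)] h by (intro mult_right_mono) auto
    then have dR: "real (dep v) * ?h \<le> R" using R by simp
    have IH: "?s + R - real (dep (pa v)) * ?h \<le> fst (P (pa v))" "fst (P (pa v)) < ?e - R + real (dep (pa v)) * ?h"
      using Suc(1)[of "pa v"] Suc(2) pv by auto
    have "wrap_dist n (fst (P v)) (fst (P (pa v))) \<le> ?h"
      using edge(2)[OF vr] radius_le[OF \<kappa>(1) mark[OF Suc(3)] mark[OF pv(1)]] by linarith
    then consider "\<bar>fst (P v) - fst (P (pa v))\<bar> \<le> ?h" | "\<bar>fst (P v) - fst (P (pa v)) + n\<bar> \<le> ?h"
      | "\<bar>fst (P v) - fst (P (pa v)) - n\<bar> \<le> ?h" unfolding wrap_dist_def by linarith
    then show ?case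
    \<comment> \<open>In the two wrapped cases \<open>fst (P v)\<close> plus or minus
      \<open>n\<close> would lie within the range of the block, forcing \<open>fst (P v)\<close> out
      of the fundamental domain.\<close>
    proof cases
      case 1
      then show ?thesis using IH d by (auto simp: abs_le_iff)
    next
      case 2
      then have "?s \<le> fst (P v) + n" "fst (P v) + n \<le> ?e" using IH d dR by (auto simp: abs_le_iff)
      moreover have "?e \<le> n / 2"
      proof -
        have "(real b + 1) * L \<le> real (num_blocks n L) * L" using n by (intro mult_right_mono) auto
        then show ?thesis using num_blocks_bounds(1)[of L n] n by linarith
      qed
      moreover have "fst (P v) + n < ?e"
      proof -
        have "fst (P v) + n \<le> fst (P (pa v)) + ?h" using 2 by (auto simp: abs_le_iff)
        then show ?thesis using IH d dR by linarith
      qed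
      ultimately show ?thesis using tor[OF Suc(3)] by auto
    next
      case 3
      then have "?s \<le> fst (P v) - n" using IH d dR by (auto simp: abs_le_iff)
      moreover have "- n / 2 \<le> ?s" using n by simp
      ultimately show ?thesis using tor[OF Suc(3)] by auto
    qed
  qed
  have "fst (P v) \<in> block n L b" if v: "v \<in> {1..m}" for v
  proof -
    have "real (dep v) * ?h \<le> m * ?h" using dep_less[OF v] h by (intro mult_right_mono) auto
    then show ?thesis using claim[OF v] R by (auto simp: block_def)
  qed
  then show ?thesis using P by (simp add: block_event_def)
qed

lemma block_event_measurable:
  assumes "0 < n" shows "block_event n L b \<in> sets (PiM {1..m} (\<lambda>_. unit_intensity n))"
proof -
  let ?P = "PiM {1..m} (\<lambda>_. unit_intensity n)"
  have "{P \<in> space ?P. \<forall>i\<in>{1..m}. fst (P i) \<in> block n L b} \<in> sets ?P"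
  proof (rule sets.sets_Collect_finite_All)
    fix i assume "i \<in> {1..m}"
    then have "(\<lambda>P. fst (P i)) \<in> borel_measurable ?P"
      using measurable_compose[OF measurable_component_singleton[of i "{1..m}" "\<lambda>_. unit_intensity n"]]
        fst_snd_measurable(1) by blast
    from measurable_sets[OF this, of "block n L b"]
    show "{P \<in> space ?P. fst (P i) \<in> block n L b} \<in> sets ?P"
      by (simp add: block_def vimage_def Int_def conj_commute)
  qed simp
  moreover have "block_event n L b = tree_event n \<inter> {P \<in> space ?P. \<forall>i\<in>{1..m}. fst (P i) \<in> block n L b}"
    by (auto simp: block_event_def tree_event_def)
  ultimately show ?thesis using tree_event_measurable[OF assms] by simp
qed

definition remainder_event :: "real \<Rightarrow> real \<Rightarrow> (nat \<Rightarrow> real \<times> real) set" where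
  "remainder_event n L = tree_event n - (\<Union>b<num_blocks n L. block_event n L b)"

text \<open>By \<open>tree_in_block\<close>, a copy in no block has a root of mark at most \<kappa>,
  or a root within \<open>R\<close> of an end of its block, or a root in the leftover piece. The
  leftover is shorter than \<open>L\<close>, and at most \<open>n / L\<close> blocks have margins of
  total length \<open>2 * R\<close> each.\<close>

lemma remainder_variance_le:
  assumes N: "poisson_point_process M (unit_intensity n) N"
    and \<kappa>: "0 < \<kappa>" and R: "R = m * (\<beta> / \<kappa>)" and L: "2 * R \<le> L" "L \<le> n"
  shows "prob_space.variance M (\<lambda>\<omega>. real (card (tuples {1..m} (N \<omega>) \<inter> remainder_event n L)))
    \<le> var_const * ((L + 2 * R * n / L) + \<kappa> powr \<delta> * n)"
proof -
  let ?K = "num_blocks n L"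
  have R0: "0 < R" using \<beta> \<kappa> m_pos unfolding R by simp
  have L0: "0 < L" and n: "0 < n" using R0 L by auto
  let ?C = "\<lambda>b. {- n / 2 + real b * L + R ..< - n / 2 + (real b + 1) * L - R}"
  define D where "D = {- n / 2..<n / 2} - (\<Union>b<?K. ?C b)"
  have CB: "?C b \<subseteq> block n L b" for b using R0 by (auto simp: block_def)
  have sub: "(\<Union>b<?K. ?C b) \<subseteq> {- n / 2..<n / 2}"
    using block_subset[of L n] CB L0 n by fastforce
  have disj: "disjoint_family_on ?C {..<?K}"
    unfolding disjoint_family_on_def using block_disjoint[OF L0, of _ _ n] CB by blast
  have "emeasure lborel (\<Union>b<?K. ?C b) = (\<Sum>b<?K. emeasure lborel (?C b))"
    by (rule sum_emeasure[symmetric]) (use disj in auto)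
  also have "\<dots> = (\<Sum>b<?K. ennreal (L - 2 * R))"
    using L by (intro sum.cong refl) (simp add: algebra_simps)
  also have "\<dots> = ennreal (real ?K * (L - 2 * R))"
    using L by (simp add: ennreal_mult ennreal_of_nat_eq_real_of_nat)
  finally have eC: "emeasure lborel (\<Union>b<?K. ?C b) = ennreal (real ?K * (L - 2 * R))" .
  have "emeasure lborel D = emeasure lborel {- n / 2..<n / 2} - emeasure lborel (\<Union>b<?K. ?C b)"
    unfolding D_def using sub eC by (intro emeasure_Diff) auto
  also have "\<dots> = ennreal (n - real ?K * (L - 2 * R))"
    using L n by (subst eC) (simp add: ennreal_minus)
  also have "\<dots> \<le> ennreal (L + 2 * R * n / L)"
  proof (rule ennreal_leI)
    have "n / L - 1 \<le> real ?K"
      using num_blocks_bounds(2)[of L n] L0 n by (simp add: field_simps)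
    then have "(n / L - 1) * (L - 2 * R) \<le> real ?K * (L - 2 * R)" using L by (intro mult_right_mono) auto
    moreover have "(n / L - 1) * (L - 2 * R) = n - 2 * R * n / L - L + 2 * R"
      using L0 by (simp add: field_simps)
    ultimately show "n - real ?K * (L - 2 * R) \<le> L + 2 * R * n / L" using R0 by linarith
  qed
  finally have eD: "emeasure lborel D \<le> ennreal (L + 2 * R * n / L)" .
  show ?thesis
  proof (rule variance_part_le[OF n N _ _ _ eD _ \<kappa>])
    show "remainder_event n L \<in> sets (PiM {1..m} (\<lambda>_. unit_intensity n))"
      unfolding remainder_event_def
      by (intro sets.Diff sets.finite_UN tree_event_measurable block_event_measurable n) simp
    show "remainder_event n L \<subseteq> tree_event n" by (auto simp: remainder_event_def)
    show "D \<in> sets borel" unfolding D_def by auto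
    show "0 \<le> L + 2 * R * n / L" using L0 R0 n by simp
    fix P assume P: "P \<in> remainder_event n L"
    show "fst (P r) \<in> D \<or> snd (P r) \<le> \<kappa>"
    proof (rule ccontr)
      assume neg: "\<not> (fst (P r) \<in> D \<or> snd (P r) \<le> \<kappa>)"
      have "P r \<in> marked_torus n" using P root_in by (auto simp: remainder_event_def tree_event_def space_PiM PiE_iff)
      then have "fst (P r) \<in> {- n / 2..<n / 2}" by (auto simp: marked_torus_def)
      then obtain b where b: "b < ?K" "fst (P r) \<in> ?C b" using neg unfolding D_def by blast
      have "P \<in> block_event n L b"
        by (rule tree_in_block[OF L0 n b(1) _ \<kappa> _ R]) (use P neg b in \<open>auto simp: remainder_event_def\<close>)
      then show False using P b(1) by (auto simp: remainder_event_def)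
    qed
  qed
qed

definition block_count :: "real \<Rightarrow> real \<Rightarrow> nat \<Rightarrow> (real \<times> real) set \<Rightarrow> real" where
  "block_count n L b X = plain_count L (shift n L b ` (X \<inter> slab n L b))"

lemma tree_event_card_split:
  assumes L: "0 < L" "2 * L \<le> n" and X: "finite X" "X \<subseteq> marked_torus n"
  shows "real (card (tuples {1..m} X \<inter> tree_event n)) =
    (\<Sum>b<num_blocks n L. block_count n L b X) + real (card (tuples {1..m} X \<inter> remainder_event n L))"
proof -
  let ?K = "num_blocks n L"
  let ?B = "\<Union>b<?K. tuples {1..m} X \<inter> block_event n L b"
  have fin: "finite (tuples {1..m} X)" using X by (intro finite_tuples) auto
  have eq: "tuples {1..m} X \<inter> tree_event n = ?B \<union> (tuples {1..m} X \<inter> remainder_event n L)"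
    by (auto simp: remainder_event_def block_event_def)
  have "card (tuples {1..m} X \<inter> tree_event n) = card ?B + card (tuples {1..m} X \<inter> remainder_event n L)"
    unfolding eq using fin by (intro card_Un_disjoint) (auto simp: remainder_event_def)
  moreover have "card ?B = (\<Sum>b<?K. card (tuples {1..m} X \<inter> block_event n L b))"
  proof (rule card_UN_disjoint)
    have "block_event n L b \<inter> block_event n L c = {}" if "b \<noteq> c" for b c
      using block_disjoint[OF L(1) that, of n] root_in unfolding block_event_def by blast
    then show "\<forall>b\<in>{..<?K}. \<forall>c\<in>{..<?K}. b \<noteq> c \<longrightarrow>
      (tuples {1..m} X \<inter> block_event n L b) \<inter> (tuples {1..m} X \<inter> block_event n L c) = {}" by blast
  qed (use fin in auto)
  moreover have "(\<Sum>b<?K. real (card (tuples {1..m} X \<inter> block_event n L b))) = (\<Sum>b<?K. block_count n L b X)"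
    using block_event_card[OF L _ X(2)] by (intro sum.cong refl) (simp add: block_count_def plain_count_def)
  ultimately show ?thesis by simp
qed

lemma block_count_properties:
  assumes L: "0 < L" "0 \<le> n" and N: "poisson_point_process M (unit_intensity n) N"
  shows "b < num_blocks n L \<Longrightarrow> (\<lambda>\<omega>. block_count n L b (N \<omega>)) \<in> borel_measurable M"
    "b < num_blocks n L \<Longrightarrow> integrable M (\<lambda>\<omega>. (block_count n L b (N \<omega>))\<^sup>2)"
    "prob_space.indep_vars M (\<lambda>_. borel) (\<lambda>b \<omega>. block_count n L b (N \<omega>)) {..<num_blocks n L}"
proof -
  let ?Y = "\<lambda>b \<omega>. shift n L b ` (N \<omega> \<inter> slab n L b)"
  interpret poisson_point_process M "unit_intensity n" N by fact
  show 1: "(\<lambda>\<omega>. block_count n L b (N \<omega>)) \<in> borel_measurable M"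
    "integrable M (\<lambda>\<omega>. (block_count n L b (N \<omega>))\<^sup>2)" if b: "b < num_blocks n L" for b
  proof -
    interpret B: separated_ppp M "unit_intensity L" "?Y b" dyadic_cell
      by (rule separated_ppp_unit[OF block_ppp[OF L b N]])
    show "(\<lambda>\<omega>. block_count n L b (N \<omega>)) \<in> borel_measurable M"
      "integrable M (\<lambda>\<omega>. (block_count n L b (N \<omega>))\<^sup>2)"
      using B.tuple_moments(1,3)[OF plain_event_measurable] by (simp_all add: block_count_def plain_count_def)
  qed
  have "indep_vars (\<lambda>_. conf (unit_intensity L)) ?Y {..<num_blocks n L}"
  proof (rule indep_blocks[where D = "slab n L" and \<Phi> = "\<lambda>b A. slab n L b \<inter> shift n L b -` A"])
    fix b assume b: "b \<in> {..<num_blocks n L}"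
    then show "?Y b \<in> measurable M (conf (unit_intensity L))"
      using poisson_point_process.N_measurable[OF block_ppp[OF L _ N]] by simp
    show "slab n L b \<inter> shift n L b -` A \<in> sets (unit_intensity n) \<and> slab n L b \<inter> shift n L b -` A \<subseteq> slab n L b"
      if "A \<in> sets (unit_intensity L)" for A
      using shift_preimage(1)[OF L _ that] b by auto
    show "card (?Y b \<omega> \<inter> A) = count (slab n L b \<inter> shift n L b -` A) \<omega>" for \<omega> A
      by (rule card_image_count[OF inj_on_subset[OF inj_shift]]) simp
  next
    have "slab n L b \<inter> slab n L c = {}" if "b \<noteq> c" for b c
      using block_disjoint[OF L(1) that, of n] by (auto simp: slab_def)
    then show "disjoint_family_on (slab n L) {..<num_blocks n L}" by (auto simp: disjoint_family_on_def)
  qed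
  then show "indep_vars (\<lambda>_. borel) (\<lambda>b \<omega>. block_count n L b (N \<omega>)) {..<num_blocks n L}"
  \<comment> \<open>Measurability of \<open>plain_count L\<close> is taken from the process in block
    0, so the case without blocks is treated separately.\<close>
  proof (cases "num_blocks n L = 0")
    case True
    then show ?thesis by (simp add: indep_vars_def indep_sets_def)
  next
    case False
    then have "plain_count L \<in> borel_measurable (conf (unit_intensity L))"
      using plain_count_measurable[OF block_ppp[OF L _ N, of 0]] by simp
    then show ?thesis
      using indep_vars_compose2[OF \<open>indep_vars (\<lambda>_. conf (unit_intensity L)) ?Y {..<num_blocks n L}\<close>, of "\<lambda>_. plain_count L" "\<lambda>_. borel"]
      unfolding block_count_def by simp
  qed
qed

text \<open>Both blocks carry, after translation, Poisson processes with the same intensity, and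
  these have the same law on configurations even if they are defined on different spaces.\<close>

lemma block_count_law:
  assumes "0 < L" "0 \<le> n" "b < num_blocks n L" "poisson_point_process M (unit_intensity n) N"
    and "0 \<le> n'" "b' < num_blocks n' L" "poisson_point_process M' (unit_intensity n') N'"
  shows "distr M borel (\<lambda>\<omega>. block_count n L b (N \<omega>)) = distr M' borel (\<lambda>\<omega>. block_count n' L b' (N' \<omega>))"
proof -
  note A = block_ppp[OF assms(1-4)] and B = block_ppp[OF assms(1,5-7)]
  note f = plain_count_measurable[OF A]
  show ?thesis
    using arg_cong[OF poisson_point_process_unique[OF A B], of "\<lambda>Q. distr Q borel (plain_count L)"]
    using distr_distr[OF f poisson_point_process.N_measurable[OF A]] distr_distr[OF f poisson_point_process.N_measurable[OF B]]
    by (simp add: comp_def block_count_def)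
qed

text \<open>One law \<rho> describes every block for every \<open>k\<close>, so the characteristic
  function of the normalised sum is the term of index \<open>num_blocks (n k) L\<close> in the fixed
  sequence of \<open>iid_char_limit\<close>, and this index tends to infinity.\<close>

lemma char_block_sum_limit:
  fixes n :: "nat \<Rightarrow> real" and M :: "nat \<Rightarrow> 'w measure"
  assumes L: "0 < L" and N: "\<And>k. poisson_point_process (M k) (unit_intensity (n k)) (N k)"
    and n: "\<And>k. 1 \<le> n k" "filterlim n at_top sequentially"
  defines "S \<equiv> \<lambda>k \<omega>. \<Sum>b<num_blocks (n k) L. block_count (n k) L b (N k \<omega>)"
  assumes pos: "eventually (\<lambda>k. 0 < prob_space.variance (M k) (S k)) sequentially"
  shows "(\<lambda>k. char (distr (M k) borel
      (\<lambda>\<omega>. (S k \<omega> - prob_space.expectation (M k) (S k)) / sqrt (prob_space.variance (M k) (S k)))) t)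
    \<longlonglongrightarrow> char std_normal_distribution t"
proof -
  let ?K = "\<lambda>k. num_blocks (n k) L"
  have n0: "0 \<le> n k" for k using n(1)[of k] by simp
  have K_lim: "filterlim ?K at_top sequentially"
  proof -
    have "eventually (\<lambda>k. Z \<le> ?K k) sequentially" for Z
    proof -
      have "eventually (\<lambda>k. (real Z + 1) * L \<le> n k) sequentially"
        using n(2) by (simp add: filterlim_at_top)
      then show ?thesis
      proof eventually_elim
        case (elim k)
        then have "real Z * L < real (?K k) * L"
          using num_blocks_bounds(2)[OF L n0[of k]] by (simp add: algebra_simps)
        then show ?case using L by simp
      qed
    qed
    then show ?thesis by (simp add: filterlim_at_top)
  qed
  have "eventually (\<lambda>k. 1 \<le> ?K k) sequentially" using K_lim by (simp add: filterlim_at_top)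
  with pos have "eventually (\<lambda>k. 0 < prob_space.variance (M k) (S k) \<and> 1 \<le> ?K k) sequentially"
    by eventually_elim simp
  \<comment> \<open>An index with at least one block, to define the common law, and with positive
    variance, to make that law nondegenerate.\<close>
  then obtain k0 where k0: "0 < prob_space.variance (M k0) (S k0)" "0 < ?K k0"
    by (auto simp: eventually_sequentially Suc_le_eq)
  define \<rho> where "\<rho> = distr (M k0) borel (\<lambda>\<omega>. block_count (n k0) L 0 (N k0 \<omega>))"
  define e where "e = (\<integral>x. x \<partial>\<rho>)"
  define \<sigma>2 where "\<sigma>2 = (\<integral>x. (x - e)\<^sup>2 \<partial>\<rho>)"
  define \<mu> where "\<mu> = distr \<rho> borel (\<lambda>x. x - e)"
  have law: "distr (M k) borel (\<lambda>\<omega>. block_count (n k) L b (N k \<omega>)) = \<rho>" if "b < ?K k" for k b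
    unfolding \<rho>_def by (rule block_count_law[OF L n0 that N n0 k0(2) N])
  have \<rho>: "real_distribution \<rho>"
  proof -
    interpret P: poisson_point_process "M k0" "unit_intensity (n k0)" "N k0" by (rule N)
    show ?thesis unfolding \<rho>_def
      by (intro P.real_distribution_distr block_count_properties(1)[OF L n0 N k0(2)])
  qed
  interpret \<rho>: real_distribution \<rho> by fact
  have \<rho>2: "integrable \<rho> (\<lambda>x. x\<^sup>2)"
    unfolding \<rho>_def using block_count_properties(1,2)[OF L n0 N k0(2)]
    by (subst integrable_distr_eq) auto
  have \<rho>1: "integrable \<rho> (\<lambda>x. x)" by (rule \<rho>.square_integrable_imp_integrable[OF _ \<rho>2]) simp
  have \<rho>c: "integrable \<rho> (\<lambda>x. (x - e)\<^sup>2)" using \<rho>1 \<rho>2 by (simp add: power2_diff)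
  have \<mu>: "real_distribution \<mu>" unfolding \<mu>_def by (rule \<rho>.real_distribution_distr) simp
  have moments: "prob_space.expectation (M k) (S k) = ?K k * e"
    "prob_space.variance (M k) (S k) = ?K k * \<sigma>2"
    "char (distr (M k) borel (\<lambda>\<omega>. (S k \<omega> - ?K k * e) / c)) s = char \<mu> (s / c) ^ ?K k" for k c s
  proof -
    interpret P: poisson_point_process "M k" "unit_intensity (n k)" "N k" by (rule N)
    let ?X = "\<lambda>b \<omega>. block_count (n k) L b (N k \<omega>)"
    note blk = block_count_properties[OF L n0[of k] N[of k]]
    have Xm: "?X b \<in> borel_measurable (M k)" if "b < ?K k" for b using blk(1)[OF that] .
    have tr: "P.expectation (\<lambda>\<omega>. f (?X b \<omega>)) = (\<integral>x. f x \<partial>\<rho>)"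
      "integrable (M k) (\<lambda>\<omega>. f (?X b \<omega>)) \<longleftrightarrow> integrable \<rho> f"
      if "b < ?K k" "f \<in> borel_measurable borel" for f :: "real \<Rightarrow> real" and b
      using integral_distr[OF Xm[OF that(1)] that(2)] integrable_distr_eq[OF Xm[OF that(1)] that(2)]
      unfolding law[OF that(1)] by simp_all
    have X1: "integrable (M k) (?X b)" "P.expectation (?X b) = e" if "b < ?K k" for b
      
    proof -
      have f: "(\<lambda>x. x) \<in> borel_measurable (borel :: real measure)" by simp
      show "integrable (M k) (?X b)" "P.expectation (?X b) = e"
        using tr[OF that f] \<rho>1 unfolding e_def by blast+
    qed
    show ES: "P.expectation (S k) = ?K k * e"
      unfolding S_def using X1 by simp
    let ?Z = "\<lambda>b \<omega>. ?X b \<omega> - e"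
    have Zi: "P.indep_vars (\<lambda>_. borel) ?Z {..<?K k}"
      by (rule P.indep_vars_compose2[OF blk(3)]) simp
    have Z2: "integrable (M k) (\<lambda>\<omega>. (?Z b \<omega>)\<^sup>2)" "P.expectation (\<lambda>\<omega>. (?Z b \<omega>)\<^sup>2) = \<sigma>2" if "b < ?K k" for b
      
    proof -
      have f: "(\<lambda>x. (x - e)\<^sup>2) \<in> borel_measurable (borel :: real measure)" by simp
      show "integrable (M k) (\<lambda>\<omega>. (?Z b \<omega>)\<^sup>2)" "P.expectation (\<lambda>\<omega>. (?Z b \<omega>)\<^sup>2) = \<sigma>2"
        using tr[OF that f] \<rho>c unfolding \<sigma>2_def by blast+
    qed
    have Z0: "P.expectation (?Z b) = 0" if "b < ?K k" for b
      using X1[OF that] by (simp add: P.prob_space)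
    have SZ: "S k \<omega> - ?K k * e = (\<Sum>b<?K k. ?Z b \<omega>)" for \<omega>
      by (simp add: S_def sum_subtractf)
    have "P.expectation (\<lambda>\<omega>. (\<Sum>b<?K k. ?Z b \<omega>)\<^sup>2) = (\<Sum>b<?K k. P.expectation (\<lambda>\<omega>. (?Z b \<omega>)\<^sup>2))"
      using P.indep_centered_sum[OF finite_lessThan Zi] Z2(1) Z0 by blast
    also have "\<dots> = ?K k * \<sigma>2" using Z2(2) by simp
    finally show "P.variance (S k) = ?K k * \<sigma>2" unfolding ES SZ .
    have Zl: "distr (M k) borel (?Z b) = \<mu>" if "b < ?K k" for b
      unfolding \<mu>_def law[OF that, symmetric]
      by (subst distr_distr[OF _ Xm[OF that]]) (simp_all add: comp_def)
    show "char (distr (M k) borel (\<lambda>\<omega>. (S k \<omega> - ?K k * e) / c)) s = char \<mu> (s / c) ^ ?K k"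
      unfolding SZ by (rule P.char_distr_scaled_sum[OF Zi Zl])
  qed
  have "0 < \<sigma>2" using k0 moments(2)[of k0] by (simp add: zero_less_mult_iff)
  define \<sigma> where "\<sigma> = sqrt \<sigma>2"
  have \<sigma>: "0 < \<sigma>" "\<sigma>\<^sup>2 = \<sigma>2" using \<open>0 < \<sigma>2\<close> by (simp_all add: \<sigma>_def)
  have "(\<lambda>j. char \<mu> (t / sqrt (real j * \<sigma>\<^sup>2)) ^ j) \<longlonglongrightarrow> char std_normal_distribution t"
  proof (rule iid_char_limit[OF \<mu>])
    show "integrable \<mu> (\<lambda>x. x\<^sup>2)" 
      unfolding \<mu>_def by (subst integrable_distr_eq) (simp_all add: \<rho>c)
    show "(\<integral>x. x \<partial>\<mu>) = 0" 
    proof -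
      have "(\<integral>x. x \<partial>\<mu>) = (\<integral>x. x - e \<partial>\<rho>)" unfolding \<mu>_def by (rule integral_distr) simp_all
      also have "\<dots> = (\<integral>x. x \<partial>\<rho>) - (\<integral>x. e \<partial>\<rho>)"
        by (rule Bochner_Integration.integral_diff[OF \<rho>1]) simp
      also have "\<dots> = 0" using \<rho>.prob_space by (simp add: e_def[symmetric])
      finally show ?thesis .
    qed
    show "(\<integral>x. x\<^sup>2 \<partial>\<mu>) = \<sigma>\<^sup>2" 
      unfolding \<mu>_def \<sigma>(2) \<sigma>2_def by (rule integral_distr) simp_all
  qed (rule \<sigma>)
  from filterlim_compose[OF this K_lim] show ?thesis
    unfolding moments(2) unfolding moments(1) unfolding moments(3) \<sigma>(2)[symmetric] .
qed

section \<open>The central limit theorem\<close>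

text \<open>The error of replacing the count by the block sum is small relative to the variance,
  uniformly in large \<open>k\<close>, once \<open>L\<close> is fixed. So \<open>L\<close> is chosen
  first from the tolerance, and the limit of the block sums is taken afterwards.\<close>

lemma char_tree_count_limit:
  fixes n :: "nat \<Rightarrow> real" and M :: "nat \<Rightarrow> 'w measure" and t :: real
  assumes N: "\<And>k. poisson_point_process (M k) (unit_intensity (n k)) (N k)"
    and n: "\<And>k. 1 \<le> n k" "filterlim n at_top sequentially"
  defines "T \<equiv> \<lambda>k \<omega>. real (card (tuples {1..m} (N k \<omega>) \<inter> tree_event (n k)))"
  defines "\<phi> \<equiv> \<lambda>k. char (distr (M k) borel
      (\<lambda>\<omega>. (T k \<omega> - prob_space.expectation (M k) (T k)) / sqrt (prob_space.variance (M k) (T k)))) t"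
  shows "\<phi> \<longlonglongrightarrow> char std_normal_distribution t"
proof (rule tendstoI)
  fix \<eta> :: real assume \<eta>: "0 < \<eta>"
  define \<epsilon> where "\<epsilon> = min 1 (\<eta> / (2 * (\<bar>t\<bar> + 1)))"
  have \<epsilon>: "0 < \<epsilon>" "\<epsilon> \<le> 1" using \<eta> by (simp_all add: \<epsilon>_def)
  have "\<epsilon> \<le> \<eta> / (2 * (\<bar>t\<bar> + 1))" by (simp add: \<epsilon>_def)
  then have "\<epsilon> * (2 * (\<bar>t\<bar> + 1)) \<le> \<eta>" by (subst (asm) pos_le_divide_eq) auto
  then have t\<epsilon>: "\<bar>t\<bar> * \<epsilon> < \<eta> / 2 + \<epsilon> / 2 \<and> \<bar>t\<bar> * \<epsilon> + \<epsilon> \<le> \<eta> / 2"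
    using \<epsilon> by (simp add: algebra_simps)
  \<comment> \<open>Small root marks, block margins and the leftover piece will each contribute at
    most \<open>var_const * a * n k\<close> to the variance of the remainder. Three terms, times the
    factor 4 of \<open>char_normalized_diff_le\<close>, give 12.\<close>
  define a where "a = \<epsilon>\<^sup>2 * mean_const / (12 * var_const)"
  have a: "0 < a" "12 * var_const * a = \<epsilon>\<^sup>2 * mean_const"
    using \<epsilon> mean_const_pos var_const_pos by (simp_all add: a_def)
  define \<kappa> where "\<kappa> = a powr (1 / \<delta>)"
  have \<kappa>: "0 < \<kappa>" "\<kappa> powr \<delta> = a" using a \<delta>_pos by (simp_all add: \<kappa>_def powr_powr)
  define R where "R = m * (\<beta> / \<kappa>)"
  have R: "0 < R" using \<beta> \<kappa> m_pos by (simp add: R_def)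
  \<comment> \<open>The first summand makes the margins a fraction at most \<open>a\<close> of the
    blocks, the second keeps \<open>2 * R\<close> below \<open>L\<close>.\<close>
  define L where "L = 2 * R / a + 2 * R"
  have L: "0 < L" "2 * R \<le> L" using R a by (simp_all add: L_def add_pos_pos)
  have "2 * R \<le> a * L" using R a by (simp add: L_def algebra_simps)
  then have RL: "2 * R / L \<le> a" using L by (simp add: pos_divide_le_eq)
  define S where "S = (\<lambda>k \<omega>. \<Sum>b<num_blocks (n k) L. block_count (n k) L b (N k \<omega>))"
  define \<psi> where "\<psi> k = char (distr (M k) borel
      (\<lambda>\<omega>. (S k \<omega> - prob_space.expectation (M k) (S k)) / sqrt (prob_space.variance (M k) (S k)))) t" for k
  \<comment> \<open>The bound \<open>L / a\<close> makes the leftover piece at most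
    \<open>a * n k\<close>; \<open>2 * L\<close> is needed to compare distances within a
    block.\<close>
  have large: "eventually (\<lambda>k. max (L / a) (2 * L) \<le> n k) sequentially"
    using n(2) unfolding filterlim_at_top by blast
  have compare: "0 < prob_space.variance (M k) (S k) \<and> cmod (\<phi> k - \<psi> k) \<le> \<bar>t\<bar> * \<epsilon>"
    if k: "max (L / a) (2 * L) \<le> n k" for k
  proof -
    interpret P: separated_ppp "M k" "unit_intensity (n k)" "N k" dyadic_cell
      by (rule separated_ppp_unit[OF N])
    have n0: "0 < n k" "0 \<le> n k" using n(1)[of k] by simp_all
    have nL: "2 * L \<le> n k" "L \<le> n k" "L \<le> a * n k" using k L a by (simp_all add: pos_divide_le_eq mult.commute)
    have vT: "mean_const * n k \<le> P.variance (T k)"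
      unfolding T_def by (rule variance_bounds(1)[OF n(1) N])
    have rem: "real (card (tuples {1..m} (N k \<omega>) \<inter> remainder_event (n k) L)) = T k \<omega> - S k \<omega>"
      if "\<omega> \<in> space (M k)" for \<omega>
      using tree_event_card_split[OF L(1) nL(1), of "N k \<omega>"] P.points_finite[OF that] P.points_in_space[OF that]
      by (simp add: T_def S_def)
    have e: "P.expectation (\<lambda>\<omega>. real (card (tuples {1..m} (N k \<omega>) \<inter> remainder_event (n k) L))) = P.expectation (\<lambda>\<omega>. T k \<omega> - S k \<omega>)"
      by (rule Bochner_Integration.integral_cong[OF refl rem])
    have "P.variance (\<lambda>\<omega>. T k \<omega> - S k \<omega>) =
        P.variance (\<lambda>\<omega>. real (card (tuples {1..m} (N k \<omega>) \<inter> remainder_event (n k) L)))"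
      unfolding e using rem by (intro Bochner_Integration.integral_cong refl) simp
    also have "\<dots> \<le> var_const * ((L + 2 * R * n k / L) + \<kappa> powr \<delta> * n k)"
      by (rule remainder_variance_le[OF N \<kappa>(1) R_def L(2) nL(2)])
    also have "\<dots> \<le> var_const * ((a * n k + a * n k) + a * n k)"
    proof -
      have "2 * R / L * n k \<le> a * n k" using RL n0 by (intro mult_right_mono)
      then show ?thesis using nL(3) \<kappa>(2) var_const_pos by (intro mult_left_mono add_mono) auto
    qed
    finally have "4 * P.variance (\<lambda>\<omega>. T k \<omega> - S k \<omega>) \<le> 12 * var_const * a * n k" by (simp add: algebra_simps)
    also have "\<dots> = \<epsilon>\<^sup>2 * (mean_const * n k)" unfolding a(2) by simp
    also have "\<dots> \<le> \<epsilon>\<^sup>2 * P.variance (T k)" using vT by (intro mult_left_mono) auto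
    finally have close: "4 * P.variance (\<lambda>\<omega>. T k \<omega> - S k \<omega>) \<le> \<epsilon>\<^sup>2 * P.variance (T k)" .
    have pos: "0 < P.variance (T k)" using vT mean_const_pos n0 by (meson less_le_trans mult_pos_pos)
    note blk = block_count_properties[OF L(1) n0(2) N[of k]]
    have Sm: "S k \<in> borel_measurable (M k)"
      unfolding S_def using blk(1) by (intro borel_measurable_sum) auto
    note A = tree_event_measurable[OF n0(1)]
    have T2: "integrable (M k) (\<lambda>\<omega>. (T k \<omega>)\<^sup>2)" unfolding T_def by (rule P.tuple_moments(3)[OF A])
    have Tmeas: "T k \<in> borel_measurable (M k)" unfolding T_def by (rule P.tuple_moments(1)[OF A])
    have S2: "integrable (M k) (\<lambda>\<omega>. (S k \<omega>)\<^sup>2)"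
    proof (rule Bochner_Integration.integrable_bound[OF T2])
      show "AE \<omega> in M k. norm ((S k \<omega>)\<^sup>2) \<le> norm ((T k \<omega>)\<^sup>2)"
      proof (rule AE_I2)
        fix \<omega> assume "\<omega> \<in> space (M k)"
        from rem[OF this] have "S k \<omega> \<le> T k \<omega>" by linarith
        moreover have "0 \<le> S k \<omega>"
          unfolding S_def by (intro sum_nonneg) (simp add: block_count_def plain_count_def)
        ultimately show "norm ((S k \<omega>)\<^sup>2) \<le> norm ((T k \<omega>)\<^sup>2)" by (simp add: power_mono)
      qed
    qed (use Sm in auto)
    show ?thesis
      using P.char_normalized_diff_le[OF Tmeas Sm T2 S2 close \<epsilon> pos] unfolding \<phi>_def \<psi>_def by blast
  qed
  have "\<psi> \<longlonglongrightarrow> char std_normal_distribution t"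
    unfolding \<psi>_def S_def
  proof (rule char_block_sum_limit[OF L(1) N n])
    show "eventually (\<lambda>k. 0 < prob_space.variance (M k) (\<lambda>\<omega>. \<Sum>b<num_blocks (n k) L. block_count (n k) L b (N k \<omega>))) sequentially"
      using large by eventually_elim (use compare in \<open>auto simp: S_def\<close>)
  qed
  then have "eventually (\<lambda>k. dist (\<psi> k) (char std_normal_distribution t) < \<eta> / 2) sequentially"
    using \<eta> by (intro tendstoD) auto
  with large show "eventually (\<lambda>k. dist (\<phi> k) (char std_normal_distribution t) < \<eta>) sequentially"
  proof eventually_elim
    case (elim k)
    have "dist (\<phi> k) (\<psi> k) \<le> \<bar>t\<bar> * \<epsilon>" using compare[OF elim(1)] by (simp add: dist_norm)
    also have "\<dots> \<le> \<eta> / 2" using t\<epsilon> \<epsilon> by linarith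
    finally show ?case using elim(2) dist_triangle[of "\<phi> k" "char std_normal_distribution t" "\<psi> k"] by linarith
  qed
qed

end

theorem theorem2:
  fixes \<beta> \<gamma> :: real and m r :: nat and E :: "(nat \<times> nat) set"
  assumes "0 < \<beta>"
    and "directed_tree m r E"
    and "0 < \<gamma>"
    and "\<gamma> < 1 / (2 * real (num_leaves m E))"
  shows "(\<exists>c_lo c_hi. 0 < c_lo \<and> c_lo < c_hi \<and>
      (\<forall>n \<ge> 1. \<forall>(M :: 'w measure) N. poisson_point_process M (unit_intensity n) N \<longrightarrow>
        c_lo * n \<le> prob_space.variance M (\<lambda>\<omega>. real (tree_count n \<beta> \<gamma> m E (N \<omega>))) \<and>
        prob_space.variance M (\<lambda>\<omega>. real (tree_count n \<beta> \<gamma> m E (N \<omega>))) \<le> c_hi * n)) \<and>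
    (\<forall>(n :: nat \<Rightarrow> real) (M :: nat \<Rightarrow> 'w measure) N.
      (\<forall>k. 1 \<le> n k \<and> poisson_point_process (M k) (unit_intensity (n k)) (N k)) \<longrightarrow>
      filterlim n at_top sequentially \<longrightarrow>
      weak_conv_m
        (\<lambda>k. let T = (\<lambda>\<omega>. real (tree_count (n k) \<beta> \<gamma> m E (N k \<omega>))) in
          distr (M k) borel
            (\<lambda>\<omega>. (T \<omega> - prob_space.expectation (M k) T) / sqrt (prob_space.variance (M k) T)))
        std_normal_distribution)"
proof -
  obtain pa dep where tree: "rooted_tree m r pa dep" and E: "E = (\<lambda>v. (v, pa v)) ` ({1..m} - {r})"
    using directed_tree_rooted_tree[OF assms(2)] by blast
  interpret rooted_tree m r pa dep by (rule tree)
  have leaves: "num_leaves m E = leaves" by (rule leaves_eq[OF E])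
  have "0 < leaves" unfolding leaves_eq_sum by simp
  then have "\<gamma> * (2 * real leaves) < 1" using assms(4) unfolding leaves by (simp add: pos_less_divide_eq)
  then have "adrcm_tree m r pa dep \<beta> \<gamma>" using assms by unfold_locales (auto simp: mult.assoc mult.left_commute)
  then interpret adrcm_tree m r pa dep \<beta> \<gamma> .
  let ?T = "\<lambda>n (N :: 'w \<Rightarrow> _) \<omega>. real (tree_count n \<beta> \<gamma> m E (N \<omega>))"
  let ?T' = "\<lambda>n (N :: 'w \<Rightarrow> _) \<omega>. real (card (tuples {1..m} (N \<omega>) \<inter> tree_event n))"
  have T: "?T n N \<omega> = ?T' n N \<omega>" if "poisson_point_process M (unit_intensity n) N" "\<omega> \<in> space M"
    for n N \<omega> and M :: "'w measure"
    using tree_count_eq[OF _ E, of "N \<omega>" n] poisson_point_process.points_in_space[OF that] by simp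
  have mean: "prob_space.expectation M (?T n N) = prob_space.expectation M (?T' n N)"
    and var: "prob_space.variance M (?T n N) = prob_space.variance M (?T' n N)"
    if N: "poisson_point_process M (unit_intensity n) N" for n N and M :: "'w measure"
  proof -
    show m: "prob_space.expectation M (?T n N) = prob_space.expectation M (?T' n N)"
      by (rule Bochner_Integration.integral_cong[OF refl T[OF N]])
    show "prob_space.variance M (?T n N) = prob_space.variance M (?T' n N)"
      unfolding m using T[OF N] by (intro Bochner_Integration.integral_cong refl) simp
  qed
  show ?thesis
  \<comment> \<open>Adding \<open>mean_const\<close> to the upper constant secures the strict
    inequality between the two constants.\<close>
  proof (rule conjI, rule exI[of _ mean_const], rule exI[of _ "2 * var_const + mean_const"], intro conjI allI impI)
    show "0 < mean_const" by (rule mean_const_pos)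
    show "mean_const < 2 * var_const + mean_const" using var_const_pos by simp
    fix n :: real and M :: "'w measure" and N
    assume n: "1 \<le> n" and N: "poisson_point_process M (unit_intensity n) N"
    show "mean_const * n \<le> prob_space.variance M (?T n N)"
      unfolding var[OF N] by (rule variance_bounds(1)[OF n N])
    have "0 \<le> mean_const * n" using mean_const_pos n by simp
    then show "prob_space.variance M (?T n N) \<le> (2 * var_const + mean_const) * n"
      unfolding var[OF N] using variance_bounds(2)[OF n N] by (simp add: algebra_simps)
  next
    show "\<forall>(n :: nat \<Rightarrow> real) (M :: nat \<Rightarrow> 'w measure) N.
      (\<forall>k. 1 \<le> n k \<and> poisson_point_process (M k) (unit_intensity (n k)) (N k)) \<longrightarrow>
      filterlim n at_top sequentially \<longrightarrow>
      weak_conv_m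
        (\<lambda>k. let T = ?T (n k) (N k) in distr (M k) borel
            (\<lambda>\<omega>. (T \<omega> - prob_space.expectation (M k) T) / sqrt (prob_space.variance (M k) T)))
        std_normal_distribution"
    proof (intro allI impI)
      fix n :: "nat \<Rightarrow> real" and M :: "nat \<Rightarrow> 'w measure" and N
      assume *: "\<forall>k. 1 \<le> n k \<and> poisson_point_process (M k) (unit_intensity (n k)) (N k)"
        and lim: "filterlim n at_top sequentially"
      have n: "1 \<le> n k" and N: "poisson_point_process (M k) (unit_intensity (n k)) (N k)" for k using * by auto
      let ?W = "\<lambda>k. distr (M k) borel (\<lambda>\<omega>. (?T' (n k) (N k) \<omega> - prob_space.expectation (M k) (?T' (n k) (N k))) /
          sqrt (prob_space.variance (M k) (?T' (n k) (N k))))"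
      have eq: "(let T = ?T (n k) (N k) in distr (M k) borel
              (\<lambda>\<omega>. (T \<omega> - prob_space.expectation (M k) T) / sqrt (prob_space.variance (M k) T))) = ?W k" for k
        unfolding Let_def var[OF N] unfolding mean[OF N] using T[OF N] by (intro distr_cong) auto
      have "real_distribution (?W k)" for k
      proof -
        interpret separated_ppp "M k" "unit_intensity (n k)" "N k" dyadic_cell
          by (rule separated_ppp_unit[OF N])
        have "0 < n k" using n[of k] by simp
        from tuple_moments(1)[OF tree_event_measurable[OF this]]
        show ?thesis by (intro real_distribution_distr borel_measurable_divide borel_measurable_diff borel_measurable_const)
      qed
      then show "weak_conv_m (\<lambda>k. let T = ?T (n k) (N k) in distr (M k) borel
              (\<lambda>\<omega>. (T \<omega> - prob_space.expectation (M k) T) / sqrt (prob_space.variance (M k) T)))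
          std_normal_distribution"
        unfolding eq
        by (intro levy_continuity real_dist_normal_dist char_tree_count_limit N n lim)
    qed
  qed
qed

end
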